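(* Let $G_0$ and $G_1$ be the order-$k$ de Bruijn graphs of two string collections $\mathcal{C}_0$ and $\mathcal{C}_1$ over $\Sigma=\{1,\dots,\sigma\}$, given by their BOSS representations $\langle W_0,W_0^-,\mathsf{last}_0\rangle$ and $\langle W_1,W_1^-,\mathsf{last}_1\rangle$. Let $G_0$ have $n_0$ nodes and $G_1$ have $n_1$ nodes, and let the arrays of the two representations have lengths $m_0$ and $m_1$ respectively. Put $n=n_0+n_1$ and $m=m_0+m_1$. Then the BOSS representation of the order-$k$ de Bruijn graph of the union collection $\mathcal{C}_0\cup\mathcal{C}_1$ can be computed in $\mathcal{O}(mk)$ time using $4n$ bits plus $\mathcal{O}(\sigma)$ words of working space.
   Context: Model: word-RAM with word size $w$ and $\sigma=w^{\mathcal{O}(1)}$. Working space means the space used in addition to the space for the input and the output. De Bruijn graph: given a collection of strings over $\Sigma$, prepend to each string $k$ copies of a symbol $\$\notin\Sigma$ smaller than every symbol of $\Sigma$. The order-$k$ de Bruijn graph has one node $v$ for every distinct $k$-mer $v[1,k]$ occurring in one of the (padded) strings, and an edge $(u,v)$ labeled $v[k]$ iff some string contains the $(k+1)$-mer $u[1,k]\,v[k]$ (so $u[2,k]=v[1,k-1]$). For a node $v$ let $\overleftarrow{v}=v[k]v[k-1]\cdots v[1]$ be its reversed $k$-mer. BOSS representation: order the nodes $v_1,\dots,v_n$ so that $\overleftarrow{v_1}\prec\cdots\prec\overleftarrow{v_n}$ (lexicographic order, i.e. colexicographic order of the $k$-mers); let $W_i$ be the sorted sequence of labels of the edges leaving $v_i$,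 or the single symbol $\$$ if $v_i$ has out-degree $0$. Then $W=W_1W_2\cdots W_n$ (length $m$); $W^-[1,m]$ is the bitvector with $W^-[i]=1$ iff $W[i]$ is the label of an edge $(u,v)$ such that $u$ has the smallest rank among the nodes with an edge to $v$; $\mathsf{last}[1,m]$ has $\mathsf{last}[i]=1$ iff $i=m$ or $W[i]$ and $W[i+1]$ belong to different nodes. *)

theory Defs
  imports Main
    "HOL-Library.Sublist"
    "HOL-Library.List_Lexorder"
    "HOL-Library.Discrete_Functions"
begin

section \<open>De Bruijn graphs and their BOSS representation\<close>

text \<open>Symbols are natural numbers: the alphabet is \<open>{1..\<sigma>}\<close> and the padding symbol \<open>$\<close> is \<open>0\<close>,
  hence smaller than every symbol of the alphabet. A \<open>k\<close>-mer is a list of length \<open>k\<close> whose head is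
  its first symbol. Only the set of strings of a collection matters for its graph.\<close>

definition padded :: "nat \<Rightarrow> nat list \<Rightarrow> nat list" where
  "padded k s = replicate k 0 @ s"

definition nodes :: "nat \<Rightarrow> nat list set \<Rightarrow> nat list set" where
  "nodes k C = {v. length v = k \<and> (\<exists>s\<in>C. sublist v (padded k s))}"

definition edges :: "nat \<Rightarrow> nat list set \<Rightarrow> (nat list \<times> nat list) set" where
  "edges k C = {(u, v). u \<in> nodes k C \<and> v \<in> nodes k C \<and> tl u = butlast v \<and>
     (\<exists>s\<in>C. sublist (u @ [last v]) (padded k s))}"

definition edge_label :: "nat list \<times> nat list \<Rightarrow> nat" where
  "edge_label e = last (snd e)"

definition out_labels :: "nat \<Rightarrow> nat list set \<Rightarrow> nat list \<Rightarrow> nat set" where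
  "out_labels k C u = {edge_label (u, v) |v. (u, v) \<in> edges k C}"

text \<open>Lists are compared lexicographically (\<open>List_Lexorder\<close>), so sorting the reversed \<open>k\<close>-mers gives
  the colexicographic order.\<close>

definition node_list :: "nat \<Rightarrow> nat list set \<Rightarrow> nat list list" where
  "node_list k C = map rev (sorted_list_of_set (rev ` nodes k C))"

definition node_W :: "nat \<Rightarrow> nat list set \<Rightarrow> nat list \<Rightarrow> nat list" where
  "node_W k C u =
     (if out_labels k C u = {} then [0] else sorted_list_of_set (out_labels k C u))"

text \<open>The entries of \<open>W = W\<^sub>1 \<dots> W\<^sub>n\<close>, each paired with the node it belongs to.\<close>

definition entries :: "nat \<Rightarrow> nat list set \<Rightarrow> (nat list \<times> nat) list" where
  "entries k C = concat (map (\<lambda>u. map (Pair u) (node_W k C u)) (node_list k C))"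

text \<open>An entry \<open>(u, 0)\<close> standing for out-degree \<open>0\<close> is not the label of an edge and gets \<open>False\<close>.\<close>

definition minus_bit :: "nat \<Rightarrow> nat list set \<Rightarrow> nat list \<times> nat \<Rightarrow> bool" where
  "minus_bit k C = (\<lambda>(u, c). \<exists>v. (u, v) \<in> edges k C \<and> edge_label (u, v) = c \<and>
     (\<forall>u'. (u', v) \<in> edges k C \<longrightarrow> rev u \<le> rev u'))"

record boss =
  boss_W :: "nat list"
  boss_Wminus :: "bool list"
  boss_last :: "bool list"

definition BOSS :: "nat \<Rightarrow> nat list set \<Rightarrow> boss" where
  "BOSS k C = (let es = entries k C in
     \<lparr> boss_W = map snd es,
       boss_Wminus = map (minus_bit k C) es,
       boss_last = map (\<lambda>i. Suc i = length es \<or> fst (es ! i) \<noteq> fst (es ! Suc i)) [0..<length es] \<rparr>)"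

definition boss_arrays :: "boss \<Rightarrow> nat list list" where
  "boss_arrays B = [boss_W B, map of_bool (boss_Wminus B), map of_bool (boss_last B)]"


section \<open>The word-RAM\<close>

text \<open>A word is a natural number below \<open>2 ^ w\<close>. A program is a fixed finite text, independent of
  \<open>w\<close> and of the input; it uses finitely many registers and finitely many working arrays (memory
  segments) whose cells are words addressed by words, initially \<open>0\<close>. Input arrays can only be read
  and output arrays can only be written, so neither serves as additional working space.

  Every instruction and every branch test takes one time unit. All operations are the usual
  unit-cost ones; \<open>Msb\<close> (index of the most significant set bit) can be simulated by a
  constant number of the others, using constants that depend only on \<open>w\<close>.\<close>

datatype binop = Add | Sub | Mul | Div | Mod | And | Or | Xor | Shl | Shr | Less | Equal

datatype instr =
    Const nat nat          \<comment> \<open>register, constant\<close>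
  | Binop nat binop nat nat \<comment> \<open>destination register, operation, operand registers\<close>
  | Msb nat nat            \<comment> \<open>destination register, operand register\<close>
  | Input nat nat nat      \<comment> \<open>destination register, input array, index register\<close>
  | Load nat nat nat       \<comment> \<open>destination register, working array, index register\<close>
  | Store nat nat nat      \<comment> \<open>working array, index register, source register\<close>
  | Output nat nat nat     \<comment> \<open>output array, index register, source register\<close>

datatype prog =
    Instr instr
  | Seq prog prog
  | If nat prog prog
  | While nat prog

fun binop_val :: "nat \<Rightarrow> binop \<Rightarrow> nat \<Rightarrow> nat \<Rightarrow> nat" where
  "binop_val w Add a b = (a + b) mod 2 ^ w"
| "binop_val w Sub a b = (a + 2 ^ w - b) mod 2 ^ w"
| "binop_val w Mul a b = (a * b) mod 2 ^ w"
| "binop_val w Div a b = a div b"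
| "binop_val w Mod a b = a mod b"
| "binop_val w And a b = Bit_Operations.and a b"
| "binop_val w Or a b = Bit_Operations.or a b"
| "binop_val w Xor a b = Bit_Operations.xor a b"
| "binop_val w Shl a b = push_bit b a mod 2 ^ w"
| "binop_val w Shr a b = drop_bit b a"
| "binop_val w Less a b = of_bool (a < b)"
| "binop_val w Equal a b = of_bool (a = b)"

text \<open>\<open>extent s a\<close> is one plus the highest index of working array \<open>a\<close> accessed so far (by a load or
  a store), or \<open>0\<close> if there is none. A cell of an output array is \<open>None\<close> until it is written.\<close>

record state =
  regs :: "nat \<Rightarrow> nat"
  work :: "nat \<Rightarrow> nat \<Rightarrow> nat"
  extent :: "nat \<Rightarrow> nat"
  out :: "nat \<Rightarrow> nat \<Rightarrow> nat option"

definition set_reg :: "nat \<Rightarrow> nat \<Rightarrow> state \<Rightarrow> state" where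
  "set_reg r x s = s\<lparr>regs := (regs s)(r := x)\<rparr>"

definition touch :: "nat \<Rightarrow> nat \<Rightarrow> state \<Rightarrow> state" where
  "touch a i s = s\<lparr>extent := (extent s)(a := max (extent s a) (Suc i))\<rparr>"

text \<open>Reading an input array out of bounds is undefined.\<close>

fun step :: "nat \<Rightarrow> nat list list \<Rightarrow> instr \<Rightarrow> state \<Rightarrow> state option" where
  "step w inp (Const r x) s = Some (set_reg r (x mod 2 ^ w) s)"
| "step w inp (Binop r f p q) s = Some (set_reg r (binop_val w f (regs s p) (regs s q)) s)"
| "step w inp (Msb r p) s = Some (set_reg r (floor_log (regs s p)) s)"
| "step w inp (Input r a p) s =
     (if a < length inp \<and> regs s p < length (inp ! a)
      then Some (set_reg r (inp ! a ! regs s p) s) else None)"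
| "step w inp (Load r a p) s =
     Some (set_reg r (work s a (regs s p)) (touch a (regs s p) s))"
| "step w inp (Store a p r) s =
     Some ((touch a (regs s p) s)\<lparr>work := (work s)(a := (work s a)(regs s p := regs s r))\<rparr>)"
| "step w inp (Output a p r) s =
     Some (s\<lparr>out := (out s)(a := (out s a)(regs s p := Some (regs s r)))\<rparr>)"

text \<open>\<open>exec w inp P s t s'\<close>: started in \<open>s\<close>, program \<open>P\<close> halts in \<open>s'\<close> after exactly \<open>t\<close> time units.\<close>

inductive exec :: "nat \<Rightarrow> nat list list \<Rightarrow> prog \<Rightarrow> state \<Rightarrow> nat \<Rightarrow> state \<Rightarrow> bool"
  for w :: nat and inp :: "nat list list" where
  Instr: "step w inp i s = Some s' \<Longrightarrow> exec w inp (Instr i) s 1 s'"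
| Seq: "exec w inp P s t s' \<Longrightarrow> exec w inp Q s' t' s'' \<Longrightarrow> exec w inp (Seq P Q) s (t + t') s''"
| IfTrue: "regs s r \<noteq> 0 \<Longrightarrow> exec w inp P s t s' \<Longrightarrow> exec w inp (If r P Q) s (Suc t) s'"
| IfFalse: "regs s r = 0 \<Longrightarrow> exec w inp Q s t s' \<Longrightarrow> exec w inp (If r P Q) s (Suc t) s'"
| WhileTrue: "regs s r \<noteq> 0 \<Longrightarrow> exec w inp P s t s' \<Longrightarrow> exec w inp (While r P) s' t' s'' \<Longrightarrow>
    exec w inp (While r P) s (Suc (t + t')) s''"
| WhileFalse: "regs s r = 0 \<Longrightarrow> exec w inp (While r P) s 1 s"

lemma exec_deterministic:
  assumes "exec w inp P s t s'" and "exec w inp P s u s''"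
  shows "t = u \<and> s' = s''"
  using assms
proof (induction arbitrary: u s'' rule: exec.induct)
  case (Instr i s s')
  from Instr.prems show ?case by (cases rule: exec.cases) (use Instr.hyps in simp_all)
next
  case (Seq P s t s' Q t' s3)
  from Seq.prems show ?case
    by (cases rule: exec.cases) (simp_all, metis Seq.IH)
next
  case (IfTrue s r P t s' Q)
  from IfTrue.prems show ?case
    by (cases rule: exec.cases) (use IfTrue.hyps(1) IfTrue.IH in simp_all)
next
  case (IfFalse s r Q t s' P)
  from IfFalse.prems show ?case
    by (cases rule: exec.cases) (use IfFalse.hyps(1) IfFalse.IH in simp_all)
next
  case (WhileTrue s r P t s' t' s3)
  from WhileTrue.prems show ?case
    by (cases rule: exec.cases) (use WhileTrue.hyps(1) in simp_all, metis WhileTrue.IH)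
next
  case (WhileFalse s r P)
  from WhileFalse.prems show ?case
    by (cases rule: exec.cases) (use WhileFalse.hyps in simp_all)
qed

text \<open>The first registers initially hold the given parameters, all other registers hold \<open>0\<close>.\<close>

definition init_state :: "nat list \<Rightarrow> state" where
  "init_state params =
     \<lparr> regs = (\<lambda>r. if r < length params then params ! r else 0),
       work = (\<lambda>_ _. 0), extent = (\<lambda>_. 0), out = (\<lambda>_ _. None) \<rparr>"

definition output_is :: "state \<Rightarrow> nat list list \<Rightarrow> bool" where
  "output_is s xss \<longleftrightarrow>
     (\<forall>a i. out s a i = (if a < length xss \<and> i < length (xss ! a) then Some (xss ! a ! i) else None))"

fun instr_regs :: "instr \<Rightarrow> nat set" where
  "instr_regs (Const r x) = {r}"
| "instr_regs (Binop r f p q) = {r, p, q}"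
| "instr_regs (Msb r p) = {r, p}"
| "instr_regs (Input r a p) = {r, p}"
| "instr_regs (Load r a p) = {r, p}"
| "instr_regs (Store a p r) = {p, r}"
| "instr_regs (Output a p r) = {p, r}"

fun instr_arrays :: "instr \<Rightarrow> nat set" where
  "instr_arrays (Load r a p) = {a}"
| "instr_arrays (Store a p r) = {a}"
| "instr_arrays _ = {}"

fun prog_regs :: "prog \<Rightarrow> nat set" where
  "prog_regs (Instr i) = instr_regs i"
| "prog_regs (Seq P Q) = prog_regs P \<union> prog_regs Q"
| "prog_regs (If r P Q) = insert r (prog_regs P \<union> prog_regs Q)"
| "prog_regs (While r P) = insert r (prog_regs P)"

fun prog_arrays :: "prog \<Rightarrow> nat set" where
  "prog_arrays (Instr i) = instr_arrays i"
| "prog_arrays (Seq P Q) = prog_arrays P \<union> prog_arrays Q"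
| "prog_arrays (If r P Q) = prog_arrays P \<union> prog_arrays Q"
| "prog_arrays (While r P) = prog_arrays P"

text \<open>Working space in bits of a run of \<open>P\<close> that halts in \<open>s\<close>: all registers of \<open>P\<close> and all working
  arrays up to their highest accessed cell, \<open>w\<close> bits per word. As \<open>extent\<close> never decreases during a
  run, the final state determines the space of the whole run.\<close>

definition work_bits :: "nat \<Rightarrow> prog \<Rightarrow> state \<Rightarrow> nat" where
  "work_bits w P s = w * (card (prog_regs P) + (\<Sum>a\<in>prog_arrays P. extent s a))"

text \<open>Given \<open>BOSS\<close> representations \<open>B0\<close> and \<open>B1\<close> in the input arrays, \<open>P\<close> halts within time \<open>T\<close> and
  working space \<open>S\<close> (in bits) with exactly the arrays of \<open>B\<close> in the output arrays. The program
  is told the two array lengths, the order, the alphabet size and the word size.\<close>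

definition merges_within ::
    "prog \<Rightarrow> nat \<Rightarrow> nat \<Rightarrow> nat \<Rightarrow> boss \<Rightarrow> boss \<Rightarrow> boss \<Rightarrow> nat \<Rightarrow> nat \<Rightarrow> bool" where
  "merges_within P w \<sigma> k B0 B1 B T S \<longleftrightarrow>
     (\<exists>t s. exec w (boss_arrays B0 @ boss_arrays B1) P
              (init_state [length (boss_W B0), length (boss_W B1), k, \<sigma>, w]) t s \<and>
            output_is s (boss_arrays B) \<and> t \<le> T \<and> work_bits w P s \<le> S)"

end

(*
  Merge the two sorted node lists by radix refinement. Let M h be the stable merge of the node lists
  in which a node v is represented by the first h symbols of its reversal. Every node except the root
  $^k is the target of exactly one edge with W^- = 1, and extending the key by one symbol prepends the
  label of that edge to the key of its source. Hence M (h + 1) arises from M h by a counting sort of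
  the targets by label, in one scan of the m entries; a new key block starts exactly where a label is
  met for the first time within a block of M h. Besides the entries themselves, this needs two
  bitvectors for M h (origin of the nodes, starts of the blocks) and two for M (h + 1), that is, 4n
  bits, and O(sigma) counters. In M k equal nodes are adjacent, so that the union graph is written in
  one scan; an output entry gets W^- = 1 iff its label is new within its block of order k - 1.

  Time O(mk) leaves no room for O(sigma) initialization. The distinct labels are therefore sorted in
  advance by descending a w-ary trie whose inner nodes are single words: as sigma is polynomial in w,
  the trie has constant depth, and the children of an inner node are listed with Msb.
*)
theory Submission
  imports Defs "HOL-Library.Product_Lexorder" "HOL-Library.Multiset"
begin

section \<open>Structured programs and their weakest preconditions\<close>

text \<open>Neither nodes nor keys are ever stored. Truncating reversals is monotone, so every
  \<open>M h\<close> restricted to one graph is that graph's own BOSS order; one origin bit per node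
  and one read pointer per input therefore reproduce the merged entries. In the proof, ties are
  broken by graph and full reversal, so that merges are strictly sorted and every position is a
  rank.

  Block starts of order \<open>h\<close> keep their positions in all later merges. After the last
  round the old vector of block starts, of order \<open>k - 1\<close>, can thus be read along
  \<open>M k\<close>. This yields the W^- bits of the union, which cannot simply be copied from the
  inputs: a target present in both graphs has an edge with W^- = 1 in each.

  Blocks are numbered by the index of their first node plus one. Numbers then ascend during a scan,
  and one cell per label, holding the last block in which the label was met, recognises first
  occurrences.

  Space is verified along with the result by fixing in advance how far each array may be
  accessed.\<close>

datatype exp = K nat | V nat | Op binop exp exp | MS exp | Ld nat exp | In nat exp

text \<open>The machine has no empty instruction; writing a scratch register is invisible to the
  precondition.\<close>

definition skip :: prog where
  "skip = Instr (Const 40 0)"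

text \<open>Registers below \<open>40\<close> hold the variables of a program, the others intermediate results.\<close>

fun comp_exp :: "exp \<Rightarrow> nat \<Rightarrow> prog" where
  "comp_exp (K x) d = Instr (Const d x)"
| "comp_exp (V r) d = Instr (Binop d And r r)"
| "comp_exp (Op f a b) d =
     Seq (comp_exp a d) (Seq (comp_exp b (Suc d)) (Instr (Binop d f d (Suc d))))"
| "comp_exp (MS a) d = Seq (comp_exp a d) (Instr (Msb d d))"
| "comp_exp (Ld a e) d = Seq (comp_exp e d) (Instr (Load d a d))"
| "comp_exp (In a e) d = Seq (comp_exp e d) (Instr (Input d a d))"

fun cost :: "exp \<Rightarrow> nat" where
  "cost (K x) = 1"
| "cost (V r) = 1"
| "cost (Op f a b) = cost a + cost b + 1"
| "cost (MS a) = cost a + 1"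
| "cost (Ld a e) = cost e + 1"
| "cost (In a e) = cost e + 1"

text \<open>\<open>And\<close> of a register with itself stands for the missing move instruction: it
  returns the word unchanged, whatever its size.\<close>

definition asg :: "nat \<Rightarrow> exp \<Rightarrow> prog" (infix "::=" 62) where
  "r ::= e = Seq (comp_exp e 40) (Instr (Binop r And 40 40))"

definition sto :: "nat \<Rightarrow> exp \<Rightarrow> exp \<Rightarrow> prog" where
  "sto a e f = Seq (comp_exp e 40) (Seq (comp_exp f 41) (Instr (Store a 40 41)))"

definition outp :: "nat \<Rightarrow> exp \<Rightarrow> exp \<Rightarrow> prog" where
  "outp a e f = Seq (comp_exp e 40) (Seq (comp_exp f 41) (Instr (Output a 40 41)))"

definition ite :: "exp \<Rightarrow> prog \<Rightarrow> prog \<Rightarrow> prog" where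
  "ite e P Q = Seq (comp_exp e 40) (If 40 P Q)"

text \<open>\<open>While\<close> tests only a register, so the condition is evaluated once before
  the loop and again at the end of each body.\<close>

definition loop :: "exp \<Rightarrow> prog \<Rightarrow> prog" where
  "loop e P = Seq (comp_exp e 40) (While 40 (Seq P (comp_exp e 40)))"

abbreviation seq :: "prog \<Rightarrow> prog \<Rightarrow> prog" (infixr ";;" 60) where
  "P ;; Q \<equiv> Seq P Q"

text \<open>Values are taken in unbounded arithmetic; \<open>op_ok\<close> rules out wrap-around.\<close>

fun op_val :: "binop \<Rightarrow> nat \<Rightarrow> nat \<Rightarrow> nat" where
  "op_val Add a b = a + b"
| "op_val Sub a b = a - b"
| "op_val Mul a b = a * b"
| "op_val Div a b = a div b"
| "op_val Mod a b = a mod b"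
| "op_val And a b = Bit_Operations.and a b"
| "op_val Or a b = Bit_Operations.or a b"
| "op_val Xor a b = Bit_Operations.xor a b"
| "op_val Shl a b = push_bit b a"
| "op_val Shr a b = drop_bit b a"
| "op_val Less a b = of_bool (a < b)"
| "op_val Equal a b = of_bool (a = b)"

type_synonym mem = "nat \<Rightarrow> nat \<Rightarrow> nat"
type_synonym outs = "nat \<Rightarrow> nat \<Rightarrow> nat option"

text \<open>\<open>xb a\<close> bounds the cells of array \<open>a\<close> and is chosen before the
  run. As every access must respect it, the space is verified together with the result, although
  extents do not appear in assertions.\<close>

locale word_ram =
  fixes w :: nat and inp :: "nat list list" and xb :: "nat \<Rightarrow> nat"
begin

fun op_ok :: "binop \<Rightarrow> nat \<Rightarrow> nat \<Rightarrow> bool" where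
  "op_ok Add a b \<longleftrightarrow> a + b < 2 ^ w"
| "op_ok Sub a b \<longleftrightarrow> b \<le> a \<and> a < 2 ^ w"
| "op_ok Mul a b \<longleftrightarrow> a * b < 2 ^ w"
| "op_ok Shl a b \<longleftrightarrow> push_bit b a < 2 ^ w"
| "op_ok _ _ _ \<longleftrightarrow> True"

lemma binop_val_eq: "op_ok f a b \<Longrightarrow> binop_val w f a b = op_val f a b"
  by (cases f) (auto simp: le_mod_geq)

fun ev :: "exp \<Rightarrow> (nat \<Rightarrow> nat) \<Rightarrow> mem \<Rightarrow> nat" where
  "ev (K x) R W = x"
| "ev (V r) R W = R r"
| "ev (Op f a b) R W = op_val f (ev a R W) (ev b R W)"
| "ev (MS a) R W = floor_log (ev a R W)"
| "ev (Ld a e) R W = W a (ev e R W)"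
| "ev (In a e) R W = inp ! a ! ev e R W"

fun ok :: "exp \<Rightarrow> (nat \<Rightarrow> nat) \<Rightarrow> mem \<Rightarrow> bool" where
  "ok (K x) R W \<longleftrightarrow> x < 2 ^ w"
| "ok (V r) R W \<longleftrightarrow> r < 40"
| "ok (Op f a b) R W \<longleftrightarrow> ok a R W \<and> ok b R W \<and> op_ok f (ev a R W) (ev b R W)"
| "ok (MS a) R W \<longleftrightarrow> ok a R W"
| "ok (Ld a e) R W \<longleftrightarrow> ok e R W \<and> ev e R W < xb a"
| "ok (In a e) R W \<longleftrightarrow> ok e R W \<and> a < length inp \<and> ev e R W < length (inp ! a)"

definition fits :: "state \<Rightarrow> bool" where
  "fits s \<longleftrightarrow> (\<forall>a. extent s a \<le> xb a)"

lemma exec_Instr: "step w inp i s = Some s' \<Longrightarrow> t = 1 \<Longrightarrow> exec w inp (Instr i) s t s'"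
  by (simp only: exec.Instr)

text \<open>Evaluation into \<open>d\<close> uses the registers from \<open>d\<close> on as a stack:
  the first operand waits in \<open>d\<close> while the second is computed in \<open>Suc d\<close>.
  Hence everything below \<open>d\<close> survives.\<close>

lemma exec_comp_exp:
  assumes "ok e R W" and "\<forall>x<40. regs s x = R x" and "work s = W" and "fits s" and "40 \<le> d"
  shows "\<exists>s'. exec w inp (comp_exp e d) s (cost e) s' \<and> regs s' d = ev e R W \<and>
    (\<forall>x<d. regs s' x = regs s x) \<and> work s' = work s \<and> out s' = out s \<and> fits s'"
  using assms
proof (induction e arbitrary: s d)
  case (K x)
  show ?case
    by (rule exI[of _ "set_reg d (x mod 2 ^ w) s"], intro conjI)
      (use K in \<open>auto simp: set_reg_def fits_def intro!: exec_Instr\<close>)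
next
  case (V r)
  show ?case
    by (rule exI[of _ "set_reg d (regs s r) s"], intro conjI)
      (use V in \<open>auto simp: set_reg_def fits_def intro!: exec_Instr\<close>)
next
  case (Op f a b)
  from Op.IH(1)[of s d] Op.prems obtain s1 where
    1: "exec w inp (comp_exp a d) s (cost a) s1" "regs s1 d = ev a R W"
      "\<forall>x<d. regs s1 x = regs s x" "work s1 = work s" "out s1 = out s" "fits s1" by auto
  from Op.IH(2)[of s1 "Suc d"] Op.prems 1 obtain s2 where
    2: "exec w inp (comp_exp b (Suc d)) s1 (cost b) s2" "regs s2 (Suc d) = ev b R W"
      "\<forall>x<Suc d. regs s2 x = regs s1 x" "work s2 = work s1" "out s2 = out s1" "fits s2" by auto
  let ?s = "set_reg d (ev (Op f a b) R W) s2"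
  have "exec w inp (Instr (Binop d f d (Suc d))) s2 1 ?s"
    using Op.prems 1 2 by (auto intro!: exec_Instr simp: binop_val_eq)
  from exec.Seq[OF 1(1) exec.Seq[OF 2(1) this]] show ?case
    by (intro exI[of _ ?s]) (use Op.prems 1 2 in \<open>auto simp: set_reg_def fits_def add.assoc\<close>)
next
  case (MS a)
  from MS.IH[of s d] MS.prems obtain s1 where
    1: "exec w inp (comp_exp a d) s (cost a) s1" "regs s1 d = ev a R W"
      "\<forall>x<d. regs s1 x = regs s x" "work s1 = work s" "out s1 = out s" "fits s1" by auto
  let ?s = "set_reg d (ev (MS a) R W) s1"
  have "exec w inp (Instr (Msb d d)) s1 1 ?s"
    using 1 by (auto intro!: exec_Instr)
  from exec.Seq[OF 1(1) this] show ?case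
    by (intro exI[of _ ?s]) (use 1 in \<open>auto simp: set_reg_def fits_def\<close>)
next
  case (Ld a e)
  from Ld.IH[of s d] Ld.prems obtain s1 where
    1: "exec w inp (comp_exp e d) s (cost e) s1" "regs s1 d = ev e R W"
      "\<forall>x<d. regs s1 x = regs s x" "work s1 = work s" "out s1 = out s" "fits s1" by auto
  let ?s = "set_reg d (ev (Ld a e) R W) (touch a (ev e R W) s1)"
  have "exec w inp (Instr (Load d a d)) s1 1 ?s"
    using 1 Ld.prems by (auto intro!: exec_Instr)
  from exec.Seq[OF 1(1) this] show ?case
    by (intro exI[of _ ?s]) (use 1 Ld.prems in \<open>auto simp: set_reg_def fits_def touch_def\<close>)
next
  case (In a e)
  from In.IH[of s d] In.prems obtain s1 where
    1: "exec w inp (comp_exp e d) s (cost e) s1" "regs s1 d = ev e R W"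
      "\<forall>x<d. regs s1 x = regs s x" "work s1 = work s" "out s1 = out s" "fits s1" by auto
  let ?s = "set_reg d (ev (In a e) R W) s1"
  have "exec w inp (Instr (Input d a d)) s1 1 ?s"
    using 1 In.prems by (auto intro!: exec_Instr)
  from exec.Seq[OF 1(1) this] show ?case
    by (intro exI[of _ ?s]) (use 1 In.prems in \<open>auto simp: set_reg_def fits_def\<close>)
qed

text \<open>The precondition hides the intermediate registers and the extents, which have to stay within
  \<open>xb\<close>; \<open>t\<close> is the time that has passed.\<close>

definition wp :: "prog \<Rightarrow> (nat \<Rightarrow> (nat \<Rightarrow> nat) \<Rightarrow> mem \<Rightarrow> outs \<Rightarrow> bool) \<Rightarrow>
    nat \<Rightarrow> (nat \<Rightarrow> nat) \<Rightarrow> mem \<Rightarrow> outs \<Rightarrow> bool" where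
  "wp P Q t R W X \<longleftrightarrow> (\<forall>s. (\<forall>x<40. regs s x = R x) \<and> work s = W \<and> out s = X \<and> fits s \<longrightarrow>
     (\<exists>u s' R'. exec w inp P s u s' \<and> fits s' \<and> (\<forall>x<40. regs s' x = R' x) \<and>
        Q (t + u) R' (work s') (out s')))"

section \<open>Proof rules with elapsed time\<close>

lemma wp_conseq:
  assumes "wp P Q t R W X" and "\<And>t R W X. Q t R W X \<Longrightarrow> Q' t R W X"
  shows "wp P Q' t R W X"
  unfolding wp_def
proof (intro allI impI)
  fix s assume "(\<forall>x<40. regs s x = R x) \<and> work s = W \<and> out s = X \<and> fits s"
  with assms(1) obtain u s' R' where "exec w inp P s u s'" "fits s'" "\<forall>x<40. regs s' x = R' x"
    "Q (t + u) R' (work s') (out s')" unfolding wp_def by blast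
  with assms(2) show "\<exists>u s' R'. exec w inp P s u s' \<and> fits s' \<and> (\<forall>x<40. regs s' x = R' x) \<and>
        Q' (t + u) R' (work s') (out s')" by blast
qed

lemma wp_seq:
  assumes "wp P (\<lambda>t R W X. wp P' Q t R W X) t R W X"
  shows "wp (P ;; P') Q t R W X"
  unfolding wp_def
proof (intro allI impI)
  fix s assume s: "(\<forall>x<40. regs s x = R x) \<and> work s = W \<and> out s = X \<and> fits s"
  with assms obtain u s1 R1 where 1: "exec w inp P s u s1" "fits s1"
    "\<forall>x<40. regs s1 x = R1 x" "wp P' Q (t + u) R1 (work s1) (out s1)" unfolding wp_def by blast
  then obtain u' s2 R2 where 2: "exec w inp P' s1 u' s2" "fits s2"
    "\<forall>x<40. regs s2 x = R2 x" "Q (t + u + u') R2 (work s2) (out s2)"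
    unfolding wp_def by blast
  show "\<exists>u s' R'. exec w inp (P ;; P') s u s' \<and> fits s' \<and> (\<forall>x<40. regs s' x = R' x) \<and>
        Q (t + u) R' (work s') (out s')"
    using exec.Seq[OF 1(1) 2(1)] 2 by (metis add.assoc)
qed

text \<open>Common beginning of assignments, tests and loops: after the evaluation the value is in
  register 40 and the visible state is unchanged.\<close>

lemma wp_comp_exp:
  assumes "ok e R W" and "\<And>s s' :: state. (\<forall>x<40. regs s x = R x) \<and> work s = W \<and> out s = X \<and> fits s \<Longrightarrow>
    exec w inp (comp_exp e 40) s (cost e) s' \<Longrightarrow> regs s' 40 = ev e R W \<Longrightarrow>
    (\<forall>x<40. regs s' x = R x) \<and> work s' = W \<and> out s' = X \<and> fits s' \<Longrightarrow>
    \<exists>u s'' R'. exec w inp P s' u s'' \<and> fits s'' \<and> (\<forall>x<40. regs s'' x = R' x) \<and>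
        Q (t + cost e + u) R' (work s'') (out s'')"
  shows "wp (comp_exp e 40 ;; P) Q t R W X"
  unfolding wp_def
proof (intro allI impI)
  fix s assume s: "(\<forall>x<40. regs s x = R x) \<and> work s = W \<and> out s = X \<and> fits s"
  then obtain s1 where 1: "exec w inp (comp_exp e 40) s (cost e) s1" "regs s1 40 = ev e R W"
    "\<forall>x<40. regs s1 x = regs s x" "work s1 = work s" "out s1 = out s" "fits s1"
    using exec_comp_exp[of e R W s 40] assms(1) by auto
  with assms(2)[OF s 1(1)] s obtain u s2 R' where "exec w inp P s1 u s2" "fits s2"
    "\<forall>x<40. regs s2 x = R' x" "Q (t + cost e + u) R' (work s2) (out s2)" by auto
  then show "\<exists>u s' R'. exec w inp (comp_exp e 40 ;; P) s u s' \<and> fits s' \<and>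
      (\<forall>x<40. regs s' x = R' x) \<and> Q (t + u) R' (work s') (out s')"
    using exec.Seq[OF 1(1)] by (metis add.assoc)
qed

lemma wp_skip:
  assumes "Q (t + 1) R W X"
  shows "wp skip Q t R W X"
  unfolding wp_def
proof (intro allI impI)
  fix s assume s: "(\<forall>x<40. regs s x = R x) \<and> work s = W \<and> out s = X \<and> fits s"
  have "exec w inp skip s 1 (set_reg 40 0 s)"
    unfolding skip_def by (rule exec.Instr) simp
  with s assms show "\<exists>u s' R'. exec w inp skip s u s' \<and> fits s' \<and>
      (\<forall>x<40. regs s' x = R' x) \<and> Q (t + u) R' (work s') (out s')"
    by (intro exI[of _ 1] exI[of _ "set_reg 40 0 s"] exI[of _ R])
      (auto simp: set_reg_def fits_def)
qed

lemma wp_asg: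
  assumes "ok e R W" and "r < 40" and "Q (t + (cost e + 1)) (R(r := ev e R W)) W X"
  shows "wp (r ::= e) Q t R W X"
  unfolding asg_def
proof (rule wp_comp_exp[OF assms(1)])
  fix s s' :: state
  assume "(\<forall>x<40. regs s' x = R x) \<and> work s' = W \<and> out s' = X \<and> fits s'"
    and "regs s' 40 = ev e R W"
  then show "\<exists>u s'' R'. exec w inp (Instr (Binop r And 40 40)) s' u s'' \<and> fits s'' \<and>
      (\<forall>x<40. regs s'' x = R' x) \<and> Q (t + cost e + u) R' (work s'') (out s'')"
    by (intro exI[of _ 1] exI[of _ "set_reg r (ev e R W) s'"] exI[of _ "R(r := ev e R W)"])
      (use assms in \<open>auto simp: set_reg_def fits_def add.assoc intro!: exec_Instr\<close>)
qed

text \<open>The second expression is evaluated from register 41 on, so the index in register 40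
  survives.\<close>

lemma exec_store_exps:
  assumes "ok e R W" and "ok f R W" and s: "\<forall>x<40. regs s x = R x" "work s = W" "fits s"
  obtains s' where "exec w inp (comp_exp e 40) s (cost e) s'" and
    "\<exists>s''. exec w inp (comp_exp f 41) s' (cost f) s'' \<and> regs s'' 40 = ev e R W \<and>
      regs s'' 41 = ev f R W \<and> (\<forall>x<40. regs s'' x = R x) \<and> work s'' = W \<and> out s'' = out s \<and>
      fits s''"
proof -
  obtain s1 where 1: "exec w inp (comp_exp e 40) s (cost e) s1" "regs s1 40 = ev e R W"
    "\<forall>x<40. regs s1 x = regs s x" "work s1 = work s" "out s1 = out s" "fits s1"
    using exec_comp_exp[of e R W s 40] assms by auto
  obtain s2 where 2: "exec w inp (comp_exp f 41) s1 (cost f) s2" "regs s2 41 = ev f R W"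
    "\<forall>x<41. regs s2 x = regs s1 x" "work s2 = work s1" "out s2 = out s1" "fits s2"
    using exec_comp_exp[of f R W s1 41] assms 1 by auto
  show ?thesis
    by (rule that[OF 1(1)], rule exI[of _ s2]) (use 1 2 s in auto)
qed

lemma wp_sto:
  assumes "ok e R W" and "ok f R W" and "ev e R W < xb a"
    and "Q (t + (cost e + cost f + 1)) R (W(a := (W a)(ev e R W := ev f R W))) X"
  shows "wp (sto a e f) Q t R W X"
  unfolding wp_def
proof (intro allI impI)
  fix s assume s: "(\<forall>x<40. regs s x = R x) \<and> work s = W \<and> out s = X \<and> fits s"
  then obtain s1 s2 where 1: "exec w inp (comp_exp e 40) s (cost e) s1"
    and 2: "exec w inp (comp_exp f 41) s1 (cost f) s2" "regs s2 40 = ev e R W"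
      "regs s2 41 = ev f R W" "\<forall>x<40. regs s2 x = R x" "work s2 = W" "out s2 = X" "fits s2"
    using exec_store_exps[OF assms(1,2)] by metis
  let ?s = "(touch a (ev e R W) s2)\<lparr>work := W(a := (W a)(ev e R W := ev f R W))\<rparr>"
  have 3: "exec w inp (Instr (Store a 40 41)) s2 1 ?s"
    using 2 by (auto intro!: exec_Instr)
  show "\<exists>u s' R'. exec w inp (sto a e f) s u s' \<and> fits s' \<and>
      (\<forall>x<40. regs s' x = R' x) \<and> Q (t + u) R' (work s') (out s')"
    unfolding sto_def
    by (rule exI, rule exI[of _ ?s], rule exI[of _ R], intro conjI, rule exec.Seq[OF 1 exec.Seq[OF 2(1) 3]])
      (use assms 2 in \<open>auto simp: fits_def touch_def add.assoc\<close>)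
qed

lemma wp_outp:
  assumes "ok e R W" and "ok f R W"
    and "Q (t + (cost e + cost f + 1)) R W (X(a := (X a)(ev e R W := Some (ev f R W))))"
  shows "wp (outp a e f) Q t R W X"
  unfolding wp_def
proof (intro allI impI)
  fix s assume s: "(\<forall>x<40. regs s x = R x) \<and> work s = W \<and> out s = X \<and> fits s"
  then obtain s1 s2 where 1: "exec w inp (comp_exp e 40) s (cost e) s1"
    and 2: "exec w inp (comp_exp f 41) s1 (cost f) s2" "regs s2 40 = ev e R W"
      "regs s2 41 = ev f R W" "\<forall>x<40. regs s2 x = R x" "work s2 = W" "out s2 = X" "fits s2"
    using exec_store_exps[OF assms(1,2)] by metis
  let ?s = "s2\<lparr>out := X(a := (X a)(ev e R W := Some (ev f R W)))\<rparr>"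
  have 3: "exec w inp (Instr (Output a 40 41)) s2 1 ?s"
    using 2 by (auto intro!: exec_Instr)
  show "\<exists>u s' R'. exec w inp (outp a e f) s u s' \<and> fits s' \<and>
      (\<forall>x<40. regs s' x = R' x) \<and> Q (t + u) R' (work s') (out s')"
    unfolding outp_def
    by (rule exI, rule exI[of _ ?s], rule exI[of _ R], intro conjI, rule exec.Seq[OF 1 exec.Seq[OF 2(1) 3]])
      (use assms 2 in \<open>auto simp: fits_def add.assoc\<close>)
qed

lemma wp_ite:
  assumes "ok e R W"
    and "ev e R W \<noteq> 0 \<Longrightarrow> wp P Q (t + (cost e + 1)) R W X"
    and "ev e R W = 0 \<Longrightarrow> wp P' Q (t + (cost e + 1)) R W X"
  shows "wp (ite e P P') Q t R W X"
  unfolding ite_def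
proof (rule wp_comp_exp[OF assms(1)])
  fix s s' :: state
  assume s': "(\<forall>x<40. regs s' x = R x) \<and> work s' = W \<and> out s' = X \<and> fits s'"
    and 40: "regs s' 40 = ev e R W"
  show "\<exists>u s'' R'. exec w inp (If 40 P P') s' u s'' \<and> fits s'' \<and>
      (\<forall>x<40. regs s'' x = R' x) \<and> Q (t + cost e + u) R' (work s'') (out s'')"
  proof (cases "ev e R W = 0")
    case True
    with assms(3) s' obtain u s'' R' where *: "exec w inp P' s' u s''" "fits s''"
      "\<forall>x<40. regs s'' x = R' x" "Q (t + (cost e + 1) + u) R' (work s'') (out s'')"
      unfolding wp_def by blast
    show ?thesis
      by (rule exI[of _ "Suc u"], rule exI[of _ s''], rule exI[of _ R'])
        (use * exec.IfFalse[of s' 40 w inp P' u s''] True 40 in auto)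
  next
    case False
    with assms(2) s' obtain u s'' R' where *: "exec w inp P s' u s''" "fits s''"
      "\<forall>x<40. regs s'' x = R' x" "Q (t + (cost e + 1) + u) R' (work s'') (out s'')"
      unfolding wp_def by blast
    show ?thesis
      by (rule exI[of _ "Suc u"], rule exI[of _ s''], rule exI[of _ R'])
        (use * exec.IfTrue[of s' 40 w inp P u s''] False 40 in auto)
  qed
qed

lemma wp_loop_unfold:
  assumes "ok e R W"
    and "ev e R W \<noteq> 0 \<Longrightarrow> wp P (\<lambda>t R W X. wp (loop e P) Q t R W X) (t + (cost e + 1)) R W X"
    and "ev e R W = 0 \<Longrightarrow> Q (t + (cost e + 1)) R W X"
  shows "wp (loop e P) Q t R W X"
  unfolding loop_def
proof (rule wp_comp_exp[OF assms(1)])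
  fix s s' :: state
  assume s': "(\<forall>x<40. regs s' x = R x) \<and> work s' = W \<and> out s' = X \<and> fits s'"
    and 40: "regs s' 40 = ev e R W"
  let ?b = "P ;; comp_exp e 40"
  show "\<exists>u s'' R'. exec w inp (While 40 ?b) s' u s'' \<and> fits s'' \<and>
      (\<forall>x<40. regs s'' x = R' x) \<and> Q (t + cost e + u) R' (work s'') (out s'')"
  proof (cases "ev e R W = 0")
    case True
    then show ?thesis
      by (intro exI[of _ 1] exI[of _ s'] exI[of _ R])
        (use assms(3) s' 40 exec.WhileFalse[of s' 40] in \<open>auto simp: add.assoc\<close>)
  next
    case False
    with assms(2) s' obtain u s1 R1 where 1: "exec w inp P s' u s1" "fits s1"
      "\<forall>x<40. regs s1 x = R1 x" "wp (loop e P) Q (t + (cost e + 1) + u) R1 (work s1) (out s1)"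
      unfolding wp_def by blast
    then obtain u' s2 R2 where 2: "exec w inp (loop e P) s1 u' s2" "fits s2"
      "\<forall>x<40. regs s2 x = R2 x" "Q (t + (cost e + 1) + u + u') R2 (work s2) (out s2)"
      unfolding wp_def by blast
    \<comment> \<open>The run of \<open>loop e P\<close> begins with an evaluation of the condition;
      this evaluation completes the body of the enclosing \<open>While\<close>.\<close>
    from 2(1) obtain v v' s3 where 3: "exec w inp (comp_exp e 40) s1 v s3"
      "exec w inp (While 40 ?b) s3 v' s2" "u' = v + v'"
      unfolding loop_def by (auto elim: exec.cases)
    have "exec w inp (While 40 ?b) s' (Suc (u + v + v')) s2"
      by (rule exec.WhileTrue[OF _ exec.Seq[OF 1(1) 3(1)] 3(2)]) (use False 40 in auto)
    then show ?thesis
      by (intro exI[of _ "Suc (u + v + v')"] exI[of _ s2] exI[of _ R2])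
        (use 2 3 in \<open>auto simp: algebra_simps\<close>)
  qed
qed

text \<open>Here the time may enter the invariant, so that it can be charged to quantities growing
  by varying amounts; \<open>wp_for\<close> charges the same \<open>T\<close> to every
  iteration.\<close>

lemma wp_while:
  fixes \<mu> :: "(nat \<Rightarrow> nat) \<Rightarrow> nat"
  assumes "I t R W X"
    and "\<And>t R W X. I t R W X \<Longrightarrow> ok e R W"
    and "\<And>t R W X. I t R W X \<Longrightarrow> ev e R W \<noteq> 0 \<Longrightarrow>
      wp P (\<lambda>t' R' W' X'. I t' R' W' X' \<and> \<mu> R' < \<mu> R) (t + (cost e + 1)) R W X"
    and "\<And>t R W X. I t R W X \<Longrightarrow> ev e R W = 0 \<Longrightarrow> Q (t + (cost e + 1)) R W X"
  shows "wp (loop e P) Q t R W X"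
  using assms(1)
proof (induction "\<mu> R" arbitrary: t R W X rule: less_induct)
  case less
  show ?case
  proof (rule wp_loop_unfold)
    assume "ev e R W \<noteq> 0"
    with less.prems have "wp P (\<lambda>t' R' W' X'. I t' R' W' X' \<and> \<mu> R' < \<mu> R) (t + (cost e + 1)) R W X"
      by (rule assms(3))
    then show "wp P (\<lambda>t R W X. wp (loop e P) Q t R W X) (t + (cost e + 1)) R W X"
      by (rule wp_conseq) (use less.hyps in auto)
  qed (use less.prems assms(2,4) in auto)
qed

text \<open>\<open>q\<close> is a ghost counter known to the invariant alone; it need not sit in a
  register and may be a sum of several measures of progress.\<close>

lemma wp_for:
  assumes I0: "I 0 R W X"
    and guard: "\<And>q R W X. I q R W X \<Longrightarrow> q \<le> N \<Longrightarrow> ok e R W \<and> (ev e R W \<noteq> 0 \<longleftrightarrow> q < N)"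
    and body: "\<And>q t R W X. I q R W X \<Longrightarrow> q < N \<Longrightarrow>
      wp P (\<lambda>t' R' W' X'. I (Suc q) R' W' X' \<and> t' \<le> t + T) t R W X"
    and fin: "\<And>t' R' W' X'. I N R' W' X' \<Longrightarrow> t' \<le> t + (N * (T + cost e + 1) + cost e + 1) \<Longrightarrow>
      Q t' R' W' X'"
  shows "wp (loop e P) Q t R W X"
proof -
  have "wp (loop e P) Q t' R W X"
    if "I q R W X" "q \<le> N" "t' + (N - q) * (T + cost e + 1) \<le> t + N * (T + cost e + 1)" for q t' R W X
    using that
  proof (induction "N - q" arbitrary: q t' R W X)
    case 0
    then have [simp]: "q = N" by simp
    show ?case
      by (rule wp_loop_unfold) (use 0 guard[OF 0(2)] fin[of R W X] in auto)
  next
    case (Suc l)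
    then have q: "q < N" "N - q = Suc (N - Suc q)" by auto
    note b = body[OF Suc.prems(1) q(1), of "t' + (cost e + 1)"]
    have "wp P (\<lambda>t R W X. wp (loop e P) Q t R W X) (t' + (cost e + 1)) R W X"
      by (rule wp_conseq[OF b], rule Suc.hyps(1)[of "Suc q"])
        (use Suc.prems(3) Suc.hyps(2) q in \<open>auto simp: algebra_simps\<close>)
    then show ?case
      by (intro wp_loop_unfold) (use guard[OF Suc.prems(1,2)] q in auto)
  qed
  from this[OF I0, of t] show ?thesis by auto
qed

end

section \<open>One de Bruijn graph\<close>

text \<open>An edge as the arrays represent it, by source and label. For positive \<open>k\<close>
  the target is \<open>tl u @ [c]\<close>, and both ends are nodes automatically.\<close>

definition arc :: "nat \<Rightarrow> nat list set \<Rightarrow> nat list \<Rightarrow> nat \<Rightarrow> bool" where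
  "arc k C u c \<longleftrightarrow> length u = k \<and> (\<exists>s\<in>C. sublist (u @ [c]) (padded k s))"

lemma sublist_appendD:
  assumes "sublist (xs @ ys) zs"
  shows "sublist xs zs" "sublist ys zs"
proof -
  from assms obtain ps ss where "zs = ps @ (xs @ ys) @ ss" by (auto simp: sublist_def)
  then have "zs = ps @ xs @ (ys @ ss)" "zs = (ps @ xs) @ ys @ ss" by simp_all
  then show "sublist xs zs" "sublist ys zs" unfolding sublist_def by blast+
qed

lemma nodes_Un: "nodes k (C \<union> D) = nodes k C \<union> nodes k D"
  by (auto simp: nodes_def)

lemma arc_Un: "arc k (C \<union> D) u c \<longleftrightarrow> arc k C u c \<or> arc k D u c"
  by (auto simp: arc_def)

lemma length_node: "v \<in> nodes k C \<Longrightarrow> length v = k"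
  by (simp add: nodes_def)

lemma finite_nodes: "finite C \<Longrightarrow> finite (nodes k C)"
proof -
  assume "finite C"
  moreover have "nodes k C \<subseteq> (\<Union>s\<in>C. set (sublists (padded k s)))"
    by (auto simp: nodes_def)
  ultimately show ?thesis by (meson List.finite_set finite_UN_I finite_subset)
qed

lemma root_node: "C \<noteq> {} \<Longrightarrow> replicate k 0 \<in> nodes k C"
  by (auto simp: nodes_def padded_def)

lemma nodes_empty [simp]: "nodes k {} = {}"
  by (simp add: nodes_def)

section \<open>Arcs, nodes and smallest in-neighbours\<close>

context
  fixes k \<sigma> :: nat and C :: "nat list set"
  assumes k: "1 \<le> k" and C: "\<forall>s\<in>C. set s \<subseteq> {1..\<sigma>}"
begin

lemma padded_nth:
  assumes "s \<in> C" and "k \<le> i" and "i < length (padded k s)"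
  shows "padded k s ! i \<in> {1..\<sigma>}"
proof -
  from assms(2,3) have "padded k s ! i \<in> set s"
    by (auto simp: padded_def nth_append intro!: nth_mem)
  with C assms(1) show ?thesis by blast
qed

text \<open>The label stands at an index of at least \<open>k\<close>, past the padding. Thus a
  \<open>0\<close> in \<open>W\<close> can only mark out-degree zero.\<close>

lemma arc_label: "arc k C u c \<Longrightarrow> c \<in> {1..\<sigma>}"
proof -
  assume a: "arc k C u c"
  then obtain s ps ss where s: "s \<in> C" "padded k s = ps @ (u @ [c]) @ ss" "length u = k"
    by (auto simp: arc_def sublist_def)
  then have "padded k s ! (length ps + k) = c" by (auto simp: nth_append)
  with padded_nth[OF s(1), of "length ps + k"] s show ?thesis by auto
qed

lemma arc_node: "arc k C u c \<Longrightarrow> u \<in> nodes k C"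
  unfolding arc_def nodes_def by (auto dest: sublist_appendD)

lemma arc_target:
  assumes "arc k C u c"
  shows "tl u @ [c] \<in> nodes k C"
proof -
  from assms obtain s where s: "length u = k" "s \<in> C" "sublist (u @ [c]) (padded k s)"
    by (auto simp: arc_def)
  with k have "u @ [c] = [hd u] @ (tl u @ [c])" by (cases u) auto
  with s(3) have "sublist (tl u @ [c]) (padded k s)" by (metis sublist_appendD(2))
  with s k show ?thesis by (auto simp: nodes_def)
qed

text \<open>An occurrence at the very start of a padded string is the padding itself, so any other
  node occurs with a symbol before it, and this symbol opens the source.\<close>

lemma node_has_arc:
  assumes "v \<in> nodes k C" and "v \<noteq> replicate k 0"
  obtains u where "arc k C u (last v)" and "tl u = butlast v"
proof -
  from assms(1) obtain s ps ss where s: "s \<in> C" "padded k s = ps @ v @ ss" "length v = k"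
    by (auto simp: nodes_def sublist_def)
  have "ps \<noteq> []"
  proof
    assume "ps = []"
    with s have "take k (replicate k 0 @ s) = take k (v @ ss)" by (simp add: padded_def)
    with s(3) assms(2) show False by simp
  qed
  then have "padded k s = butlast ps @ (last ps # v) @ ss" using s(2) by simp
  then have "sublist (last ps # v) (padded k s)" unfolding sublist_def by blast
  moreover have "v \<noteq> []" using s(3) k by auto
  ultimately have "arc k C (last ps # butlast v) (last v)"
    using s k by (auto simp: arc_def intro!: bexI[of _ s])
  then show ?thesis by (rule that) simp
qed

lemma edges_iff: "(u, v) \<in> edges k C \<longleftrightarrow> (\<exists>c. v = tl u @ [c] \<and> arc k C u c)"
proof
  assume e: "(u, v) \<in> edges k C"
  then have "v \<noteq> []" using k by (auto simp: edges_def nodes_def)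
  then have "v = tl u @ [last v]" using e by (auto simp: edges_def)
  with e show "\<exists>c. v = tl u @ [c] \<and> arc k C u c"
    by (auto simp: edges_def arc_def nodes_def intro: exI[of _ "last v"])
next
  assume "\<exists>c. v = tl u @ [c] \<and> arc k C u c"
  then obtain c where c: "v = tl u @ [c]" "arc k C u c" by blast
  from c(2) have "\<exists>s\<in>C. sublist (u @ [c]) (padded k s)" by (simp add: arc_def)
  with c arc_node[OF c(2)] arc_target[OF c(2)] show "(u, v) \<in> edges k C"
    unfolding edges_def by simp
qed

lemma out_labels_eq: "out_labels k C u = {c. arc k C u c}"
  by (auto simp: out_labels_def edge_label_def edges_iff intro: exI[of _ "tl u @ [_]"])

lemma minus_bit_iff: "minus_bit k C (u, c) \<longleftrightarrow>
    arc k C u c \<and> (\<forall>u'. arc k C u' c \<and> tl u' = tl u \<longrightarrow> rev u \<le> rev u')"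
  by (auto simp: minus_bit_def edge_label_def edges_iff)

lemma minus_bit_unique:
  assumes "minus_bit k C (u, c)" and "minus_bit k C (u', c)" and "tl u = tl u'"
  shows "u = u'"
proof -
  from assms have "rev u \<le> rev u'" "rev u' \<le> rev u" by (auto simp: minus_bit_iff)
  then show ?thesis by simp
qed

text \<open>The set of in-neighbours is finite and non-empty, so it has a colexicographic
  minimum.\<close>

lemma node_has_minus_bit:
  assumes "finite C" and "v \<in> nodes k C" and "v \<noteq> replicate k 0"
  obtains u where "minus_bit k C (u, last v)" and "tl u = butlast v"
proof -
  let ?S = "{u. arc k C u (last v) \<and> tl u = butlast v}"
  have "finite (rev ` ?S)"
    by (rule finite_imageI, rule finite_subset[OF _ finite_nodes[OF assms(1)]]) (auto intro: arc_node)
  moreover have "rev ` ?S \<noteq> {}"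
    using node_has_arc[OF assms(2,3)] by blast
  ultimately have m: "Min (rev ` ?S) \<in> rev ` ?S" "\<forall>x\<in>rev ` ?S. Min (rev ` ?S) \<le> x" by simp_all
  then obtain u where u: "u \<in> ?S" "rev u = Min (rev ` ?S)" by auto
  with m(2) have "minus_bit k C (u, last v)" by (auto simp: minus_bit_iff)
  with u(1) show ?thesis by (intro that) auto
qed

lemma set_node_W:
  assumes "finite C"
  shows "set (node_W k C u) = (if \<forall>c. \<not> arc k C u c then {0} else {c. arc k C u c})"
proof -
  have "finite {c. arc k C u c}" by (rule finite_subset[of _ "{1..\<sigma>}"]) (auto dest: arc_label)
  then show ?thesis by (auto simp: node_W_def out_labels_eq)
qed

lemma node_W_nonempty:
  assumes "finite C"
  shows "node_W k C u \<noteq> []"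
proof
  assume "node_W k C u = []"
  then have "set (node_W k C u) = {}" by simp
  then show False unfolding set_node_W[OF assms] by (auto split: if_splits)
qed

lemma node_W_le: "finite C \<Longrightarrow> c \<in> set (node_W k C u) \<Longrightarrow> c \<le> \<sigma>"
  by (auto simp: set_node_W dest: arc_label split: if_splits)

end

section \<open>Node lists and entries of one graph\<close>

lemma sorted_node_W: "sorted_wrt (<) (node_W k C u)"
  by (simp add: node_W_def)

lemma sorted_node_list: "sorted_wrt (<) (map rev (node_list k C))"
  by (simp add: node_list_def comp_def)

lemma set_node_list: "finite C \<Longrightarrow> set (node_list k C) = nodes k C"
  by (simp add: node_list_def finite_nodes image_image)

lemma distinct_node_list: "distinct (node_list k C)"
  using sorted_node_list[of k C] unfolding strict_sorted_iff by (simp add: distinct_map)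

text \<open>A node's entries: label, bit of \<open>W\<^sup>-\<close> and bit of \<open>last\<close>.\<close>

fun flagged :: "(nat \<Rightarrow> bool) \<Rightarrow> nat list \<Rightarrow> (nat \<times> bool \<times> bool) list" where
  "flagged f [] = []"
| "flagged f (c # l) = (c, f c, l = []) # flagged f l"

lemma flagged_eq_Nil [simp]: "flagged f l = [] \<longleftrightarrow> l = []"
  by (cases l) auto

lemma map_fst_flagged [simp]: "map fst (flagged f l) = l"
  by (induction l) auto

lemma map_last_flagged: "map (snd \<circ> snd) (flagged f l) = map (snd \<circ> snd) (flagged g l)"
  by (induction l) auto

lemma length_flagged [simp]: "length (flagged f l) = length l"
  by (induction l) auto

lemma set_flagged: "(c, m, z) \<in> set (flagged f l) \<Longrightarrow> c \<in> set l \<and> m = f c"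
  by (induction l) auto

lemma flagged_complete: "c \<in> set l \<Longrightarrow> \<exists>z. (c, f c, z) \<in> set (flagged f l)"
  by (induction l) auto

lemma flagged_snoc: "flagged f (l @ [c]) = map (\<lambda>c. (c, f c, False)) l @ [(c, f c, True)]"
  by (induction l) auto

text \<open>The property of \<open>last\<close> that lets a scan count nodes: one mark per node, on
  its final entry.\<close>

lemma flagged_ends:
  assumes "l \<noteq> []"
  shows "\<exists>ys y. flagged f l = ys @ [y] \<and> (\<forall>z\<in>set ys. \<not> snd (snd z)) \<and> snd (snd y)"
  using assms by (cases l rule: rev_exhaust) (auto simp: flagged_snoc)

definition node_entries :: "nat \<Rightarrow> nat list set \<Rightarrow> nat list \<Rightarrow> (nat \<times> bool \<times> bool) list" where
  "node_entries k C u = flagged (\<lambda>c. minus_bit k C (u, c)) (node_W k C u)"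

definition graph_entries :: "nat \<Rightarrow> nat list set \<Rightarrow> (nat \<times> bool \<times> bool) list" where
  "graph_entries k C = concat (map (node_entries k C) (node_list k C))"

text \<open>\<open>last\<close> compares the nodes of neighbouring entries. As nodes are distinct
  and none lacks entries, this is the mark at the end of each node's own list, which is the same for
  every flag function \<open>f\<close>.\<close>

lemma last_bits_concat:
  fixes es :: "('a \<times> nat) list"
  assumes "distinct us" and "\<forall>u\<in>set us. g u \<noteq> []"
    and "es = concat (map (\<lambda>u. map (Pair u) (g u)) us)"
  shows "map (\<lambda>i. Suc i = length es \<or> fst (es ! i) \<noteq> fst (es ! Suc i)) [0..<length es] =
    concat (map (\<lambda>u. map (snd \<circ> snd) (flagged f (g u))) us)"
  using assms
proof (induction us arbitrary: es)
  case Nil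
  then show ?case by simp
next
  case (Cons u us)
  define es' where "es' = concat (map (\<lambda>u. map (Pair u) (g u)) us)"
  let ?b = "\<lambda>es i. Suc i = length es \<or> fst (es ! i) \<noteq> fst (es ! Suc i)"
  have fst_es': "fst x \<in> set us" if "x \<in> set es'" for x
    using that by (auto simp: es'_def)
  have *: "map (?b (map (Pair u) l @ es')) [0..<length l + length es'] =
      map (snd \<circ> snd) (flagged f l) @ map (?b es') [0..<length es']" for l
  proof (induction l)
    case Nil
    then show ?case by simp
  next
    case (Cons c l)
    have "[0..<length (c # l) + length es'] = 0 # map Suc [0..<length l + length es']"
      by (simp add: map_Suc_upt upt_conv_Cons del: upt_Suc)
    moreover have "?b (map (Pair u) (c # l) @ es') 0 \<longleftrightarrow> l = []"
    proof (cases l)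
      case Nil
      then show ?thesis using Cons.prems fst_es'[of "hd es'"] \<open>distinct (u # us)\<close>
        by (cases es') auto
    qed auto
    ultimately show ?case using Cons.IH by (simp add: comp_def)
  qed
  from Cons.prems(3) have "es = map (Pair u) (g u) @ es'" by (simp add: es'_def)
  then show ?case
    using *[of "g u"] Cons.IH[of es'] Cons.prems(1,2) es'_def by simp
qed

lemma boss_arrays_eq:
  assumes "1 \<le> k" and "\<forall>s\<in>C. set s \<subseteq> {1..\<sigma>}" and "finite C"
  shows "boss_arrays (BOSS k C) = [map fst (graph_entries k C),
    map (of_bool \<circ> fst \<circ> snd) (graph_entries k C), map (of_bool \<circ> snd \<circ> snd) (graph_entries k C)]"
proof -
  have 1: "map snd (entries k C) = map fst (graph_entries k C)"
    by (simp add: entries_def graph_entries_def node_entries_def map_concat comp_def)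
  have "map (minus_bit k C) (map (Pair u) l) =
      map (fst \<circ> snd) (flagged (\<lambda>c. minus_bit k C (u, c)) l)" for u l
    by (induction l) auto
  then have 2: "map (minus_bit k C) (entries k C) = map (fst \<circ> snd) (graph_entries k C)"
    by (simp add: entries_def graph_entries_def node_entries_def map_concat comp_def)
  have "map (\<lambda>i. Suc i = length (entries k C) \<or> fst (entries k C ! i) \<noteq> fst (entries k C ! Suc i))
      [0..<length (entries k C)] =
    concat (map (\<lambda>u. map (snd \<circ> snd) (flagged (\<lambda>_. False) (node_W k C u))) (node_list k C))"
    by (rule last_bits_concat[OF distinct_node_list])
      (use node_W_nonempty[OF assms] in \<open>auto simp: entries_def\<close>)
  also have "\<dots> = concat (map (\<lambda>u. map (snd \<circ> snd) (node_entries k C u)) (node_list k C))"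
    unfolding node_entries_def by (intro arg_cong[of _ _ concat] map_cong refl map_last_flagged)
  also have "\<dots> = map (snd \<circ> snd) (graph_entries k C)"
    by (simp add: graph_entries_def map_concat comp_def)
  finally show ?thesis
    using 1 2 by (simp add: boss_arrays_def BOSS_def Let_def flip: map_map)
qed

section \<open>Sorted lists and blocks of equal keys\<close>

text \<open>In a strictly sorted list the index of an element is the number of smaller ones. The
  positions of the counting sort are obtained as such ranks.\<close>

lemma nth_length_filter_less:
  fixes xs :: "'a::linorder list"
  assumes "sorted_wrt (<) xs" and "x \<in> set xs"
  shows "length (filter (\<lambda>y. y < x) xs) < length xs" and "xs ! length (filter (\<lambda>y. y < x) xs) = x"
proof -
  have "length (filter (\<lambda>y. y < x) xs) < length xs \<and> xs ! length (filter (\<lambda>y. y < x) xs) = x"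
    using assms
  proof (induction xs)
    case (Cons a xs)
    show ?case
    proof (cases "x = a")
      case True
      with Cons.prems have "filter (\<lambda>y. y < x) xs = []" by (auto simp: filter_empty_conv)
      with True show ?thesis by simp
    qed (use Cons in auto)
  qed simp
  then show "length (filter (\<lambda>y. y < x) xs) < length xs" and "xs ! length (filter (\<lambda>y. y < x) xs) = x"
    by auto
qed

text \<open>The rank of \<open>x\<close>; if \<open>x\<close> occurs in a sorted list, this is the
  index of its first occurrence, from which its block is numbered.\<close>

definition below :: "'a::linorder list \<Rightarrow> 'a \<Rightarrow> nat" where
  "below ks x = length (filter (\<lambda>y. y < x) ks)"

text \<open>Stated against all earlier indices, which matches the search for a first occurrence; on
  sorted lists the predecessor alone decides.\<close>

definition starts :: "'a list \<Rightarrow> nat \<Rightarrow> bool" where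
  "starts ks i \<longleftrightarrow> (\<forall>j<i. ks ! j \<noteq> ks ! i)"

lemma starts_0 [simp]: "starts ks 0"
  by (simp add: starts_def)

lemma below_starts:
  assumes "sorted ks" and "i < length ks" and "starts ks i"
  shows "below ks (ks ! i) = i"
proof -
  have "ks = take i ks @ drop i ks" by simp
  then have "filter (\<lambda>y. y < ks ! i) ks =
      filter (\<lambda>y. y < ks ! i) (take i ks) @ filter (\<lambda>y. y < ks ! i) (drop i ks)"
    by (metis filter_append)
  moreover have "filter (\<lambda>y. y < ks ! i) (take i ks) = take i ks"
  proof (rule filter_True, rule ballI)
    fix y assume "y \<in> set (take i ks)"
    then obtain j where j: "j < i" "y = ks ! j" using assms(2) by (auto simp: in_set_conv_nth)
    then have "y \<le> ks ! i" using assms by (simp add: sorted_nth_mono)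
    moreover have "y \<noteq> ks ! i" using j assms(3) by (simp add: starts_def)
    ultimately show "y < ks ! i" by simp
  qed
  moreover have "filter (\<lambda>y. y < ks ! i) (drop i ks) = []"
  proof (rule filter_False, rule ballI)
    fix y assume "y \<in> set (drop i ks)"
    then obtain j where "j < length ks - i" "y = ks ! (i + j)" by (auto simp: in_set_conv_nth)
    moreover from this have "ks ! i \<le> ks ! (i + j)" using assms(1) by (intro sorted_nth_mono) auto
    ultimately show "\<not> y < ks ! i" by simp
  qed
  ultimately show ?thesis using assms(2) by (simp add: below_def)
qed

lemma not_starts_Suc:
  assumes "sorted ks" and "Suc i < length ks" and "\<not> starts ks (Suc i)"
  shows "ks ! Suc i = ks ! i"
proof -
  from assms(3) obtain j where j: "j \<le> i" "ks ! j = ks ! Suc i"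
    by (auto simp: starts_def less_Suc_eq_le)
  have "ks ! j \<le> ks ! i" "ks ! i \<le> ks ! Suc i"
    using sorted_nth_mono[OF assms(1) j(1)] sorted_nth_mono[OF assms(1), of i "Suc i"] assms(2)
    by auto
  with j show ?thesis by simp
qed

lemma below_mono: "x \<le> y \<Longrightarrow> below ks x \<le> below ks y"
proof (induction ks)
  case (Cons a ks)
  then show ?case by (auto simp: below_def)
qed (simp add: below_def)

lemma below_strict_mono: "x < y \<Longrightarrow> x \<in> set ks \<Longrightarrow> below ks x < below ks y"
proof (induction ks)
  case (Cons a ks)
  show ?case
  proof (cases "x \<in> set ks")
    case False
    with Cons.prems below_mono[OF less_imp_le[OF Cons.prems(1)], of ks] show ?thesis
      by (auto simp: below_def)
  qed (use Cons in \<open>auto simp: below_def\<close>)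
qed simp

lemma below_inj:
  assumes "below ks x = below ks y" and "x \<in> set ks" and "y \<in> set ks"
  shows "x = y"
proof (rule ccontr)
  assume "x \<noteq> y"
  then have "x < y \<or> y < x" by auto
  with below_strict_mono[of x y ks] below_strict_mono[of y x ks] assms show False by auto
qed

text \<open>The content of the array that records for each label the last block in which it was met.
  Block numbers start at \<open>1\<close>, as cells are initially \<open>0\<close>.\<close>

definition latest :: "(nat \<times> nat) list \<Rightarrow> nat \<Rightarrow> nat" where
  "latest xs = foldl (\<lambda>f (c, b). f(c := b)) (\<lambda>_. 0) xs"

lemma latest_Nil [simp]: "latest [] = (\<lambda>_. 0)"
  by (simp add: latest_def)

lemma latest_snoc [simp]: "latest (xs @ [(c, b)]) = (latest xs)(c := b)"
  by (simp add: latest_def)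

text \<open>Blocks are met in ascending order and none exceeds \<open>b\<close>, so a record of
  \<open>b\<close> cannot have been overwritten by another block; \<open>0 < b\<close> tells it from
  an untouched cell.\<close>

lemma latest_eq_iff:
  assumes "sorted (map snd xs)" and "\<forall>x\<in>set xs. snd x \<le> b" and "0 < b"
  shows "latest xs c = b \<longleftrightarrow> (c, b) \<in> set xs"
  using assms
proof (induction xs rule: rev_induct)
  case (snoc x xs)
  obtain c' b' where x: "x = (c', b')" by force
  have "latest xs c = b \<longleftrightarrow> (c, b) \<in> set xs" using snoc by (simp add: sorted_append)
  moreover have "b' = b" if "(c, b) \<in> set xs"
    using snoc.prems that by (force simp: x sorted_append)
  ultimately show ?case by (auto simp: x)
qed simp

section \<open>Lists concatenated from the entries of nodes\<close>

lemma filter_fst_concat: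
  "filter (\<lambda>y. fst y = b) (concat (map (\<lambda>(b, u). map (\<lambda>x. (b, u, x)) (f b u)) L)) =
    concat (map (\<lambda>(b, u). map (\<lambda>x. (b, u, x)) (f b u)) (filter (\<lambda>y. fst y = b) L))"
  by (induction L) (auto simp: filter_map comp_def)

text \<open>A scan sees only entries; the number of end marks passed so far is the index of the node
  it is in.\<close>

lemma concat_count_ends:
  assumes "\<forall>x\<in>set L. \<exists>ys y. g x = ys @ [y] \<and> (\<forall>z\<in>set ys. \<not> P z) \<and> P y"
    and "\<forall>x\<in>set L. \<forall>z\<in>set (g x). own z = x" and "q < length (concat (map g L))"
  shows "length (filter P (take q (concat (map g L)))) < length L \<and>
    L ! length (filter P (take q (concat (map g L)))) = own (concat (map g L) ! q)"
  using assms
proof (induction L arbitrary: q)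
  case (Cons x L)
  then obtain ys y where g: "g x = ys @ [y]" "\<forall>z\<in>set ys. \<not> P z" "P y" by auto
  show ?case
  proof (cases "q < length (g x)")
    case True
    then have "take q (g x) = take q ys" using g by simp
    then have "filter P (take q (g x)) = []" using g(2) by (auto simp: filter_empty_conv dest: in_set_takeD)
    moreover have "own (g x ! q) = x" using True Cons.prems(2) by simp
    ultimately show ?thesis using True by (simp add: nth_append)
  next
    case False
    have "filter P (g x) = [y]" using g by (auto simp: filter_empty_conv)
    moreover have "q - length (g x) < length (concat (map g L))" using False Cons.prems(3) by auto
    note Cons.IH[OF _ _ this]
    ultimately show ?thesis using False Cons.prems by (simp add: nth_append)
  qed
qed simp

lemma concat_count_ends_total:
  assumes "\<forall>x\<in>set L. \<exists>ys y. g x = ys @ [y] \<and> (\<forall>z\<in>set ys. \<not> P z) \<and> P y"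
  shows "length (filter P (concat (map g L))) = length L"
  using assms
proof (induction L)
  case (Cons x L)
  then obtain ys y where g: "g x = ys @ [y]" "\<forall>z\<in>set ys. \<not> P z" "P y" by auto
  have "filter P (g x) = [y]" using g by (auto simp: filter_empty_conv)
  with Cons show ?case by simp
qed simp

lemma sorted_wrt_irrefl_distinct: "sorted_wrt R xs \<Longrightarrow> (\<And>x. \<not> R x x) \<Longrightarrow> distinct xs"
  by (induction xs) auto

lemma sorted_wrt_concat_map:
  fixes f :: "'a \<Rightarrow> 'k::linorder"
  assumes "sorted_wrt (<) (map f L)" and "\<forall>x\<in>set L. sorted_wrt R (g x)"
    and "\<And>x y z z'. x \<in> set L \<Longrightarrow> y \<in> set L \<Longrightarrow> f x < f y \<Longrightarrow> z \<in> set (g x) \<Longrightarrow> z' \<in> set (g y) \<Longrightarrow> R z z'"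
  shows "sorted_wrt R (concat (map g L))"
  using assms
proof (induction L)
  case (Cons x L)
  have "R z z'" if "z \<in> set (g x)" "z' \<in> set (concat (map g L))" for z z'
    using that Cons.prems(1) Cons.prems(3)[of x] by auto
  with Cons show ?case by (auto simp: sorted_wrt_append)
qed simp

lemma take_mono_lex: "xs \<le> ys \<Longrightarrow> take h xs \<le> take h ys" for xs ys :: "'a::linorder list"
proof (induction h arbitrary: xs ys)
  case (Suc h)
  then show ?case by (cases xs; cases ys) auto
qed simp

section \<open>Merging the node lists of two graphs\<close>

text \<open>The Boolean index of a graph is at the same time the origin bit of its nodes. As some
  string exists, there is at least one root.\<close>

locale two_graphs =
  fixes k \<sigma> :: nat and C :: "bool \<Rightarrow> nat list set"
  assumes k: "1 \<le> k" and fin: "finite (C b)" and alphabet: "\<forall>s\<in>C b. set s \<subseteq> {1..\<sigma>}"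
    and nonempty: "C False \<union> C True \<noteq> {}"
begin

lemmas graph_facts = k alphabet

text \<open>The prefix is the actual sort key, the graph index makes the merge stable, and the full
  reversal orders the nodes of one graph as the input lists them. The last component makes keys
  injective, so that merges are strictly sorted.\<close>

definition key :: "nat \<Rightarrow> bool \<times> nat list \<Rightarrow> nat list \<times> bool \<times> nat list" where
  "key h y = (take h (rev (snd y)), fst y, rev (snd y))"

definition kt :: "nat \<Rightarrow> bool \<times> nat list \<Rightarrow> nat list" where
  "kt h y = take h (rev (snd y))"

definition tagged :: "(bool \<times> nat list) list" where
  "tagged = map (Pair False) (node_list k (C False)) @ map (Pair True) (node_list k (C True))"

definition M :: "nat \<Rightarrow> (bool \<times> nat list) list" where
  "M h = sort_key (key h) tagged"

definition num :: nat where
  "num = length tagged"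

definition kl :: "nat \<Rightarrow> nat list list" where
  "kl h = map (kt h) (M h)"

lemma num_eq: "num = card (nodes k (C False)) + card (nodes k (C True))"
  by (simp add: num_def tagged_def set_node_list[OF fin, symmetric] distinct_card distinct_node_list)

lemma inj_key: "inj_on (key h) A"
  by (auto simp: inj_on_def key_def)

lemma length_M [simp]: "length (M h) = num"
  by (simp add: M_def num_def)

lemma mset_M: "mset (M h) = mset tagged"
  by (simp add: M_def)

lemma distinct_tagged: "distinct tagged"
  by (auto simp: tagged_def distinct_map distinct_node_list inj_on_def)

lemma distinct_M: "distinct (M h)"
  using distinct_tagged by (simp add: M_def)

lemma set_M: "set (M h) = {(b, u). u \<in> nodes k (C b)}"
proof -
  have "(b, u) \<in> set (M h) \<longleftrightarrow> u \<in> nodes k (C b)" for b u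
    by (cases b) (auto simp: M_def tagged_def set_node_list[OF fin])
  then show ?thesis by auto
qed

lemma sorted_M: "sorted_wrt (<) (map (key h) (M h))"
  unfolding strict_sorted_iff by (auto simp: distinct_map distinct_M inj_key) (simp add: M_def)

text \<open>Truncation is monotone, so every merge keeps each graph's own order. Hence a bitvector
  of origins determines the merge.\<close>

lemma filter_M: "filter (\<lambda>y. fst y = b) (M h) = map (Pair b) (node_list k (C b))"
proof -
  let ?L = "filter (\<lambda>y. fst y = b) (M h)"
  have "sorted_wrt (<) (map (key h) ?L)"
    using sorted_M[of h] by (simp add: sorted_wrt_map sorted_wrt_filter)
  then have "sorted_wrt (<) (map (rev \<circ> snd) ?L)"
    unfolding sorted_wrt_map
  proof (rule sorted_wrt_mono_rel[rotated])
    fix x y assume "x \<in> set ?L" "y \<in> set ?L" "key h x < key h y"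
    then show "(rev \<circ> snd) x < (rev \<circ> snd) y"
      using take_mono_lex[of "rev (snd y)" "rev (snd x)" h]
      by (cases "rev (snd x) < rev (snd y)") (auto simp: key_def not_less)
  qed
  moreover have "set (map (rev \<circ> snd) ?L) = set (map rev (node_list k (C b)))"
    by (force simp: set_M set_node_list[OF fin])
  ultimately have "map (rev \<circ> snd) ?L = map rev (node_list k (C b))"
    using sorted_node_list strict_sorted_equal by blast
  then have "map snd ?L = node_list k (C b)"
    by (simp flip: map_map)
  moreover have "?L = map (Pair b) (map snd ?L)"
    by (simp, rule sym, rule map_idI) auto
  ultimately show ?thesis by simp
qed

text \<open>Both sides are sorted rearrangements of the same truncated keys. Later rounds thus move
  nodes only inside blocks, and the block starts of order \<open>h\<close> stay valid.\<close>

lemma kl_eq: "h \<le> h' \<Longrightarrow> map (kt h) (M h') = kl h"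
proof -
  assume h: "h \<le> h'"
  have "sorted (map (kt h) (M h'))"
    using sorted_M[of h'] unfolding sorted_wrt_map
  proof (rule sorted_wrt_mono_rel[rotated])
    fix x y assume "key h' x < key h' y"
    then have "kt h' x \<le> kt h' y" by (auto simp: key_def kt_def)
    from take_mono_lex[OF this, of h] h show "kt h x \<le> kt h y" by (simp add: kt_def min_def)
  qed
  moreover have "sorted (kl h)"
    using sorted_M[of h] unfolding sorted_wrt_map kl_def
    by (rule sorted_wrt_mono_rel[rotated]) (auto simp: key_def kt_def)
  moreover have "mset (map (kt h) (M h')) = mset (kl h)"
    by (simp add: kl_def mset_M)
  ultimately show ?thesis by (metis properties_for_sort)
qed

lemma sorted_kl: "sorted (kl h)"
  using sorted_M[of h] unfolding sorted_wrt_map kl_def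
  by (rule sorted_wrt_mono_rel[rotated]) (auto simp: key_def kt_def)

lemma length_kl [simp]: "length (kl h) = num"
  by (simp add: kl_def)

lemma nth_kl: "h \<le> h' \<Longrightarrow> i < num \<Longrightarrow> kl h ! i = kt h (M h' ! i)"
  using kl_eq[of h h'] by (metis length_M nth_map)

section \<open>Entries in the order of a merge\<close>

definition entries_of :: "bool \<times> nat list \<Rightarrow> (bool \<times> nat list \<times> nat \<times> bool \<times> bool) list" where
  "entries_of = (\<lambda>(b, u). map (\<lambda>x. (b, u, x)) (node_entries k (C b) u))"

definition E :: "nat \<Rightarrow> (bool \<times> nat list \<times> nat \<times> bool \<times> bool) list" where
  "E h = concat (map entries_of (M h))"

abbreviation lab :: "bool \<times> nat list \<times> nat \<times> bool \<times> bool \<Rightarrow> nat" where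
  "lab y \<equiv> fst (snd (snd y))"

abbreviation mi :: "bool \<times> nat list \<times> nat \<times> bool \<times> bool \<Rightarrow> bool" where
  "mi y \<equiv> fst (snd (snd (snd y)))"

abbreviation la :: "bool \<times> nat list \<times> nat \<times> bool \<times> bool \<Rightarrow> bool" where
  "la y \<equiv> snd (snd (snd (snd y)))"

definition own :: "bool \<times> nat list \<times> nat \<times> bool \<times> bool \<Rightarrow> bool \<times> nat list" where
  "own y = (fst y, fst (snd y))"

text \<open>Scanning in merged order therefore reads each input from left to right, with one pointer
  per graph.\<close>

lemma filter_E: "map (\<lambda>y. snd (snd y)) (filter (\<lambda>y. fst y = b) (E h)) = graph_entries k (C b)"
proof -
  have "filter (\<lambda>y. fst y = b) (E h) = concat (map entries_of (filter (\<lambda>y. fst y = b) (M h)))"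
    unfolding E_def entries_of_def by (rule filter_fst_concat)
  then show ?thesis
    by (simp add: filter_M graph_entries_def entries_of_def map_concat comp_def)
qed

text \<open>Rounds differ only in the order of the entries, so counts per label can be taken once
  for all.\<close>

lemma mset_E: "mset (map (\<lambda>y. snd (snd y)) (E h)) =
    mset (graph_entries k (C False) @ graph_entries k (C True))"
proof -
  have "mset (E h) = mset (filter fst (E h)) + mset (filter (\<lambda>y. \<not> fst y) (E h))"
    by simp
  then have "mset (map (\<lambda>y. snd (snd y)) (E h)) =
    mset (map (\<lambda>y. snd (snd y)) (filter fst (E h))) + mset (map (\<lambda>y. snd (snd y)) (filter (\<lambda>y. \<not> fst y) (E h)))"
    unfolding mset_map by (simp only: image_mset_union)
  with filter_E[of True h] filter_E[of False h] show ?thesis by simp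
qed

lemma entries_of_ends: "\<exists>ys y. entries_of x = ys @ [y] \<and> (\<forall>z\<in>set ys. \<not> la z) \<and> la y"
proof -
  obtain b u where x: "x = (b, u)" by force
  from flagged_ends[OF node_W_nonempty[OF graph_facts fin]]
  obtain ys y where "node_entries k (C b) u = ys @ [y]" "\<forall>z\<in>set ys. \<not> snd (snd z)" "snd (snd y)"
    unfolding node_entries_def by metis
  then have "entries_of x = map (\<lambda>x. (b, u, x)) ys @ [(b, u, y)] \<and>
    (\<forall>z\<in>set (map (\<lambda>x. (b, u, x)) ys). \<not> la z) \<and> la (b, u, y)" by (simp add: x entries_of_def)
  then show ?thesis by blast
qed

lemma own_entries_of: "z \<in> set (entries_of x) \<Longrightarrow> own z = x"
  by (auto simp: entries_of_def own_def)

lemma count_la: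
  assumes "q < length (E h)"
  shows "length (filter la (take q (E h))) < num"
    and "M h ! length (filter la (take q (E h))) = own (E h ! q)"
proof -
  have "\<forall>x\<in>set (M h). \<exists>ys y. entries_of x = ys @ [y] \<and> (\<forall>z\<in>set ys. \<not> la z) \<and> la y"
    using entries_of_ends by blast
  moreover have "\<forall>x\<in>set (M h). \<forall>z\<in>set (entries_of x). own z = x"
    using own_entries_of by blast
  ultimately have "length (filter la (take q (E h))) < length (M h) \<and>
    M h ! length (filter la (take q (E h))) = own (E h ! q)"
    using assms unfolding E_def by (rule concat_count_ends)
  then show "length (filter la (take q (E h))) < num"
    and "M h ! length (filter la (take q (E h))) = own (E h ! q)" by auto
qed

lemma count_la_total: "length (filter la (E h)) = num"
proof -
  have "\<forall>x\<in>set (M h). \<exists>ys y. entries_of x = ys @ [y] \<and> (\<forall>z\<in>set ys. \<not> la z) \<and> la y"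
    using entries_of_ends by blast
  then show ?thesis unfolding E_def by (subst concat_count_ends_total) auto
qed

lemma num_le_E: "num \<le> length (E h)"
  by (metis count_la_total length_filter_le)

lemma sorted_E: "sorted_wrt (\<lambda>y z. key h (own y) < key h (own z) \<or> own y = own z \<and> lab y < lab z) (E h)"
  unfolding E_def
proof (rule sorted_wrt_concat_map[OF sorted_M])
  show "\<forall>x\<in>set (M h). sorted_wrt (\<lambda>y z. key h (own y) < key h (own z) \<or> own y = own z \<and> lab y < lab z) (entries_of x)"
  proof
    fix x :: "bool \<times> nat list"
    obtain b u where x: "x = (b, u)" by force
    have "sorted_wrt (<) (map fst (node_entries k (C b) u))"
      by (simp add: node_entries_def sorted_node_W)
    then show "sorted_wrt (\<lambda>y z. key h (own y) < key h (own z) \<or> own y = own z \<and> lab y < lab z) (entries_of x)"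
      by (simp add: x entries_of_def sorted_wrt_map own_def)
  qed
qed (auto dest!: own_entries_of)

lemma in_E:
  assumes "y \<in> set (E h)" and "mi y"
  shows "minus_bit k (C (fst y)) (fst (snd y), lab y)"
proof -
  from assms(1) obtain x where "x \<in> set (M h)" "y \<in> set (entries_of x)"
    by (auto simp: E_def)
  then obtain b u z where "y = (b, u, z)" "z \<in> set (node_entries k (C b) u)"
    by (auto simp: entries_of_def)
  with assms(2) show ?thesis
    by (cases z) (auto simp: node_entries_def dest!: set_flagged)
qed

lemma E_complete:
  assumes "minus_bit k (C b) (u, c)"
  obtains z where "(b, u, c, True, z) \<in> set (E h)"
proof -
  from assms have a: "arc k (C b) u c" by (simp add: minus_bit_iff[OF graph_facts])
  then have "(b, u) \<in> set (M h)" by (simp add: set_M arc_node[OF graph_facts])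
  moreover have "c \<in> set (node_W k (C b) u)" using a by (auto simp: set_node_W[OF graph_facts fin])
  with assms obtain z where "(c, True, z) \<in> set (node_entries k (C b) u)"
    using flagged_complete[of c "node_W k (C b) u" "\<lambda>c. minus_bit k (C b) (u, c)"] by (auto simp: node_entries_def)
  ultimately have "(b, u, c, True, z) \<in> set (E h)"
    unfolding E_def set_concat set_map
    by (intro UnionI[OF imageI[OF imageI]]) (auto simp: entries_of_def)
  then show ?thesis by (rule that)
qed

lemma label_le: "y \<in> set (E h) \<Longrightarrow> lab y \<le> \<sigma>"
proof -
  assume "y \<in> set (E h)"
  then obtain x where "x \<in> set (M h)" "y \<in> set (entries_of x)"
    by (auto simp: E_def)
  then obtain b u z where y: "y = (b, u, z)" "z \<in> set (node_entries k (C b) u)"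
    by (auto simp: entries_of_def)
  then have "fst z \<in> set (node_W k (C b) u)"
    by (cases z) (auto simp: node_entries_def dest!: set_flagged)
  from node_W_le[OF graph_facts fin this] y show ?thesis by simp
qed

section \<open>Targets and roots\<close>

definition target :: "bool \<times> nat list \<times> nat \<times> bool \<times> bool \<Rightarrow> bool \<times> nat list" where
  "target y = (fst y, tl (fst (snd y)) @ [lab y])"

text \<open>The nodes made of padding only, one per non-empty graph. No edge leads to them, so each
  round has to place them separately.\<close>

definition roots :: "(bool \<times> nat list) list" where
  "roots = map (\<lambda>b. (b, replicate k 0)) (filter (\<lambda>b. C b \<noteq> {}) [False, True])"

lemma minus_label: "y \<in> set (E h) \<Longrightarrow> mi y \<Longrightarrow> lab y \<in> {1..\<sigma>}"
  using in_E[of y h] by (meson arc_label[OF graph_facts] minus_bit_iff[OF graph_facts])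

lemma minus_length: "y \<in> set (E h) \<Longrightarrow> mi y \<Longrightarrow> length (fst (snd y)) = k"
  using in_E[of y h] by (auto simp: minus_bit_iff[OF graph_facts] arc_def)

lemma inj_target:
  assumes "y \<in> set (E h)" "mi y" "z \<in> set (E h)" "mi z" "target y = target z"
  shows "own y = own z" "lab y = lab z"
proof -
  show l: "lab y = lab z" using assms(5) by (simp add: target_def)
  have "fst (snd y) = fst (snd z)"
  proof (rule minus_bit_unique[OF graph_facts])
    show "minus_bit k (C (fst y)) (fst (snd y), lab y)" by (rule in_E) fact+
    show "minus_bit k (C (fst y)) (fst (snd z), lab y)"
      using in_E[OF assms(3,4)] l assms(5) by (simp add: target_def)
    show "tl (fst (snd y)) = tl (fst (snd z))" using assms(5) by (simp add: target_def)
  qed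
  with assms(5) show "own y = own z" by (simp add: own_def target_def)
qed

text \<open>Extending the key by one symbol does not change the relative order of the targets with a
  common label, which makes a counting sort by label correct.\<close>

lemma key_target_mono:
  assumes "Suc h \<le> k" and "i < j" and "j < length (E h)" and "mi (E h ! i)" and "mi (E h ! j)"
    and "lab (E h ! i) = lab (E h ! j)"
  shows "key (Suc h) (target (E h ! i)) < key (Suc h) (target (E h ! j))"
proof -
  define y z where "y = E h ! i" and "z = E h ! j"
  have yz: "y \<in> set (E h)" "z \<in> set (E h)" "mi y" "mi z" "lab y = lab z"
    using assms by (auto simp: y_def z_def)
  have k1: "key h (own y) < key h (own z)"
    using sorted_wrt_nth_less[OF sorted_E assms(2,3)] yz(5) by (auto simp: y_def z_def)
  then have ne: "target y \<noteq> target z" using inj_target[of y h z] yz by auto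
  define u v where "u = fst (snd y)" and "v = fst (snd z)"
  have len: "length u = k" "length v = k" using yz minus_length by (auto simp: u_def v_def)
  \<comment> \<open>The symbol dropped from the front of a node is the last one of its reversal,
    beyond the first \<open>h\<close> symbols as \<open>h < k\<close>.\<close>
  have take: "take h (rev (tl x)) = take h (rev x)" if "length x = k" for x :: "nat list"
  proof -
    have "x \<noteq> []" using that k by auto
    then have "rev x = rev (tl x) @ [hd x]" by (metis list.collapse rev.simps(2))
    then show ?thesis using that assms(1) by simp
  qed
  \<comment> \<open>Without their last symbols the reversals keep their order only weakly; that the
    targets differ makes it strict.\<close>
  have mono: "rev (tl u) \<le> rev (tl v)" if "rev u < rev v"
  proof -
    have "rev (tl x) = take (k - 1) (rev x)" if "length x = k" for x :: "nat list"
    proof -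
      have "x \<noteq> []" using that k by auto
      then have "rev x = rev (tl x) @ [hd x]" by (metis list.collapse rev.simps(2))
      then show ?thesis using that by simp
    qed
    with len take_mono_lex[of "rev u" "rev v" "k - 1"] that show ?thesis by simp
  qed
  have "key (Suc h) (target y) = (lab y # take h (rev u), fst y, lab y # rev (tl u))"
    "key (Suc h) (target z) = (lab y # take h (rev v), fst z, lab y # rev (tl v))"
    using take[OF len(1)] take[OF len(2)] yz(5) by (simp_all add: key_def target_def u_def v_def)
  moreover have "(take h (rev u), fst y, rev u) < (take h (rev v), fst z, rev v)"
    using k1 by (simp add: key_def own_def u_def v_def)
  moreover have "rev (tl u) \<noteq> rev (tl v)" if "fst y = fst z"
    using ne that yz(5) by (auto simp: target_def u_def v_def)
  ultimately show ?thesis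
    using mono unfolding y_def[symmetric] z_def[symmetric] by (auto simp: less_le)
qed

lemma key_target_less_iff:
  assumes "Suc h \<le> k" and "i < length (E h)" and "j < length (E h)" and "mi (E h ! i)" and "mi (E h ! j)"
    and "lab (E h ! i) = lab (E h ! j)"
  shows "key (Suc h) (target (E h ! i)) < key (Suc h) (target (E h ! j)) \<longleftrightarrow> i < j"
proof -
  consider "i < j" | "i = j" | "j < i" by linarith
  then show ?thesis
  proof cases
    case 1
    with key_target_mono[OF assms(1) 1 assms(3-6)] show ?thesis by simp
  next
    case 3
    with key_target_mono[OF assms(1) 3 assms(2,5,4) assms(6)[symmetric]] show ?thesis by auto
  qed simp
qed

text \<open>Neither side has repetitions, so comparing sets suffices. Counts over the next merge can
  thereby be computed over the entries of the current one.\<close>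

lemma mset_targets: "mset (M h') = mset (roots @ map target (filter mi (E h)))"
proof -
  have "distinct (map target (filter mi (E h)))"
    unfolding distinct_map
  proof
    have "distinct (E h)"
      using sorted_E[of h] by (rule sorted_wrt_irrefl_distinct) auto
    then show "distinct (filter mi (E h))" by simp
    show "inj_on target (set (filter mi (E h)))"
    proof (rule inj_onI)
      fix y z assume yz: "y \<in> set (filter mi (E h))" "z \<in> set (filter mi (E h))" "target y = target z"
      with inj_target[of y h z] have "own y = own z" "lab y = lab z" by auto
      moreover obtain i j where "y = E h ! i" "z = E h ! j" "i < length (E h)" "j < length (E h)"
        using yz by (auto simp: in_set_conv_nth)
      ultimately show "y = z"
        using sorted_wrt_nth_less[OF sorted_E, of i j h] sorted_wrt_nth_less[OF sorted_E, of j i h]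
        by (metis less_irrefl linorder_neqE_nat)
    qed
  qed
  moreover have "distinct roots"
    by (simp add: roots_def)
  \<comment> \<open>Roots end in the padding symbol, targets in a label, which is positive.\<close>
  moreover have "set roots \<inter> set (map target (filter mi (E h))) = {}"
  proof -
    have "last (snd x) = 0" if "x \<in> set roots" for x
      using that k by (auto simp: roots_def last_replicate split: if_splits)
    moreover have "last (snd x) \<noteq> 0" if "x \<in> set (map target (filter mi (E h)))" for x
      using that minus_label by (force simp: target_def)
    ultimately show ?thesis by blast
  qed
  moreover have "set (M h') = set (roots @ map target (filter mi (E h)))"
  proof (rule set_eqI)
    fix x :: "bool \<times> nat list"
    obtain b v where x: "x = (b, v)" by force
    have 1: "x \<in> set roots \<longleftrightarrow> v = replicate k 0 \<and> C b \<noteq> {}"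
      by (cases b) (auto simp: x roots_def)
    show "x \<in> set (M h') \<longleftrightarrow> x \<in> set (roots @ map target (filter mi (E h)))"
    proof
      assume "x \<in> set (M h')"
      then have v: "v \<in> nodes k (C b)" by (simp add: set_M x)
      show "x \<in> set (roots @ map target (filter mi (E h)))"
      proof (cases "v = replicate k 0")
        case True
        then show ?thesis using 1 v by auto
      next
        case False
        from node_has_minus_bit[OF graph_facts fin v False] obtain u where
          u: "minus_bit k (C b) (u, last v)" "tl u = butlast v" by blast
        with E_complete obtain z where "(b, u, last v, True, z) \<in> set (E h)" by blast
        moreover have "v \<noteq> []" using v k by (auto simp: nodes_def)
        then have "target (b, u, last v, True, z) = x"
          using u by (simp add: target_def x)
        ultimately show ?thesis by force
      qed
    next
      assume "x \<in> set (roots @ map target (filter mi (E h)))"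
      then consider "x \<in> set roots" | y where "y \<in> set (E h)" "mi y" "x = target y" by auto
      then show "x \<in> set (M h')"
      proof cases
        case 1
        with \<open>x \<in> set roots \<longleftrightarrow> _\<close> show ?thesis by (auto simp: set_M x root_node)
      next
        case 2
        with in_E[OF 2(1,2)] show ?thesis
          by (auto simp: set_M target_def minus_bit_iff[OF graph_facts] intro!: arc_target[OF graph_facts])
      qed
    qed
  qed
  ultimately show ?thesis
    using distinct_M[of h'] by (intro set_eq_iff_mset_eq_distinct[THEN iffD1]) auto
qed

section \<open>Positions in the counting sort\<close>

definition inputs :: "(nat \<times> bool \<times> bool) list" where
  "inputs = graph_entries k (C False) @ graph_entries k (C True)"

definition cnt :: "nat \<Rightarrow> nat" where
  "cnt c = length (filter (\<lambda>x. fst (snd x) \<and> fst x = c) inputs)"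

text \<open>Counted from the end of the merge: a descending pass over the labels then obtains it by
  subtraction, without counting the roots.\<close>

definition first_pos :: "nat \<Rightarrow> nat" where
  "first_pos c = num - length (filter (\<lambda>x. fst (snd x) \<and> c \<le> fst x) inputs)"

definition pos :: "nat \<Rightarrow> nat \<Rightarrow> nat" where
  "pos h q = first_pos (lab (E h ! q)) +
     length (filter (\<lambda>y. mi y \<and> lab y = lab (E h ! q)) (take q (E h)))"

lemma length_E [simp]: "length (E h) = length inputs"
  using mset_E[of h] unfolding inputs_def by (metis length_map mset_eq_length)

lemma count_E: "length (filter (\<lambda>y. P (snd (snd y))) (E h)) = length (filter P inputs)"
proof -
  have "mset (filter P (map (\<lambda>y. snd (snd y)) (E h))) = mset (filter P inputs)"
    by (simp only: mset_filter mset_E inputs_def)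
  from mset_eq_length[OF this] show ?thesis by (simp add: filter_map comp_def)
qed

lemma num_split: "num = length roots + length (filter mi (E h))"
  using mset_eq_length[OF mset_targets[of 0 h]] by simp

lemma count_M: "length (filter P (M h')) = length (filter P (roots @ map target (filter mi (E h))))"
  by (rule mset_eq_length) (simp only: mset_filter mset_targets[of h' h])

lemma first_pos_eq: "first_pos c = length roots + length (filter (\<lambda>y. mi y \<and> lab y < c) (E h))"
proof -
  have "length (filter mi xs) = length (filter (\<lambda>y. mi y \<and> lab y < c) xs) +
    length (filter (\<lambda>y. mi y \<and> c \<le> lab y) xs)" for xs
    by (induction xs) auto
  then show ?thesis
    using count_E[of "\<lambda>x. fst (snd x) \<and> c \<le> fst x" h] num_split[of h] by (simp add: first_pos_def)
qed

lemma key_target: "key (Suc h) (target y) =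
    (lab y # take h (rev (tl (fst (snd y)))), fst y, lab y # rev (tl (fst (snd y))))"
  by (simp add: key_def target_def)

lemma key_target_label:
  assumes "lab y \<noteq> lab z"
  shows "key (Suc h) (target y) < key (Suc h) (target z) \<longleftrightarrow> lab y < lab z"
  using assms unfolding key_target by (cases "lab y < lab z") simp_all

text \<open>The reversal of a root begins with the padding symbol, that of a target with a positive
  label.\<close>

lemma roots_first:
  assumes "x \<in> set roots" and "y \<in> set (E h)" and "mi y"
  shows "key (Suc h') x < key (Suc h') (target y)"
proof -
  obtain k' where k': "k = Suc k'" using k by (cases k) auto
  from assms(1) obtain b where "x = (b, replicate k 0)" by (auto simp: roots_def split: if_splits)
  moreover have "rev (replicate k (0 :: nat)) = 0 # replicate k' 0"
    unfolding rev_replicate by (simp add: k')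
  ultimately have "key (Suc h') x = (0 # take h' (replicate k' 0), b, 0 # replicate k' 0)"
    by (simp add: key_def del: rev_replicate)
  with minus_label[OF assms(2,3)] show ?thesis by (simp add: key_target less_prod_def)
qed

text \<open>Before the target of entry \<open>q\<close> come the roots, the targets with a smaller
  label, wherever they are scanned, and those with the same label scanned before \<open>q\<close>.
  Hence the split of the scan at \<open>q\<close>.\<close>

lemma filter_less_target:
  assumes h: "Suc h \<le> k" and q: "q < length (E h)" and m: "mi (E h ! q)"
  shows "length (filter (\<lambda>y. key (Suc h) y < key (Suc h) (target (E h ! q))) (M (Suc h))) = pos h q"
proof -
  define t c where "t = E h ! q" and "c = lab t"
  define P where "P x \<longleftrightarrow> key (Suc h) x < key (Suc h) (target t)" for x
  have t: "t \<in> set (E h)" "mi t" using q m by (auto simp: t_def)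
  have "length (filter P (M (Suc h))) = length (filter P (roots @ map target (filter mi (E h))))"
    by (rule count_M)
  also have "\<dots> = length roots + length (filter (\<lambda>y. mi y \<and> P (target y)) (E h))"
  proof -
    have "filter P roots = roots"
      by (rule filter_True) (use roots_first[OF _ t] in \<open>auto simp: P_def\<close>)
    moreover have "length (filter P (map target (filter mi (E h)))) =
        length (filter (\<lambda>y. mi y \<and> P (target y)) (E h))"
      by (simp add: filter_map comp_def)
    ultimately show ?thesis by simp
  qed
  also have "filter (\<lambda>y. mi y \<and> P (target y)) (E h) =
    filter (\<lambda>y. mi y \<and> P (target y)) (take q (E h)) @ filter (\<lambda>y. mi y \<and> P (target y)) (drop (Suc q) (E h))"
    by (subst id_take_nth_drop[OF q]) (simp add: P_def t_def)
  also have "filter (\<lambda>y. mi y \<and> P (target y)) (take q (E h)) = filter (\<lambda>y. mi y \<and> lab y \<le> c) (take q (E h))"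
  proof (rule filter_cong[OF refl])
    fix y assume "y \<in> set (take q (E h))"
    then obtain i where i: "i < q" "y = E h ! i" using q by (auto simp: in_set_conv_nth)
    show "(mi y \<and> P (target y)) = (mi y \<and> lab y \<le> c)"
      using key_target_less_iff[OF h _ q, of i] key_target_label[of y t h] i q m
      by (cases "lab y = c") (auto simp: P_def c_def t_def)
  qed
  also have "filter (\<lambda>y. mi y \<and> P (target y)) (drop (Suc q) (E h)) = filter (\<lambda>y. mi y \<and> lab y < c) (drop (Suc q) (E h))"
  proof (rule filter_cong[OF refl])
    fix y assume "y \<in> set (drop (Suc q) (E h))"
    then obtain i' where "i' < length (drop (Suc q) (E h))" "drop (Suc q) (E h) ! i' = y"
      unfolding in_set_conv_nth by blast
    then obtain i where i: "i < length (E h)" "q < i" "y = E h ! i"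
      by (intro that[of "Suc q + i'"]) auto
    show "(mi y \<and> P (target y)) = (mi y \<and> lab y < c)"
      using key_target_less_iff[OF h i(1) q] key_target_label[of y t h] i q m
      by (cases "lab y = c") (auto simp: P_def c_def t_def)
  qed
  also have "length roots + length (filter (\<lambda>y. mi y \<and> lab y \<le> c) (take q (E h)) @
      filter (\<lambda>y. mi y \<and> lab y < c) (drop (Suc q) (E h))) = pos h q"
  proof -
    have "length (filter (\<lambda>y. mi y \<and> lab y \<le> c) xs) = length (filter (\<lambda>y. mi y \<and> lab y < c) xs) +
        length (filter (\<lambda>y. mi y \<and> lab y = c) xs)" for xs
      by (induction xs) auto
    moreover have "filter (\<lambda>y. mi y \<and> lab y < c) (E h) =
        filter (\<lambda>y. mi y \<and> lab y < c) (take q (E h)) @ filter (\<lambda>y. mi y \<and> lab y < c) (drop (Suc q) (E h))"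
      by (subst id_take_nth_drop[OF q]) (simp add: c_def t_def)
    ultimately show ?thesis
      by (simp add: pos_def first_pos_eq[of _ h] c_def t_def)
  qed
  finally show ?thesis by (simp add: P_def[abs_def] t_def)
qed

lemma key_M_less_iff:
  assumes "i < num" and "j < num"
  shows "key h (M h ! i) < key h (M h ! j) \<longleftrightarrow> i < j"
proof -
  have *: "key h (M h ! i) < key h (M h ! j)" if "i < j" "j < num" for i j
    using sorted_wrt_nth_less[OF sorted_M[of h] that(1)] that by simp
  consider "i < j" | "i = j" | "j < i" by linarith
  then show ?thesis
  proof cases
    case 1
    with *[OF 1 assms(2)] show ?thesis by simp
  next
    case 3
    with *[OF 3 assms(1)] show ?thesis by auto
  qed simp
qed

lemma M_nth_count:
  assumes "x \<in> set (M h)"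
  shows "length (filter (\<lambda>y. key h y < key h x) (M h)) < num"
    and "M h ! length (filter (\<lambda>y. key h y < key h x) (M h)) = x"
proof -
  let ?n = "length (filter (\<lambda>y. key h y < key h x) (M h))"
  have x: "key h x \<in> set (map (key h) (M h))" using assms by simp
  have e: "length (filter (\<lambda>y. y < key h x) (map (key h) (M h))) = ?n"
    by (simp add: filter_map comp_def)
  from nth_length_filter_less(1)[OF sorted_M x] show n: "?n < num" unfolding e by simp
  from nth_length_filter_less(2)[OF sorted_M x] n have "key h (M h ! ?n) = key h x" unfolding e by simp
  then show "M h ! ?n = x" using inj_key[of h UNIV] by (auto dest: injD)
qed

lemma target_in_M: "y \<in> set (E h) \<Longrightarrow> mi y \<Longrightarrow> target y \<in> set (M h')"
  using arg_cong[OF mset_targets[of h' h], of set_mset] by auto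

text \<open>Rank equals index in a strictly sorted list, so counting smaller keys locates the target
  in the next merge.\<close>

lemma M_pos:
  assumes "Suc h \<le> k" and "q < length (E h)" and "mi (E h ! q)"
  shows "pos h q < num" and "M (Suc h) ! pos h q = target (E h ! q)"
proof -
  have "target (E h ! q) \<in> set (M (Suc h))"
    by (rule target_in_M[OF nth_mem[OF assms(2)] assms(3)])
  from M_nth_count[OF this]
  show "pos h q < num" and "M (Suc h) ! pos h q = target (E h ! q)"
    unfolding filter_less_target[OF assms] .
qed

lemma M_root:
  assumes "i < length roots"
  shows "M (Suc h) ! i = roots ! i"
proof -
  let ?x = "roots ! i"
  let ?P = "\<lambda>y. key (Suc h) y < key (Suc h) ?x"
  have "filter ?P (map target (filter mi (E h))) = []"
    using roots_first[OF nth_mem[OF assms], of _ h h] by (auto simp: filter_empty_conv dest: less_asym)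
  then have "length (filter ?P (M (Suc h))) = length (filter ?P roots)"
    unfolding count_M[of _ "Suc h" h] filter_append by simp
  also have "\<dots> = i"
    using assms by (cases "C False = {}"; cases "C True = {}") (auto simp: roots_def key_def less_Suc_eq)
  finally have "length (filter ?P (M (Suc h))) = i" .
  moreover have "?x \<in> set (M (Suc h))"
    using nth_mem[OF assms] arg_cong[OF mset_targets[of "Suc h" h], of set_mset] by simp
  ultimately show ?thesis using M_nth_count(2)[of ?x "Suc h"] by simp
qed

lemma M_cases:
  assumes "j < num"
  obtains "j < length roots"
  | q where "q < length (E h)" "mi (E h ! q)" "target (E h ! q) = M (Suc h) ! j"
proof -
  have "M (Suc h) ! j \<in> set (roots @ map target (filter mi (E h)))"
    using mset_targets[of "Suc h" h] assms by (metis length_M nth_mem set_mset_mset)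
  then consider "M (Suc h) ! j \<in> set roots" | y where "y \<in> set (E h)" "mi y" "M (Suc h) ! j = target y"
    by auto
  then show ?thesis
  proof cases
    case 1
    then obtain i where i: "i < length roots" "M (Suc h) ! j = M (Suc h) ! i"
      using M_root by (auto simp: in_set_conv_nth)
    moreover have "i < num" using i num_split[of h] by simp
    ultimately have "j = i" using distinct_M[of "Suc h"] assms by (simp add: nth_eq_iff_index_eq)
    with i show ?thesis using that(1) by simp
  next
    case 2
    then show ?thesis using that(2) by (auto simp: in_set_conv_nth)
  qed
qed

lemma pos_unique:
  assumes "Suc h \<le> k" and "q < length (E h)" and "mi (E h ! q)" and "j < num"
    and "target (E h ! q) = M (Suc h) ! j"
  shows "j = pos h q"
proof -
  have "M (Suc h) ! j = M (Suc h) ! pos h q" using M_pos(2)[OF assms(1-3)] assms(5) by simp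
  then show ?thesis
    using nth_eq_iff_index_eq[OF distinct_M[of "Suc h"], of j "pos h q"] M_pos(1)[OF assms(1-3)] assms(4)
    by simp
qed

lemma pos_ge_roots: "length roots \<le> pos h q"
  by (simp add: pos_def first_pos_eq[of _ h])

text \<open>These are the ones of the next origin vector. The root of the second graph has index 1
  behind the other root, and 0 if the first graph is empty, whence \<open>of_bool\<close>.\<close>

lemma fst_M_Suc:
  assumes "Suc h \<le> k" and "j < num"
  shows "fst (M (Suc h) ! j) \<longleftrightarrow> C True \<noteq> {} \<and> j = of_bool (C False \<noteq> {}) \<or>
    (\<exists>q<length (E h). mi (E h ! q) \<and> fst (E h ! q) \<and> pos h q = j)"
proof (cases "j < length roots")
  case True
  with pos_ge_roots have "pos h q \<noteq> j" for q by (metis not_le)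
  then show ?thesis
    using M_root[OF True, of h] True by (auto simp: roots_def less_Suc_eq split: if_splits)
next
  case False
  with assms(2) obtain q where q: "q < length (E h)" "mi (E h ! q)" "target (E h ! q) = M (Suc h) ! j"
    by (elim M_cases[where h = h]) auto
  with pos_unique[OF assms(1) q(1,2) assms(2)] have "j = pos h q" by simp
  moreover have "\<not> (C True \<noteq> {} \<and> j = of_bool (C False \<noteq> {}))"
    using False by (cases "C False = {}"; cases "C True = {}") (auto simp: roots_def)
  moreover have "fst (E h ! q') = fst (E h ! q)" if "q' < length (E h)" "mi (E h ! q')" "pos h q' = j" for q'
    using M_pos[OF assms(1) that(1,2)] that q by (auto simp: target_def)
  moreover have "fst (M (Suc h) ! j) = fst (E h ! q)" using q(3)[symmetric] by (simp add: target_def)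
  ultimately show ?thesis using q(1,2) by metis
qed

section \<open>Block starts of the next merge\<close>

definition fresh :: "nat \<Rightarrow> nat \<Rightarrow> bool" where
  "fresh h q \<longleftrightarrow> (\<forall>i<q. mi (E h ! i) \<longrightarrow> lab (E h ! i) = lab (E h ! q) \<longrightarrow>
     kt h (own (E h ! i)) \<noteq> kt h (own (E h ! q)))"

text \<open>A block of the next order is given by a label and a current block: the symbol cut off
  from the source lies beyond its first \<open>h\<close> reversed symbols.\<close>

lemma kt_target:
  assumes "Suc h \<le> k" and "y \<in> set (E h)" and "mi y"
  shows "kt (Suc h) (target y) = lab y # kt h (own y)"
proof -
  have l: "length (fst (snd y)) = k" by (rule minus_length[OF assms(2,3)])
  then have "fst (snd y) \<noteq> []" using k by (cases "fst (snd y)") simp_all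
  then have "rev (fst (snd y)) = rev (tl (fst (snd y))) @ [hd (fst (snd y))]"
    by (metis list.collapse rev.simps(2))
  with l assms(1) show ?thesis by (simp add: kt_def target_def own_def)
qed

text \<open>For a fixed label the positions follow the scan order, so the first target in a block is
  the first one scanned. A root cannot share the block, as its key begins with the padding
  symbol.\<close>

lemma starts_pos:
  assumes "Suc h \<le> k" and "q < length (E h)" and "mi (E h ! q)"
  shows "starts (kl (Suc h)) (pos h q) \<longleftrightarrow> fresh h q"
proof
  let ?y = "E h ! q"
  have kl_pos: "kl (Suc h) ! pos h i = lab (E h ! i) # kt h (own (E h ! i))"
    if "i < length (E h)" "mi (E h ! i)" for i
    using M_pos[OF assms(1) that] nth_kl[of "Suc h" "Suc h" "pos h i"] kt_target[OF assms(1)] that by simp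
  have less: "pos h i < pos h j \<longleftrightarrow> key (Suc h) (M (Suc h) ! pos h i) < key (Suc h) (M (Suc h) ! pos h j)"
    if "i < length (E h)" "mi (E h ! i)" "j < length (E h)" "mi (E h ! j)" for i j
    using key_M_less_iff[of "pos h i" "pos h j" "Suc h"] M_pos(1)[OF assms(1) that(1,2)]
      M_pos(1)[OF assms(1) that(3,4)] by simp
  {
    assume s: "starts (kl (Suc h)) (pos h q)"
    show "fresh h q"
      unfolding fresh_def
    proof (intro allI impI notI)
      fix i assume i: "i < q" "mi (E h ! i)" "lab (E h ! i) = lab ?y" "kt h (own (E h ! i)) = kt h (own ?y)"
      with assms have "i < length (E h)" by simp
      with i assms have "pos h i < pos h q"
        using less[of i q] M_pos[OF assms(1), of i] M_pos[OF assms] key_target_less_iff[OF assms(1), of i q] by simp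
      with s kl_pos[of i] kl_pos[OF assms(2,3)] i \<open>i < length (E h)\<close> show False by (simp add: starts_def)
    qed
  }
  {
    assume f: "fresh h q"
    show "starts (kl (Suc h)) (pos h q)"
      unfolding starts_def
    proof (intro allI impI notI)
      fix j assume j: "j < pos h q" "kl (Suc h) ! j = kl (Suc h) ! pos h q"
      then have jn: "j < num" using M_pos(1)[OF assms] by simp
      then have kj: "kl (Suc h) ! j = kt (Suc h) (M (Suc h) ! j)" by (simp add: nth_kl)
      from jn show False
      proof (cases rule: M_cases[where h = h])
        case 1
        then have "M (Suc h) ! j \<in> set roots" using M_root[OF 1] by simp
        then have "kl (Suc h) ! j = replicate (Suc h) 0"
          using kj assms(1) by (auto simp: roots_def kt_def min_def split: if_splits)
        moreover have "lab ?y \<noteq> 0" using minus_label[of ?y h] assms by auto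
        ultimately show False using j(2) kl_pos[OF assms(2,3)] by simp
      next
        case (2 i)
        then have ji: "j = pos h i" using pos_unique[OF assms(1)] jn by simp
        with kl_pos 2 j(2) kl_pos[OF assms(2,3)] have "lab (E h ! i) = lab ?y"
          "kt h (own (E h ! i)) = kt h (own ?y)" by auto
        moreover from this have "i < q"
          using less[OF 2(1,2) assms(2,3)] ji j(1) M_pos[OF assms(1) 2(1,2)] M_pos[OF assms]
            key_target_less_iff[OF assms(1) 2(1) assms(2) 2(2) assms(3)] by simp
        ultimately show False using f 2 by (simp add: fresh_def)
      qed
    qed
  }
qed

text \<open>Roots of both graphs carry the same key, so together they form the block at index 0 and
  a second root starts none.\<close>

lemma starts_Suc:
  assumes "Suc h \<le> k" and "j < num"
  shows "starts (kl (Suc h)) j \<longleftrightarrow> j = 0 \<or> (\<exists>q<length (E h). mi (E h ! q) \<and> fresh h q \<and> pos h q = j)"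
proof (cases "j < length roots")
  case True
  with pos_ge_roots have "pos h q \<noteq> j" for q by (metis not_le)
  moreover have "\<not> starts (kl (Suc h)) j" if "j \<noteq> 0"
  proof -
    have "0 < length roots" by (rule le_less_trans[OF _ True]) simp
    then have "kl (Suc h) ! i = take (Suc h) (replicate k 0)" if "i < length roots" for i
      using that True assms(2) num_split[of 0]
      by (simp add: nth_kl[of "Suc h" "Suc h"] M_root kt_def) (auto simp: roots_def less_Suc_eq split: if_splits)
    from this[OF \<open>0 < length roots\<close>] this[OF True] that show ?thesis
      by (auto simp: starts_def intro!: exI[of _ 0])
  qed
  ultimately show ?thesis by auto
next
  case False
  with assms(2) obtain q where q: "q < length (E h)" "mi (E h ! q)" "target (E h ! q) = M (Suc h) ! j"
    by (elim M_cases[where h = h]) auto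
  with pos_unique[OF assms(1) q(1,2) assms(2)] have "j = pos h q" by simp
  moreover have "j \<noteq> 0" using False nonempty by (auto simp: roots_def split: if_splits)
  ultimately show ?thesis using starts_pos[OF assms(1)] q by metis
qed

text \<open>The index of the first node of the block, plus one. At a block start it is read off the
  current position, without a counter of blocks.\<close>

definition block :: "nat \<Rightarrow> bool \<times> nat list \<Rightarrow> nat" where
  "block h x = Suc (below (kl h) (kt h x))"

definition seen :: "nat \<Rightarrow> nat \<Rightarrow> (nat \<times> nat) list" where
  "seen h q = map (\<lambda>y. (lab y, block h (own y))) (filter mi (take q (E h)))"

lemma own_in_M: "q < length (E h) \<Longrightarrow> own (E h ! q) \<in> set (M h)"
  using count_la[of q h] by (metis length_M nth_mem)

lemma kt_in_kl: "x \<in> set (M h) \<Longrightarrow> kt h x \<in> set (kl h)"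
  by (simp add: kl_def)

text \<open>Block numbers ascend during the scan and identify prefixes, so one cell per label
  replaces a search through all earlier entries.\<close>

lemma fresh_iff_latest:
  assumes "q < length (E h)"
  shows "fresh h q \<longleftrightarrow> latest (seen h q) (lab (E h ! q)) \<noteq> block h (own (E h ! q))"
proof -
  let ?y = "E h ! q"
  have mono: "sorted (map (\<lambda>y. block h (own y)) (E h))"
    unfolding sorted_map using sorted_E[of h]
    by (rule sorted_wrt_mono_rel[rotated]) (auto simp: block_def key_def kt_def intro!: below_mono)
  then have "sorted (map (\<lambda>y. block h (own y)) (take q (E h)))"
    by (metis sorted_wrt_take take_map)
  then have "sorted (map snd (seen h q))"
    by (simp add: seen_def comp_def sorted_filter)
  moreover have "\<forall>x\<in>set (seen h q). snd x \<le> block h (own ?y)"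
  proof -
    have "block h (own y) \<le> block h (own ?y)" if "y \<in> set (take q (E h))" for y
    proof -
      from that assms obtain i where "i < q" "y = E h ! i" by (auto simp: in_set_conv_nth)
      with sorted_nth_mono[OF mono, of i q] assms show ?thesis by simp
    qed
    then show ?thesis by (auto simp: seen_def)
  qed
  ultimately have "latest (seen h q) (lab ?y) = block h (own ?y) \<longleftrightarrow> (lab ?y, block h (own ?y)) \<in> set (seen h q)"
    by (rule latest_eq_iff) (simp add: block_def)
  also have "\<dots> \<longleftrightarrow> (\<exists>i<q. mi (E h ! i) \<and> lab (E h ! i) = lab ?y \<and> block h (own (E h ! i)) = block h (own ?y))"
  proof -
    have "set (filter mi (take q (E h))) = (\<lambda>i. E h ! i) ` {i. i < q \<and> mi (E h ! i)}"
      using assms nth_image[of q "E h"] by (auto simp: nth_image[symmetric])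
    then have "set (seen h q) =
        (\<lambda>i. (lab (E h ! i), block h (own (E h ! i)))) ` {i. i < q \<and> mi (E h ! i)}"
      unfolding seen_def set_map by (simp only: image_image)
    then show ?thesis by (auto simp: eq_commute[of "lab (E h ! q)"] eq_commute[of "block h (own (E h ! q))"])
  qed
  also have "\<dots> \<longleftrightarrow> \<not> fresh h q"
  proof -
    have "block h (own (E h ! i)) = block h (own ?y) \<longleftrightarrow> kt h (own (E h ! i)) = kt h (own ?y)" if "i < q" for i
      using below_inj[OF _ kt_in_kl[OF own_in_M] kt_in_kl[OF own_in_M], of h i q] that assms
      by (auto simp: block_def)
    then show ?thesis by (auto simp: fresh_def)
  qed
  finally show ?thesis by auto
qed

end

section \<open>The union graph\<close>

text \<open>The labels of a union node from the \<open>W\<close> entries of its copies: the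
  \<open>0\<close> of a copy without outgoing edges disappears as soon as the other copy has an
  edge.\<close>

definition labels_of :: "nat set \<Rightarrow> nat list" where
  "labels_of S = (if S = {0} then [0] else sorted_list_of_set (S - {0}))"

lemma labels_of_empty [simp]: "labels_of {} = []"
  by (simp add: labels_of_def)

lemma labels_of_eq_Nil: "finite S \<Longrightarrow> labels_of S = [] \<longleftrightarrow> S = {}"
  by (auto simp: labels_of_def)

text \<open>\<open>0\<close> is smallest and therefore met before any label, so a merging step can
  decide from what is left whether it has to be dropped.\<close>

lemma labels_of_step:
  assumes "finite S" and "c \<in> S" and "\<forall>x\<in>S. c \<le> x"
  shows "labels_of S = (if c = 0 \<and> S - {c} \<noteq> {} then labels_of (S - {c}) else c # labels_of (S - {c}))"
proof (cases "c = 0")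
  case True
  then show ?thesis
    using assms by (cases "S - {0} = {}") (auto simp: labels_of_def insert_absorb)
next
  case False
  have "c = Min S" using assms by (metis Min_eqI)
  then have "sorted_list_of_set S = c # sorted_list_of_set (S - {c})"
    using assms sorted_list_of_set_nonempty[of S] by auto
  moreover have "0 \<notin> S" using assms(3) False by auto
  then have "labels_of S = sorted_list_of_set S" "labels_of (S - {c}) = sorted_list_of_set (S - {c})"
    by (auto simp: labels_of_def)
  ultimately show ?thesis using False by simp
qed

context two_graphs
begin

text \<open>With \<open>block_not_starts\<close>, this tracks the current block along a merge:
  renewed at a start, inherited elsewhere. The merge may be of higher order than the blocks, as in
  the output with \<open>k\<close> and \<open>k - 1\<close>.\<close>

lemma block_starts:
  assumes "h \<le> h'" and "i < num" and "starts (kl h) i"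
  shows "block h (M h' ! i) = Suc i"
  using below_starts[OF sorted_kl, of i h] nth_kl[OF assms(1,2)] assms by (simp add: block_def)

lemma block_not_starts:
  assumes "h \<le> h'" and "Suc i < num" and "\<not> starts (kl h) (Suc i)"
  shows "block h (M h' ! Suc i) = block h (M h' ! i)"
  using not_starts_Suc[OF sorted_kl, of i h] nth_kl[OF assms(1)] assms by (simp add: block_def)

definition CU :: "nat list set" where
  "CU = C False \<union> C True"

lemma CU: "finite CU" "\<forall>s\<in>CU. set s \<subseteq> {1..\<sigma>}" "CU \<noteq> {}"
  using fin alphabet nonempty by (auto simp: CU_def)

lemmas CU_facts = k CU(2)

lemma nodes_CU: "u \<in> nodes k CU \<longleftrightarrow> (\<exists>b. u \<in> nodes k (C b))"
  by (auto simp: CU_def nodes_Un) (metis (full_types))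

lemma arc_CU: "arc k CU u c \<longleftrightarrow> (\<exists>b. arc k (C b) u c)"
  by (auto simp: CU_def arc_Un) (metis (full_types))

text \<open>For a node absent from the graph, \<open>node_W\<close> would yield \<open>[0]\<close>,
  which has to be told from a node of out-degree zero.\<close>

definition node_labels :: "bool \<Rightarrow> nat list \<Rightarrow> nat list" where
  "node_labels b u = (if u \<in> nodes k (C b) then node_W k (C b) u else [])"

lemma node_W_CU:
  assumes "u \<in> nodes k CU"
  shows "node_W k CU u = labels_of (set (node_labels False u) \<union> set (node_labels True u))"
proof -
  let ?A = "\<lambda>b. {c. arc k (C b) u c}"
  have A: "?A b \<subseteq> {1..\<sigma>}" for b using arc_label[OF graph_facts] by blast
  have AU: "{c. arc k CU u c} = ?A False \<union> ?A True"
    by (auto simp: arc_CU) (metis (full_types))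
  have s: "set (node_labels b u) = (if u \<notin> nodes k (C b) then {} else if ?A b = {} then {0} else ?A b)" for b
    by (auto simp: node_labels_def set_node_W[OF graph_facts fin])
  have n: "?A b = {}" if "u \<notin> nodes k (C b)" for b
    using that arc_node[OF graph_facts] by blast
  have W: "node_W k CU u = (if ?A False \<union> ?A True = {} then [0] else sorted_list_of_set (?A False \<union> ?A True))"
    unfolding node_W_def out_labels_eq[OF CU_facts] AU by (rule refl)
  show ?thesis
  proof (cases "?A False \<union> ?A True = {}")
    case True
    then have "set (node_labels False u) \<union> set (node_labels True u) = {0}"
      using assms unfolding s nodes_CU by auto (metis (full_types))+
    with True show ?thesis unfolding W by (simp add: labels_of_def)
  next
    case False
    have "set (node_labels False u) \<union> set (node_labels True u) - {0} = ?A False \<union> ?A True"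
      using n[of False] n[of True] A[of False] A[of True] unfolding s by auto
    moreover from this have "set (node_labels False u) \<union> set (node_labels True u) \<noteq> {0}" using False by auto
    ultimately show ?thesis using False unfolding W labels_of_def by simp
  qed
qed

section \<open>Equal nodes in the final merge\<close>

lemma kl_k: "i < num \<Longrightarrow> kl k ! i = rev (snd (M k ! i))"
proof -
  assume i: "i < num"
  then have "M k ! i \<in> set (M k)" by simp
  then have "length (snd (M k ! i)) = k" by (auto simp: set_M length_node)
  with i show ?thesis by (simp add: nth_kl[of k k] kt_def)
qed

text \<open>A block of order \<open>k\<close> is a single node, present in one graph or in both, so
  looking one position ahead finds its end.\<close>

definition block_end :: "nat \<Rightarrow> nat" where
  "block_end i = (if Suc i < num \<and> \<not> starts (kl k) (Suc i) then Suc (Suc i) else Suc i)"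

definition boundary :: "nat \<Rightarrow> bool" where
  "boundary i \<longleftrightarrow> i \<le> num \<and> (i < num \<longrightarrow> starts (kl k) i)"

text \<open>Two equal nodes differ in their graph, and the key puts the first graph in
  front.\<close>

lemma M_pair:
  assumes "Suc i < num" and "\<not> starts (kl k) (Suc i)"
  shows "M k ! i = (False, snd (M k ! i))" and "M k ! Suc i = (True, snd (M k ! i))"
proof -
  have "snd (M k ! Suc i) = snd (M k ! i)"
    using not_starts_Suc[OF sorted_kl, of i k] assms by (simp add: kl_k)
  moreover have "key k (M k ! i) < key k (M k ! Suc i)"
    using key_M_less_iff[of i "Suc i" k] assms by simp
  ultimately show "M k ! i = (False, snd (M k ! i))" and "M k ! Suc i = (True, snd (M k ! i))"
    by (auto simp: key_def prod_eq_iff)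
qed

text \<open>A third equal node would make the middle one the second of one pair and the first of
  another, with contradictory origins.\<close>

lemma boundary_block_end:
  assumes "i < num"
  shows "boundary (block_end i)"
proof (cases "Suc i < num \<and> \<not> starts (kl k) (Suc i)")
  case True
  have "starts (kl k) (Suc (Suc i))" if "Suc (Suc i) < num"
  proof (rule ccontr)
    assume "\<not> starts (kl k) (Suc (Suc i))"
    from M_pair(1)[OF that this] M_pair(2)[of i] True show False by simp
  qed
  with True show ?thesis by (simp add: boundary_def block_end_def)
qed (use assms in \<open>auto simp: boundary_def block_end_def\<close>)

lemma drop_block:
  assumes "i < num" and "boundary i"
  defines "u \<equiv> snd (M k ! i)"
  shows "drop i (M k) = map (\<lambda>b. (b, u)) (filter (\<lambda>b. u \<in> nodes k (C b)) [False, True]) @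
    drop (block_end i) (M k)"
proof (cases "Suc i < num \<and> \<not> starts (kl k) (Suc i)")
  case True
  then have p: "M k ! i = (False, u)" "M k ! Suc i = (True, u)" using M_pair[of i] by (auto simp: u_def)
  have "M k ! i \<in> set (M k)" "M k ! Suc i \<in> set (M k)" using True by simp_all
  then have "u \<in> nodes k (C False)" "u \<in> nodes k (C True)" unfolding p by (simp_all add: set_M)
  moreover have "drop i (M k) = M k ! i # M k ! Suc i # drop (Suc (Suc i)) (M k)"
    using True by (simp add: Cons_nth_drop_Suc)
  ultimately show ?thesis using True p by (simp add: block_end_def)
next
  case False
  obtain b where b: "M k ! i = (b, u)" by (metis u_def prod.collapse)
  have "M k ! i \<in> set (M k)" using assms(1) by simp
  then have "u \<in> nodes k (C b)" unfolding b by (simp add: set_M)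
  \<comment> \<open>A copy from the other graph would have the same key. It cannot stand before a
    block start, so by sortedness position \<open>Suc i\<close> would continue the block.\<close>
  moreover have "u \<notin> nodes k (C (\<not> b))"
  proof
    assume "u \<in> nodes k (C (\<not> b))"
    then have "(\<not> b, u) \<in> set (M k)" by (simp add: set_M)
    then obtain j where j: "j < num" "M k ! j = (\<not> b, u)" by (auto simp: in_set_conv_nth)
    then have eq: "kl k ! j = kl k ! i" using assms(1) j by (simp add: kl_k b)
    have "j \<noteq> i" using j b by auto
    moreover have "\<not> j < i" using eq assms(1,2) by (auto simp: boundary_def starts_def)
    ultimately have "Suc i \<le> j" by simp
    then have "kl k ! i \<le> kl k ! Suc i" "kl k ! Suc i \<le> kl k ! j"
      using j(1) by (auto intro!: sorted_nth_mono[OF sorted_kl])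
    with eq have "\<not> starts (kl k) (Suc i)" by (auto simp: starts_def intro!: exI[of _ i])
    moreover have "Suc i < num" using \<open>Suc i \<le> j\<close> j(1) by linarith
    ultimately show False using False by blast
  qed
  moreover have "drop i (M k) = M k ! i # drop (Suc i) (M k)"
    using assms(1) by (simp add: Cons_nth_drop_Suc)
  ultimately show ?thesis using False b unfolding block_end_def by (cases b) auto
qed

definition rest_nodes :: "nat \<Rightarrow> nat list list" where
  "rest_nodes i = remdups_adj (map snd (drop i (M k)))"

lemma rest_nodes_step:
  assumes "i < num" and "boundary i"
  shows "rest_nodes i = snd (M k ! i) # rest_nodes (block_end i)"
proof -
  let ?u = "snd (M k ! i)" and ?j = "block_end i"
  have ne: "x \<noteq> ?u" if "?j < num" "x = snd (M k ! ?j)" for x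
  proof
    assume "x = ?u"
    then have "kl k ! ?j = kl k ! i" using that assms by (simp add: kl_k)
    moreover have "starts (kl k) ?j" using boundary_block_end[OF assms(1)] that by (simp add: boundary_def)
    moreover have "i < ?j" by (simp add: block_end_def)
    ultimately show False by (auto simp: starts_def)
  qed
  have "remdups_adj (?u # map snd (drop ?j (M k))) = ?u # rest_nodes ?j"
  proof (cases "?j < num")
    case True
    then have "drop ?j (M k) = M k ! ?j # drop (Suc ?j) (M k)" by (simp add: Cons_nth_drop_Suc)
    with ne[OF True refl] show ?thesis by (simp add: rest_nodes_def)
  qed (simp add: rest_nodes_def)
  moreover have "remdups_adj (map snd (drop i (M k))) = remdups_adj (?u # map snd (drop ?j (M k)))"
  proof -
    have "?u \<in> nodes k (C (fst (M k ! i)))"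
      using nth_mem[of i "M k"] assms by (auto simp: set_M)
    then show ?thesis
      unfolding drop_block[OF assms] by (cases "fst (M k ! i)") auto
  qed
  ultimately show ?thesis by (simp add: rest_nodes_def)
qed

lemma distinct_remdups_adj_sorted: "sorted xs \<Longrightarrow> distinct (remdups_adj xs)"
  for xs :: "'a::linorder list"
  by (induction xs rule: remdups_adj.induct) (auto dest: order.antisym)

text \<open>Equal nodes are adjacent in the final merge, so dropping adjacent repetitions leaves a
  strictly sorted list, which is determined by its set.\<close>

lemma rest_nodes_0: "rest_nodes 0 = node_list k CU"
proof -
  have *: "sorted (map rev (map snd (M k)))"
  proof -
    have "map rev (map snd (M k)) = kl k"
      by (rule nth_equalityI) (auto simp: kl_k)
    then show ?thesis by (simp add: sorted_kl)
  qed
  then have "sorted (map rev (rest_nodes 0))"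
    by (simp add: rest_nodes_def sorted_remdups_adj flip: remdups_adj_map_injective)
  moreover have "distinct (map rev (rest_nodes 0))"
    using distinct_remdups_adj_sorted[OF *] by (simp add: rest_nodes_def flip: remdups_adj_map_injective)
  ultimately have "sorted_wrt (<) (map rev (rest_nodes 0))" by (simp add: strict_sorted_iff)
  moreover have "set (map rev (rest_nodes 0)) = set (map rev (node_list k CU))"
    by (auto simp: rest_nodes_def set_M set_node_list[OF CU(1)] nodes_CU image_iff)
  ultimately have "map rev (rest_nodes 0) = map rev (node_list k CU)"
    using sorted_node_list strict_sorted_equal by blast
  then show ?thesis by simp
qed

section \<open>Entries still to be read and entries written\<close>

definition rest_entries :: "bool \<Rightarrow> nat \<Rightarrow> (nat \<times> bool \<times> bool) list" where
  "rest_entries b i = concat (map (\<lambda>y. node_entries k (C b) (snd y)) (filter (\<lambda>y. fst y = b) (drop i (M k))))"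

lemma rest_entries_0: "rest_entries b 0 = graph_entries k (C b)"
  by (simp add: rest_entries_def filter_M graph_entries_def comp_def)

lemma rest_entries_step:
  assumes "i < num" and "boundary i"
  shows "rest_entries b i =
    flagged (\<lambda>c. minus_bit k (C b) (snd (M k ! i), c)) (node_labels b (snd (M k ! i))) @
    rest_entries b (block_end i)"
  unfolding rest_entries_def drop_block[OF assms]
  by (cases b) (auto simp: node_labels_def node_entries_def)

definition union_entries :: "nat list list \<Rightarrow> (nat list \<times> nat \<times> bool \<times> bool) list" where
  "union_entries us = concat (map (\<lambda>u. map (Pair u) (node_entries k CU u)) us)"

lemma map_snd_union_entries: "map snd (union_entries (node_list k CU)) = graph_entries k CU"
  by (simp add: union_entries_def graph_entries_def map_concat comp_def)

text \<open>Either origin gives the same block, which depends only on the prefix of the node. Zeros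
  are not labels of edges and leave no record.\<close>

definition seen_union :: "(nat list \<times> nat \<times> bool \<times> bool) list \<Rightarrow> (nat \<times> nat) list" where
  "seen_union xs = map (\<lambda>y. (fst (snd y), block (k - 1) (False, fst y))) (filter (\<lambda>y. fst (snd y) \<noteq> 0) xs)"

lemma rev_tl_take: "length u = k \<Longrightarrow> rev (tl u) = take (k - 1) (rev u)"
proof -
  assume "length u = k"
  then show ?thesis by (cases u) auto
qed

text \<open>Two nodes have an edge with label \<open>c\<close> to the same node iff they agree in all but the first
  symbol, that is, iff they are in the same block of order \<open>k - 1\<close>.\<close>

lemma union_minus:
  assumes xs: "union_entries (node_list k CU) = xs @ (u, c, m, l) # ys" and c: "c \<noteq> 0"
  shows "m \<longleftrightarrow> latest (seen_union xs) c \<noteq> block (k - 1) (False, u)"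
proof -
  let ?E = "union_entries (node_list k CU)"
  let ?R = "\<lambda>y z :: nat list \<times> nat \<times> bool \<times> bool. rev (fst y) < rev (fst z) \<or> fst y = fst z \<and> fst (snd y) < fst (snd z)"
  have sorted: "sorted_wrt ?R ?E"
    unfolding union_entries_def
  proof (rule sorted_wrt_concat_map[OF sorted_node_list])
    show "\<forall>u\<in>set (node_list k CU). sorted_wrt ?R (map (Pair u) (node_entries k CU u))"
    proof
      fix u
      have "sorted_wrt (<) (map fst (node_entries k CU u))" by (simp add: node_entries_def sorted_node_W)
      then show "sorted_wrt ?R (map (Pair u) (node_entries k CU u))" by (simp add: sorted_wrt_map)
    qed
  qed auto
  have E: "u' \<in> nodes k CU \<and> (c' \<noteq> 0 \<longrightarrow> arc k CU u' c') \<and> m' = minus_bit k CU (u', c')"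
    if "(u', c', m', l') \<in> set ?E" for u' c' m' l'
    using that by (auto simp: union_entries_def set_node_list[OF CU(1)] node_entries_def
      set_node_W[OF CU_facts CU(1)] dest!: set_flagged split: if_splits)
  have E': "\<exists>m' l'. (u', c', m', l') \<in> set ?E" if "arc k CU u' c'" for u' c'
  proof -
    have "u' \<in> nodes k CU" by (rule arc_node[OF CU_facts that])
    moreover have "c' \<in> set (node_W k CU u')" using that by (auto simp: set_node_W[OF CU_facts CU(1)])
    then obtain z where "(c', minus_bit k CU (u', c'), z) \<in> set (node_entries k CU u')"
      unfolding node_entries_def using flagged_complete[of c' _ "\<lambda>c. minus_bit k CU (u', c)"] by blast
    ultimately show ?thesis unfolding union_entries_def by (force simp: set_node_list[OF CU(1)])
  qed
  have kt: "kt (k - 1) (b, u') = rev (tl u')" if "u' \<in> nodes k CU" for b u'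
    using rev_tl_take[OF length_node[OF that]] by (simp add: kt_def)
  have mem: "rev (tl u') \<in> set (kl (k - 1))" if u': "u' \<in> nodes k CU" for u'
  proof -
    obtain b where "(b, u') \<in> set (M (k - 1))" using u' by (auto simp: set_M nodes_CU)
    from kt_in_kl[OF this] show ?thesis using kt[OF u'] by simp
  qed
  \<comment> \<open>Dropping the first symbol of a node truncates its reversal to
    \<open>k - 1\<close> symbols, and ranks are injective on occurring prefixes.\<close>
  have blk: "block (k - 1) (False, u') = block (k - 1) (False, v') \<longleftrightarrow> tl u' = tl v'"
    if "u' \<in> nodes k CU" "v' \<in> nodes k CU" for u' v'
    using below_inj[OF _ mem[OF that(1)] mem[OF that(2)]] kt[OF that(1)] kt[OF that(2)]
    by (auto simp: block_def)
  have blk_mono: "block (k - 1) (False, u') \<le> block (k - 1) (False, v')"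
    if "rev u' \<le> rev v'" for u' v'
    using that by (auto simp: block_def kt_def intro!: below_mono take_mono_lex)
  have le: "rev (fst y) \<le> rev (fst z)" if "?R y z" for y z using that by auto
  have xs_set: "set xs \<subseteq> set ?E" and u_in: "(u, c, m, l) \<in> set ?E" using xs by auto
  have srt: "sorted_wrt ?R xs" "\<forall>y\<in>set xs. ?R y (u, c, m, l)" "\<forall>y\<in>set ys. ?R (u, c, m, l) y"
    using sorted unfolding xs by (auto simp: sorted_wrt_append)
  have "sorted (map snd (seen_union xs))"
    unfolding seen_union_def map_map comp_def sorted_map snd_conv
    by (rule sorted_wrt_mono_rel[OF _ sorted_wrt_filter[OF srt(1)]]) (auto intro!: blk_mono[unfolded One_nat_def])
  moreover have "\<forall>x\<in>set (seen_union xs). snd x \<le> block (k - 1) (False, u)"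
    using srt(2) by (auto simp: seen_union_def less_imp_le intro!: blk_mono[unfolded One_nat_def])
  ultimately have "latest (seen_union xs) c = block (k - 1) (False, u) \<longleftrightarrow>
      (c, block (k - 1) (False, u)) \<in> set (seen_union xs)"
    by (rule latest_eq_iff) (simp add: block_def)
  \<comment> \<open>Entries are written by ascending source: of the edges with label
    \<open>c\<close>, exactly those with a smaller source have been recorded.\<close>
  also have "\<dots> \<longleftrightarrow> (\<exists>u'. arc k CU u' c \<and> tl u' = tl u \<and> rev u' < rev u)"
  proof
    assume "(c, block (k - 1) (False, u)) \<in> set (seen_union xs)"
    then obtain u' m' l' where y: "(u', c, m', l') \<in> set xs"
      "block (k - 1) (False, u') = block (k - 1) (False, u)"
      by (auto simp: seen_union_def)
    then have "arc k CU u' c" "tl u' = tl u" using E[of u' c m' l'] E[OF u_in] xs_set c blk by auto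
    moreover have "rev u' < rev u" using srt(2) y(1) by auto
    ultimately show "\<exists>u'. arc k CU u' c \<and> tl u' = tl u \<and> rev u' < rev u" by blast
  next
    assume "\<exists>u'. arc k CU u' c \<and> tl u' = tl u \<and> rev u' < rev u"
    then obtain u' where u': "arc k CU u' c" "tl u' = tl u" "rev u' < rev u" by blast
    from E'[OF u'(1)] obtain m' l' where y: "(u', c, m', l') \<in> set ?E" by blast
    then have "(u', c, m', l') \<in> set xs"
      using u'(3) srt(3) unfolding xs by fastforce
    moreover have "block (k - 1) (False, u') = block (k - 1) (False, u)"
      using blk E[OF y] E[OF u_in] u'(2) by simp
    ultimately show "(c, block (k - 1) (False, u)) \<in> set (seen_union xs)"
      using c by (force simp: seen_union_def)
  qed
  also have "\<dots> \<longleftrightarrow> \<not> m"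
    using E[OF u_in] c by (auto simp: minus_bit_iff[OF CU_facts] not_le)
  finally show ?thesis by blast
qed

end

section \<open>The program\<close>

abbreviation exp_add (infixl ".+" 75) where "a .+ b \<equiv> Op Add a b"
abbreviation exp_sub (infixl ".-" 75) where "a .- b \<equiv> Op Sub a b"
abbreviation exp_mul (infixl ".*" 80) where "a .* b \<equiv> Op Mul a b"
abbreviation exp_div (infixl ".'/" 80) where "a ./ b \<equiv> Op Div a b"
abbreviation exp_mod (infixl ".%" 80) where "a .% b \<equiv> Op Mod a b"
abbreviation exp_less (infix ".<" 72) where "a .< b \<equiv> Op Less a b"
abbreviation exp_equal (infix ".=" 72) where "a .= b \<equiv> Op Equal a b"

text \<open>Registers: \<open>0\<close>--\<open>4\<close> the parameters \<open>m\<^sub>0\<close>, \<open>m\<^sub>1\<close>, \<open>k\<close>, \<open>\<sigma>\<close>, \<open>w\<close>; \<open>5\<close> \<open>n\<close>; \<open>6\<close> \<open>n\<^sub>0\<close>; \<open>7\<close> words per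
  bitvector; \<open>8\<close> number of distinct labels; \<open>20\<close>, \<open>21\<close> positions in the two inputs; \<open>22\<close> position
  among the merged nodes; \<open>23\<close> current block; \<open>29\<close> output position; \<open>30\<close>, \<open>31\<close> whether the current
  node has entries left in the two graphs.

  Working arrays: \<open>0\<close>, \<open>1\<close> origins of the nodes in the old and the new merge; \<open>2\<close>, \<open>3\<close> block starts in
  the old and the new merge; \<open>4\<close> number of targets per label; \<open>5\<close> the inner nodes of one level of the
  trie; \<open>6\<close>, \<open>7\<close> its prefixes, finally the labels, in descending order; \<open>8\<close> position of the next target
  per label; \<open>9\<close> last block per label.

  Bit \<open>i\<close> of a bitvector is bit \<open>i mod w\<close> of word \<open>i div w\<close>.\<close>

abbreviation getb :: "nat \<Rightarrow> exp \<Rightarrow> exp" where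
  "getb a e \<equiv> Op Shr (Ld a (e ./ V 4)) (e .% V 4) .% K 2"

definition setb :: "nat \<Rightarrow> exp \<Rightarrow> prog" where
  "setb a e = sto a (e ./ V 4) (Op Or (Ld a (e ./ V 4)) (Op Shl (K 1) (e .% V 4)))"

text \<open>The three arrays of a graph are numbered in the order \<open>W\<close>, W^-,
  \<open>last\<close>.\<close>

definition ia :: "bool \<Rightarrow> nat \<Rightarrow> nat" where
  "ia b x = (if b then 3 + x else x)"

definition mr :: "bool \<Rightarrow> nat" where
  "mr b = (if b then 1 else 0)"

definition pr :: "bool \<Rightarrow> nat" where
  "pr b = (if b then 21 else 20)"

definition count_prog :: "bool \<Rightarrow> prog" where
  "count_prog b =
     9 ::= K 0 ;;
     loop (V 9 .< V (mr b)) (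
       5 ::= V 5 .+ In (ia b 2) (V 9) ;;
       ite (In (ia b 1) (V 9))
         (sto 4 (In (ia b 0) (V 9)) (Ld 4 (In (ia b 0) (V 9)) .+ K 1)) skip ;;
       9 ::= V 9 .+ K 1)"

text \<open>Register 5 accumulates over both passes and is saved to register 6 in between. Rounding
  up subtracts before it divides, since adding \<open>w\<close> to \<open>n\<close> might
  overflow.\<close>

definition count_all :: prog where
  "count_all = count_prog False ;; 6 ::= V 5 ;; count_prog True ;; 7 ::= (V 5 .- K 1) ./ V 4 .+ K 1"

text \<open>As \<open>k\<close> is positive, the sum also covers a position just past the last entry
  and the sentinel \<open>Suc \<sigma>\<close>.\<close>

locale merge_run = two_graphs +
  fixes w :: nat
  assumes word: "length inputs + k + \<sigma> < 2 ^ w"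
begin

definition g :: "bool \<Rightarrow> (nat \<times> bool \<times> bool) list" where
  "g b = graph_entries k (C b)"

definition inp :: "nat list list" where
  "inp = boss_arrays (BOSS k (C False)) @ boss_arrays (BOSS k (C True))"

definition nw :: nat where
  "nw = (num - 1) div w + 1"

text \<open>Four bitvectors, which make up the \<open>4 * n\<close> bits up to rounding, and six
  arrays with cells for \<open>0\<close> and the labels.\<close>

definition xb :: "nat \<Rightarrow> nat" where
  "xb a = (if a < 4 then nw else if a < 10 then \<sigma> + 2 else 0)"

sublocale word_ram w inp xb .

lemma inputs_eq: "inputs = g False @ g True"
  by (simp add: inputs_def g_def)

lemma length_g_le: "length (g b) \<le> length inputs"
  by (cases b) (simp_all add: inputs_eq)

lemma inp_eq: "inp ! ia b 0 = map fst (g b)" "inp ! ia b 1 = map (of_bool \<circ> fst \<circ> snd) (g b)"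
  "inp ! ia b 2 = map (of_bool \<circ> snd \<circ> snd) (g b)"
  using boss_arrays_eq[OF graph_facts fin] by (cases b; simp add: inp_def ia_def g_def nth_append numeral_3_eq_3)+

lemma ia_less: "ia b 0 < length inp" "ia b 1 < length inp" "ia b 2 < length inp"
  by (simp_all add: inp_def boss_arrays_def ia_def)

lemmas inp_simps [simp] = inp_eq inp_eq[unfolded One_nat_def] ia_less ia_less[unfolded One_nat_def]

lemma num_pos: "0 < num"
proof -
  obtain b where "C b \<noteq> {}" using nonempty by auto
  then have "(b, replicate k 0) \<in> set (M 0)" by (simp add: set_M root_node)
  then have "0 < length (M 0)" by (metis length_pos_if_in_set)
  then show ?thesis by simp
qed

lemma num_le: "num \<le> length inputs"
  using num_le_E[of 0] by simp

text \<open>There is at least one entry and \<open>k\<close> is positive, so \<open>2 ^ w\<close>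
  exceeds two. Repeated division by \<open>w\<close> therefore terminates.\<close>

lemma w_ge: "2 \<le> w"
proof (rule ccontr)
  assume "\<not> 2 \<le> w"
  then have "(2 :: nat) ^ w \<le> 2 ^ 1" by (intro power_increasing) auto
  moreover have "1 \<le> length inputs" "1 \<le> k" using num_pos num_le k by auto
  ultimately show False using word by simp
qed

lemma two_less: "2 < (2 :: nat) ^ w"
proof -
  have "(2 :: nat) ^ 2 \<le> 2 ^ w" by (rule power_increasing[OF w_ge]) simp
  then show ?thesis by simp
qed

lemma w_simps [simp]: "0 < w" "w \<noteq> 0" "Suc 0 < w" "2 < (2 :: nat) ^ w" "Suc 0 < 2 ^ w" "w < 2 ^ w"
  using w_ge two_less by auto

lemma small [simp]: "x \<le> length inputs + k + \<sigma> \<Longrightarrow> x < 2 ^ w"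
  using word by simp

text \<open>The set fixes every word completely, including its bits from \<open>w\<close> on and the
  words beyond the array. Thus the empty set literally means a zero array.\<close>

definition bits :: "(nat \<Rightarrow> nat) \<Rightarrow> nat set \<Rightarrow> bool" where
  "bits f S \<longleftrightarrow> (\<forall>p b. bit (f p) b \<longleftrightarrow> b < w \<and> p * w + b \<in> S)"

lemma bits_zero: "bits f {} \<longleftrightarrow> f = (\<lambda>_. 0)"
  by (auto simp: bits_def fun_eq_iff bit_eq_iff)

lemma bits_get:
  assumes "bits f S"
  shows "drop_bit (i mod w) (f (i div w)) mod 2 = of_bool (i \<in> S)"
proof -
  have "bit (f (i div w)) (i mod w) \<longleftrightarrow> i \<in> S"
    using assms w_ge by (simp add: bits_def)
  then show ?thesis by (auto simp: bit_iff_odd_drop_bit mod_2_eq_odd)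
qed

lemma bits_set:
  assumes "bits f S"
  shows "bits (f(i div w := or (f (i div w)) (push_bit (i mod w) 1))) (insert i S)"
proof -
  have "p * w + b = i \<longleftrightarrow> p = i div w \<and> b = i mod w" if "b < w" for p b
    using that by auto
  then show ?thesis
    using assms w_ge by (auto simp: bits_def bit_or_iff bit_push_bit_iff bit_exp_iff bit_1_iff split: if_splits)
qed

lemma wp_setb:
  assumes "ok e R W" and "R 4 = w" and "ev e R W div w < xb a" and "bits (W a) S"
    and "\<And>f. bits f (insert (ev e R W) S) \<Longrightarrow> Q (t + (3 * cost e + 11)) R (W(a := f)) X"
  shows "wp (setb a e) Q t R W X"
  unfolding setb_def
proof (rule wp_sto)
  show "ok (e ./ V 4) R W" using assms(1) by simp
  show "ok (Op Or (Ld a (e ./ V 4)) (Op Shl (K 1) (e .% V 4))) R W"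
    using assms(1-3) by simp
  show "ev (e ./ V 4) R W < xb a" using assms(2,3) by simp
  show "Q (t + (cost (e ./ V 4) + cost (Op Or (Ld a (e ./ V 4)) (Op Shl (K 1) (e .% V 4))) + 1)) R
     (W(a := (W a)(ev (e ./ V 4) R W := ev (Op Or (Ld a (e ./ V 4)) (Op Shl (K 1) (e .% V 4))) R W))) X"
    using assms(5)[OF bits_set[OF assms(4), of "ev e R W"]] assms(2)
    by (simp add: numeral_eq_Suc)
qed

definition params :: "(nat \<Rightarrow> nat) \<Rightarrow> bool" where
  "params R \<longleftrightarrow> R 0 = length (g False) \<and> R 1 = length (g True) \<and> R 2 = k \<and> R 3 = \<sigma> \<and> R 4 = w"

lemma params_mr: "params R \<Longrightarrow> R (mr b) = length (g b)"
  by (cases b) (simp_all add: params_def mr_def)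

lemma params_upd: "4 < r \<Longrightarrow> params (R(r := x)) = params R"
  by (simp add: params_def)

lemma fst_g_le: "q < length (g b) \<Longrightarrow> fst (g b ! q) \<le> \<sigma>"
proof -
  assume "q < length (g b)"
  then have "g b ! q \<in> set (map (\<lambda>y. snd (snd y)) (filter (\<lambda>y. fst y = b) (E 0)))"
    unfolding filter_E g_def[symmetric] by (rule nth_mem)
  then obtain y where "y \<in> set (E 0)" "g b ! q = snd (snd y)" by auto
  with label_le[of y 0] show ?thesis by simp
qed

section \<open>Counting nodes and targets per label\<close>

abbreviation tally :: "(nat \<times> bool \<times> bool) list \<Rightarrow> nat \<Rightarrow> nat" where
  "tally xs c \<equiv> length (filter (\<lambda>x. fst (snd x) \<and> fst x = c) xs)"

text \<open>In these variants the postcondition is the first subgoal and results are named by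
  variables, which keeps terms small along a chain of assignments.\<close>

lemma vc_asg:
  assumes "\<And>x. x = ev e R W \<Longrightarrow> Q (t + (cost e + 1)) (R(r := x)) W X" and "ok e R W" and "r < 40"
  shows "wp (r ::= e) Q t R W X"
  using assms by (intro wp_asg) auto

lemma vc_sto:
  assumes "\<And>i x. i = ev e R W \<Longrightarrow> x = ev f R W \<Longrightarrow>
      Q (t + (cost e + cost f + 1)) R (W(a := (W a)(i := x))) X"
    and "ok e R W" and "ok f R W" and "ev e R W < xb a"
  shows "wp (sto a e f) Q t R W X"
  using assms by (intro wp_sto) auto

lemma vc_outp:
  assumes "\<And>i x. i = ev e R W \<Longrightarrow> x = ev f R W \<Longrightarrow>
      Q (t + (cost e + cost f + 1)) R W (X(a := (X a)(i := Some x)))"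
    and "ok e R W" and "ok f R W"
  shows "wp (outp a e f) Q t R W X"
  using assms by (intro wp_outp) auto

lemma vc_ite:
  assumes "ev e R W \<noteq> 0 \<Longrightarrow> wp P Q (t + (cost e + 1)) R W X"
    and "ev e R W = 0 \<Longrightarrow> wp P' Q (t + (cost e + 1)) R W X"
    and "ok e R W"
  shows "wp (ite e P P') Q t R W X"
  using assms by (intro wp_ite) auto

lemmas vc = wp_seq vc_asg vc_sto vc_outp vc_ite wp_skip

lemma wp_count_loop:
  assumes p: "params R" and R9: "R 9 = 0" and R5: "R 5 + length (g b) \<le> length inputs"
    and W4: "\<And>c. W 4 c + length (g b) \<le> length inputs"
    and Q: "\<And>t'. t' \<le> t + length (g b) * 24 + 4 \<Longrightarrow>
      Q t' (R(9 := length (g b), 5 := R 5 + length (filter (snd \<circ> snd) (g b))))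
        (W(4 := \<lambda>c. W 4 c + tally (g b) c)) X"
  shows "wp (loop (V 9 .< V (mr b)) (
       5 ::= V 5 .+ In (ia b 2) (V 9) ;;
       ite (In (ia b 1) (V 9))
         (sto 4 (In (ia b 0) (V 9)) (Ld 4 (In (ia b 0) (V 9)) .+ K 1)) skip ;;
       9 ::= V 9 .+ K 1)) Q t R W X"
proof (rule wp_for[where N = "length (g b)" and T = 20 and I =
      "\<lambda>q R' W' X'. R' = R(9 := q, 5 := R 5 + length (filter (snd \<circ> snd) (take q (g b)))) \<and>
        W' = W(4 := \<lambda>c. W 4 c + tally (take q (g b)) c) \<and> X' = X"])
  let ?I = "\<lambda>q R' W' X'. R' = R(9 := q, 5 := R 5 + length (filter (snd \<circ> snd) (take q (g b)))) \<and>
    W' = W(4 := \<lambda>c. W 4 c + tally (take q (g b)) c) \<and> X' = X"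
  show "?I 0 R W X" using R9 by (auto simp: fun_eq_iff)
  show "ok (V 9 .< V (mr b)) R' W' \<and> (ev (V 9 .< V (mr b)) R' W' \<noteq> 0) = (q < length (g b))"
    if "?I q R' W' X'" "q \<le> length (g b)" for q R' W' X'
    using that params_mr[OF p, of b] by (auto simp: mr_def)
  show "Q t' R' W' X'" if "?I (length (g b)) R' W' X'"
    "t' \<le> t + (length (g b) * (20 + cost (V 9 .< V (mr b)) + 1) + cost (V 9 .< V (mr b)) + 1)" for t' R' W' X'
    using that Q[of t'] by simp
  fix q t R' W' X' assume I: "?I q R' W' X'" and q: "q < length (g b)"
  have "length (filter (snd \<circ> snd) (take q (g b))) \<le> q"
    by (rule le_trans[OF length_filter_le]) simp
  then have 1: "R 5 + length (filter (snd \<circ> snd) (take q (g b))) + 1 \<le> length inputs" using R5 q by simp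
  have 2: "W 4 c + tally (take q (g b)) c + 1 \<le> length inputs" for c
  proof -
    have "tally (take q (g b)) c \<le> q"
      by (rule le_trans[OF length_filter_le]) simp
    then show ?thesis using W4[of c] q by simp
  qed
  show "wp (5 ::= V 5 .+ In (ia b 2) (V 9) ;;
       ite (In (ia b 1) (V 9))
         (sto 4 (In (ia b 0) (V 9)) (Ld 4 (In (ia b 0) (V 9)) .+ K 1)) skip ;;
       9 ::= V 9 .+ K 1) (\<lambda>t' R' W' X'. ?I (Suc q) R' W' X' \<and> t' \<le> t + 20) t R' W' X'"
    by (intro vc; use I 1 2[of "fst (g b ! q)"] q length_g_le[of b] fst_g_le[OF q] in
      \<open>auto simp: take_Suc_conv_app_nth xb_def fun_eq_iff\<close>)
qed

lemma wp_count:
  assumes p: "params R" and R5: "R 5 + length (g b) \<le> length inputs"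
    and W4: "\<And>c. W 4 c + length (g b) \<le> length inputs"
    and Q: "\<And>t'. t' \<le> t + length (g b) * 24 + 6 \<Longrightarrow>
      Q t' (R(9 := length (g b), 5 := R 5 + length (filter (snd \<circ> snd) (g b))))
        (W(4 := \<lambda>c. W 4 c + tally (g b) c)) X"
  shows "wp (count_prog b) Q t R W X"
  unfolding count_prog_def
proof (rule wp_seq, rule vc_asg, rule wp_count_loop)
  fix x t'
  assume "x = ev (K 0) R W"
    "t' \<le> t + (cost (K 0) + 1) + length (g b) * 24 + 4"
  then show "Q t' ((R(9 := x))(9 := length (g b), 5 := (R(9 := x)) 5 + length (filter (snd \<circ> snd) (g b))))
    (W(4 := \<lambda>c. W 4 c + tally (g b) c)) X"
    using Q[of t'] by simp
qed (use p R5 W4 in \<open>simp_all add: params_upd\<close>)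

lemma length_la_g: "length (filter (snd \<circ> snd) (g False)) + length (filter (snd \<circ> snd) (g True)) = num"
  using count_E[of "snd \<circ> snd" 0] count_la_total[of 0] by (simp add: inputs_eq)

lemma cnt_eq: "cnt c = tally (g False) c + tally (g True) c"
  by (simp add: cnt_def inputs_eq)

definition counted :: "(nat \<Rightarrow> nat) \<Rightarrow> bool" where
  "counted R \<longleftrightarrow> params R \<and> R 5 = num \<and> R 7 = nw"

lemma nw_le: "nw \<le> num"
  using num_pos div_le_dividend[of "num - 1" w] unfolding nw_def by linarith

lemma wp_count_all:
  assumes p: "params R" and R5: "R 5 = 0" and W: "W = (\<lambda>_ _. 0)"
    and Q: "\<And>t' R'. counted R' \<Longrightarrow> R' 6 = length (filter (snd \<circ> snd) (g False)) \<Longrightarrow>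
      t' \<le> t + length inputs * 24 + 30 \<Longrightarrow> Q t' R' (W(4 := cnt)) X"
  shows "wp count_all Q t R W X"
  unfolding count_all_def
proof (rule wp_seq, rule wp_count[OF p], goal_cases)
  case 1
  show ?case using R5 length_g_le by simp
next
  case 2
  show ?case using W length_g_le by simp
next
  case (3 t')
  let ?W = "W(4 := \<lambda>c. W 4 c + tally (g False) c)"
  have le: "length (filter (snd \<circ> snd) (g False)) \<le> length (g False)" by simp
  show ?case
  proof (rule wp_seq, rule vc_asg, rule wp_seq, rule wp_count, goal_cases)
    case 1
    show ?case using p by (simp add: params_upd)
  next
    case 2
    show ?case using R5 le by (simp add: inputs_eq)
  next
    case (3 x c)
    have "tally (g False) c \<le> length (g False)" by simp
    then show ?case using W by (simp add: inputs_eq del: length_filter_le)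
  next
    case (4 x t'')
    have cnt: "W(4 := \<lambda>c. W 4 c + tally (g False) c + tally (g True) c) = W(4 := cnt)"
      using W by (simp add: cnt_eq[abs_def])
    show ?case
    proof (rule vc_asg, goal_cases)
      case (1 y)
      show ?case
        using Q[of "R(9 := length (g False), 5 := length (filter (snd \<circ> snd) (g False)), 6 := x,
            9 := length (g True), 5 := num, 7 := y)"] 1 3 4 p R5 cnt length_la_g
        by (simp add: counted_def params_def nw_def inputs_eq algebra_simps)
    next
      case 2
      show ?case using p R5 num_pos num_le nw_le length_la_g by (simp add: params_def nw_def)
    qed simp
  qed simp_all
qed

end

section \<open>Sorting the labels\<close>

text \<open>Marking the prefixes of one length in a bitvector builds a level of the trie: word
  \<open>p\<close> is the inner node with prefix \<open>p\<close>, and its bits are the children.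
  Register 10 holds the power of \<open>w\<close> that cuts off the remaining digits.\<close>

definition mark_body :: "bool \<Rightarrow> prog" where
  "mark_body b =
     ite (In (ia b 1) (V 9)) (12 ::= In (ia b 0) (V 9) ./ V 10 ;; setb 5 (V 12)) skip ;;
     9 ::= V 9 .+ K 1"

definition mark_prog :: "bool \<Rightarrow> prog" where
  "mark_prog b = 9 ::= K 0 ;; loop (V 9 .< V (mr b)) (mark_body b)"

text \<open>Takes the largest child left in the current inner node and clears its bit. Children thus
  come out in descending order, and array 5 is zero again for the next level.\<close>

definition expand_body :: prog where
  "expand_body =
     15 ::= Ld 6 (V 13) ;;
     16 ::= Ld 5 (V 15) ;;
     ite (V 16)
       (17 ::= MS (V 16) ;;
        sto 5 (V 15) (Op Xor (V 16) (Op Shl (K 1) (V 17))) ;;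
        sto 7 (V 14) (V 15 .* V 4 .+ V 17) ;;
        14 ::= V 14 .+ K 1)
       (13 ::= V 13 .+ K 1)"

definition copy_body :: prog where
  "copy_body = sto 6 (V 9) (Ld 7 (V 9)) ;; 9 ::= V 9 .+ K 1"

definition expand_prog :: prog where
  "expand_prog =
     13 ::= K 0 ;;
     14 ::= K 0 ;;
     loop (V 13 .< V 8) expand_body ;;
     8 ::= V 14 ;;
     9 ::= K 0 ;;
     loop (V 9 .< V 8) copy_body"

text \<open>The quotient of \<open>\<sigma>\<close> decides when to stop, so the power never exceeds
  \<open>\<sigma>\<close> and cannot overflow.\<close>

definition power_body :: prog where
  "power_body = 11 ::= V 11 ./ V 4 ;; 10 ::= V 10 .* V 4"

definition level_body :: prog where
  "level_body = mark_prog False ;; mark_prog True ;; expand_prog ;; 10 ::= V 10 ./ V 4"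

text \<open>The root of the trie is the prefix 0, already present in array 6 because memory is
  initially zero. On the last level the power is 1, and dividing it by \<open>w\<close> gives the 0
  that ends the loop.\<close>

definition sort_prog :: prog where
  "sort_prog =
     10 ::= K 1 ;;
     11 ::= V 3 ;;
     loop ((V 11 .< V 4) .= K 0) power_body ;;
     8 ::= K 1 ;;
     loop (V 10) level_body"

lemma floor_log_bit:
  assumes "0 < x"
  shows "bit x (floor_log x)" and "bit x j \<Longrightarrow> j \<le> floor_log x"
proof -
  have 1: "2 ^ floor_log x \<le> x" "x < 2 * 2 ^ floor_log x"
    using floor_log_exp2_le[OF assms] floor_log_exp2_gt by auto
  then have "x div 2 ^ floor_log x = 1"
    by (intro div_nat_eqI) auto
  then show "bit x (floor_log x)" by (simp add: bit_iff_odd)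
  assume "bit x j"
  then have "odd (x div 2 ^ j)" by (simp add: bit_iff_odd)
  then have "x div 2 ^ j \<noteq> 0" by (metis even_zero)
  then have "2 ^ j \<le> x" by (simp add: div_eq_0_iff)
  with 1(2) have "(2 :: nat) ^ j < 2 ^ Suc (floor_log x)" by simp
  then have "j < Suc (floor_log x)" by (rule power_less_imp_less_exp[rotated]) simp
  then show "j \<le> floor_log x" by simp
qed

definition down :: "nat set \<Rightarrow> nat list" where
  "down S = rev (sorted_list_of_set S)"

lemma down_simps:
  assumes "finite S"
  shows "set (down S) = S" "distinct (down S)" "length (down S) = card S"
  using assms by (simp_all add: down_def)

lemma down_nth: "finite S \<Longrightarrow> i < j \<Longrightarrow> j < card S \<Longrightarrow> down S ! j < down S ! i"
  by (simp add: down_def rev_nth sorted_wrt_nth_less[OF strict_sorted_list_of_set])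

lemma down_next:
  assumes "finite S" and y: "y \<in> S - set (take e (down S))"
    and max: "\<And>z. z \<in> S - set (take e (down S)) \<Longrightarrow> z \<le> y"
  shows "e < card S" and "down S ! e = y"
proof -
  obtain j where j: "j < card S" "down S ! j = y"
    using y assms(1) by (metis DiffD1 down_simps(1,3) in_set_conv_nth)
  have "e \<le> j"
  proof (rule ccontr)
    assume "\<not> e \<le> j"
    then have "y \<in> set (take e (down S))"
      using j assms(1) by (auto simp: in_set_conv_nth down_simps intro!: exI[of _ j])
    with y show False by simp
  qed
  then show e: "e < card S" using j by simp
  have "down S ! e \<in> S - set (take e (down S))"
  proof
    show "down S ! e \<in> S" using e assms(1) by (metis down_simps(1,3) nth_mem)
    show "down S ! e \<notin> set (take e (down S))"
    proof
      assume "down S ! e \<in> set (take e (down S))"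
      then obtain i where "i < e" "down S ! i = down S ! e" by (auto simp: in_set_conv_nth)
      with down_nth[OF assms(1) this(1) e] show False by simp
    qed
  qed
  from max[OF this] have "down S ! e \<le> down S ! j" using j by simp
  with down_nth[OF assms(1), of e j] \<open>e \<le> j\<close> j show "down S ! e = y"
    by (cases "e = j") auto
qed

section \<open>Prefixes of the labels in base w\<close>

context merge_run
begin

text \<open>Only edges with W^- = 1 place a target in a round, so it is their labels that need
  counters.\<close>

definition minus_labels :: "(nat \<times> bool \<times> bool) list \<Rightarrow> nat set" where
  "minus_labels xs = fst ` set (filter (\<lambda>x. fst (snd x)) xs)"

definition labels :: "nat set" where
  "labels = minus_labels inputs"

text \<open>The labels without their last \<open>j\<close> digits in base \<open>w\<close>, that is,
  one level of the trie.\<close>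

definition digits :: "nat \<Rightarrow> nat set" where
  "digits j = (\<lambda>x. x div w ^ j) ` labels"

lemmas labels_eq = labels_def[unfolded minus_labels_def]

lemma finite_labels: "finite labels"
  by (simp add: labels_eq)

lemma card_labels: "card labels \<le> length inputs"
  unfolding labels_eq using le_trans[OF card_image_le[OF finite_set] le_trans[OF card_length length_filter_le]] .

lemma labels_iff: "c \<in> labels \<longleftrightarrow> (\<exists>y\<in>set (E h). mi y \<and> lab y = c)"
proof -
  have "set inputs = (\<lambda>y. snd (snd y)) ` set (E h)"
    using arg_cong[OF mset_E[of h], of set_mset] by (simp add: inputs_def)
  then have "labels = fst ` ((\<lambda>y. snd (snd y)) ` {y \<in> set (E h). mi y})"
    unfolding labels_eq set_filter by (simp only: Compr_image_eq)
  then have l: "labels = lab ` {y \<in> set (E h). mi y}" by (simp only: image_image)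
  show ?thesis
  proof
    assume "c \<in> labels"
    then obtain y where "c = lab y" "y \<in> {y \<in> set (E h). mi y}" unfolding l by (rule imageE)
    then show "\<exists>y\<in>set (E h). mi y \<and> lab y = c" by (intro bexI[of _ y]) simp_all
  next
    assume "\<exists>y\<in>set (E h). mi y \<and> lab y = c"
    then obtain y where "y \<in> set (E h)" "mi y" "c = lab y" by (elim bexE conjE) simp
    then show "c \<in> labels" unfolding l by (intro image_eqI[of _ _ y]) simp_all
  qed
qed

lemma labels_le: "c \<in> labels \<Longrightarrow> 1 \<le> c \<and> c \<le> \<sigma>"
proof -
  assume "c \<in> labels"
  then obtain y where y: "y \<in> set (E 0)" "mi y" "lab y = c" unfolding labels_iff[of _ 0] by blast
  from minus_label[OF y(1,2)] y(3) show ?thesis by simp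
qed

lemma finite_digits: "finite (digits j)"
  by (simp add: digits_def finite_labels)

lemma card_digits: "card (digits j) \<le> length inputs"
  unfolding digits_def using le_trans[OF card_image_le[OF finite_labels] card_labels] .

lemma digits_le: "y \<in> digits j \<Longrightarrow> y \<le> \<sigma>"
  using labels_le unfolding digits_def by (auto intro: le_trans[OF div_le_dividend])

lemma digits_Suc: "y \<in> digits j \<Longrightarrow> y div w \<in> digits (Suc j)"
  by (auto simp: digits_def div_mult2_eq[symmetric] mult.commute)

lemma digits_card_le: "S \<subseteq> digits j \<Longrightarrow> card S \<le> Suc \<sigma>"
proof -
  assume "S \<subseteq> digits j"
  then have "S \<subseteq> {..\<sigma>}" using digits_le by auto
  from card_mono[OF _ this] show ?thesis by simp
qed

lemma wp_mark:
  assumes p: "params R" and pw: "0 < R 10" and bits: "bits (W 5) A"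
    and Q: "\<And>t' f z. t' \<le> t + length (g b) * 40 + 6 \<Longrightarrow>
      bits f (A \<union> (\<lambda>x. x div R 10) ` minus_labels (g b)) \<Longrightarrow>
      Q t' (R(9 := length (g b), 12 := z)) (W(5 := f)) X"
  shows "wp (mark_prog b) Q t R W X"
  unfolding mark_prog_def
proof (rule wp_seq, rule vc_asg)
  fix x0 assume x0: "x0 = ev (K 0) R W"
  let ?S = "\<lambda>q. A \<union> (\<lambda>x. x div R 10) ` minus_labels (take q (g b))"
  show "wp (loop (V 9 .< V (mr b)) (mark_body b)) Q (t + (cost (K 0) + 1)) (R(9 := x0)) W X"
  proof (rule wp_for[where N = "length (g b)" and T = 34 and I =
      "\<lambda>q R' W' X'. \<exists>z f. R' = R(9 := q, 12 := z) \<and> W' = W(5 := f) \<and> bits f (?S q) \<and> X' = X"])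
    let ?I = "\<lambda>q R' W' X'. \<exists>z f. R' = R(9 := q, 12 := z) \<and> W' = W(5 := f) \<and> bits f (?S q) \<and> X' = X"
    show "?I 0 (R(9 := x0)) W X"
      using bits x0 by (intro exI[of _ "R 12"] exI[of _ "W 5"]) (auto simp: fun_eq_iff minus_labels_def)
    show "ok (V 9 .< V (mr b)) R' W' \<and> (ev (V 9 .< V (mr b)) R' W' \<noteq> 0) = (q < length (g b))"
      if "?I q R' W' X'" "q \<le> length (g b)" for q R' W' X'
      using that params_mr[OF p, of b] by (auto simp: mr_def)
    show "Q t' R' W' X'" if "?I (length (g b)) R' W' X'"
      "t' \<le> t + (cost (K 0) + 1) + (length (g b) * (34 + cost (V 9 .< V (mr b)) + 1) + cost (V 9 .< V (mr b)) + 1)"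
      for t' R' W' X'
      using that Q[of t'] by auto
    fix q t R' W' X' assume I: "?I q R' W' X'" and q: "q < length (g b)"
    then obtain z f where R': "R' = R(9 := q, 12 := z)" and W': "W' = W(5 := f)" and f: "bits f (?S q)"
      and X': "X' = X" by blast
    have R4: "R 4 = w" using p by (simp add: params_def)
    have x: "fst (g b ! q) div R 10 div w \<le> \<sigma>"
      using fst_g_le[OF q] by (meson div_le_dividend le_trans)
    have S: "?S (Suc q) = (if fst (snd (g b ! q)) then insert (fst (g b ! q) div R 10) (?S q) else ?S q)"
      using q by (simp add: take_Suc_conv_app_nth minus_labels_def)
    have lt: "q < length inputs" using q length_g_le[of b] by simp
    show "wp (mark_body b) (\<lambda>t' R' W' X'. ?I (Suc q) R' W' X' \<and> t' \<le> t + 34) t R' W' X'"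
      unfolding mark_body_def
    proof (rule wp_seq, rule vc_ite, goal_cases)
      case 1
      then have m: "fst (snd (g b ! q))" using q by (auto simp: R' W')
      show ?case
      proof (rule wp_seq, rule vc_asg, rule wp_setb[where S = "?S q"], goal_cases)
        case (5 x f')
        have eq: "x = fst (g b ! q) div R 10" using 5(1) q by (simp add: R')
        show ?case
          by (rule vc_asg)
            (use 5(2) S m lt q in \<open>auto simp: R' W' X' eq fun_eq_iff intro!: exI[of _ "fst (g b ! q) div R 10"] exI[of _ f']\<close>)
      qed (use q R4 x f in \<open>simp_all add: R' W' xb_def\<close>)
    next
      case 2
      then have m: "\<not> fst (snd (g b ! q))" using q by (auto simp: R' W')
      show ?case
        by (intro vc) (use S m lt q f in \<open>auto simp: R' W' X' fun_eq_iff intro!: exI[of _ z] exI[of _ f]\<close>)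
    qed (use q in \<open>simp add: R'\<close>)
  qed
qed simp_all

text \<open>Every iteration emits a child or leaves an exhausted parent. The ghost counter is
  \<open>r + e\<close>, and the time is linear in the numbers of parents and children, independently
  of the \<open>w\<close> bits per word.\<close>

lemma wp_expand_loop:
  assumes p: "params R" and S: "finite S" "\<And>y. y \<in> S \<Longrightarrow> y \<le> \<sigma>" "card S \<le> length inputs" "card S \<le> Suc \<sigma>"
    and xs: "\<And>i j. i < j \<Longrightarrow> j < length xs \<Longrightarrow> xs ! j < xs ! i" "\<And>x. x \<in> set xs \<Longrightarrow> x \<le> \<sigma>"
      "length xs \<le> Suc (length inputs)" "length xs \<le> Suc \<sigma>"
    and W6: "\<And>i. i < length xs \<Longrightarrow> W 6 i = xs ! i"
    and R: "R 8 = length xs" "R 13 = 0" "R 14 = 0"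
    and div: "\<And>y. y \<in> S \<Longrightarrow> y div w \<in> set xs" and bits: "bits (W 5) S"
    and Q: "\<And>t' R' f. t' \<le> t + (length xs + card S) * 50 + 4 \<Longrightarrow>
      \<forall>x. x \<notin> {13, 14, 15, 16, 17} \<longrightarrow> R' x = R x \<Longrightarrow> R' 14 = card S \<Longrightarrow>
      \<forall>i<card S. f i = down S ! i \<Longrightarrow> Q t' R' (W(5 := \<lambda>_. 0, 7 := f)) X"
  shows "wp (loop (V 13 .< V 8) expand_body) Q t R W X"
proof (rule wp_for[where N = "length xs + card S" and T = 40 and I =
      "\<lambda>q R' W' X'. \<exists>r e T f. q = r + e \<and> r \<le> length xs \<and> e \<le> card S \<and>
        (\<forall>x. x \<notin> {13, 14, 15, 16, 17} \<longrightarrow> R' x = R x) \<and> R' 13 = r \<and> R' 14 = e \<and>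
        W' = W(5 := T, 7 := f) \<and> X' = X \<and> bits T (S - set (take e (down S))) \<and>
        (\<forall>i<e. f i = down S ! i) \<and> (\<forall>y\<in>S - set (take e (down S)). y div w \<notin> set (take r xs))"])
  let ?I = "\<lambda>q R' W' X'. \<exists>r e T f. q = r + e \<and> r \<le> length xs \<and> e \<le> card S \<and>
        (\<forall>x. x \<notin> {13, 14, 15, 16, 17} \<longrightarrow> R' x = R x) \<and> R' 13 = r \<and> R' 14 = e \<and>
        W' = W(5 := T, 7 := f) \<and> X' = X \<and> bits T (S - set (take e (down S))) \<and>
        (\<forall>i<e. f i = down S ! i) \<and> (\<forall>y\<in>S - set (take e (down S)). y div w \<notin> set (take r xs))"
  show "?I 0 R W X"
    by (rule exI[of _ 0], rule exI[of _ 0], rule exI[of _ "W 5"], rule exI[of _ "W 7"])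
      (use R bits in \<open>auto simp: fun_eq_iff\<close>)
  \<comment> \<open>Every element of \<open>S\<close> has its parent in \<open>xs\<close>, so
    nothing is left once all parents are exhausted.\<close>
  have full: "e = card S \<and> S - set (take e (down S)) = {}"
    if "e \<le> card S" "\<forall>y\<in>S - set (take e (down S)). y div w \<notin> set xs" for e
  proof -
    have "S - set (take e (down S)) = {}" using that(2) div by auto
    moreover from this have "card S \<le> card (set (take e (down S)))"
      by (intro card_mono) auto
    then have "card S \<le> e" using card_length[of "take e (down S)"] by simp
    ultimately show ?thesis using that(1) by simp
  qed
  show "ok (V 13 .< V 8) R' W' \<and> (ev (V 13 .< V 8) R' W' \<noteq> 0) = (q < length xs + card S)"
    if I: "?I q R' W' X'" for q R' W' X'
  proof -
    from I obtain r e where *: "q = r + e" "r \<le> length xs" "e \<le> card S" "R' 8 = R 8" "R' 13 = r"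
      "\<forall>y\<in>S - set (take e (down S)). y div w \<notin> set (take r xs)" by auto
    have "r < length xs \<longleftrightarrow> q < length xs + card S"
    proof (cases "r = length xs")
      case True
      with * full[of e] show ?thesis by simp
    qed (use * in auto)
    then show ?thesis using * R by simp
  qed
  show "Q t' R' W' X'" if I: "?I (length xs + card S) R' W' X'"
    and t': "t' \<le> t + ((length xs + card S) * (40 + cost (V 13 .< V 8) + 1) + cost (V 13 .< V 8) + 1)" for t' R' W' X'
  proof -
    from I obtain r e T f where *: "length xs + card S = r + e" "r \<le> length xs" "e \<le> card S"
      "\<forall>x. x \<notin> {13, 14, 15, 16, 17} \<longrightarrow> R' x = R x" "R' 14 = e" "W' = W(5 := T, 7 := f)" "X' = X"
      "bits T (S - set (take e (down S)))" "\<forall>i<e. f i = down S ! i"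
      "\<forall>y\<in>S - set (take e (down S)). y div w \<notin> set (take r xs)" by blast
    then have "r = length xs" by simp
    then have "e = card S \<and> S - set (take e (down S)) = {}"
      by (intro full) (use *(3,10) in simp_all)
    with *(8) have e: "e = card S" "bits T {}" by metis+
    then have "T = (\<lambda>_. 0)" by (simp add: bits_zero)
    with * e t' show ?thesis using Q[of t' R' f] by simp
  qed
  fix q t R' W' X' assume I: "?I q R' W' X'" and q: "q < length xs + card S"
  then obtain r e T f where q_eq: "q = r + e" and r: "r \<le> length xs" and e: "e \<le> card S"
    and R': "\<forall>x. x \<notin> {13, 14, 15, 16, 17} \<longrightarrow> R' x = R x" "R' 13 = r" "R' 14 = e"
    and W': "W' = W(5 := T, 7 := f)" and X': "X' = X" and T: "bits T (S - set (take e (down S)))"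
    and f: "\<forall>i<e. f i = down S ! i" and late: "\<forall>y\<in>S - set (take e (down S)). y div w \<notin> set (take r xs)"
    by blast
  have r_less: "r < length xs"
  proof (rule ccontr)
    assume "\<not> r < length xs"
    with r late full[of e] e have "r = length xs" "e = card S" by auto
    with q q_eq show False by simp
  qed
  have R4: "R 4 = w" using p by (simp add: params_def)
  have xr: "xs ! r \<le> \<sigma>" using r_less xs(2) by simp
  show "wp expand_body (\<lambda>t' R' W' X'. ?I (Suc q) R' W' X' \<and> t' \<le> t + 40) t R' W' X'"
    unfolding expand_body_def
  proof (rule wp_seq, rule vc_asg, rule wp_seq, rule vc_asg, rule vc_ite, goal_cases)
    case (1 p tw)
    have ptw: "p = xs ! r" "tw = T (xs ! r)" using 1 R' W' W6[OF r_less] by auto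
    have pos: "0 < T (xs ! r)" using 1(3) ptw by simp
    define b where "b = floor_log (T (xs ! r))"
    define y where "y = xs ! r * w + b"
    have b: "b < w" "y \<in> S - set (take e (down S))"
      using T floor_log_bit(1)[OF pos] unfolding bits_def b_def y_def by auto
    \<comment> \<open>Remaining elements have parents at or after index \<open>r\<close>, hence not
      above the current one; under the current parent the highest set bit is the largest
      child.\<close>
    have max: "z \<le> y" if z: "z \<in> S - set (take e (down S))" for z
    proof -
      have "z div w \<in> set xs" "z div w \<notin> set (take r xs)" using z div late by auto
      then obtain j where j: "j < length xs" "z div w = xs ! j" "r \<le> j"
      proof -
        obtain j where "j < length xs" "xs ! j = z div w"
          using \<open>z div w \<in> set xs\<close> by (auto simp: in_set_conv_nth)
        moreover from this have "r \<le> j"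
          using \<open>z div w \<notin> set (take r xs)\<close> nth_mem[of j "take r xs"] by (cases "r \<le> j") auto
        ultimately show ?thesis using that by metis
      qed
      then have "z div w \<le> xs ! r" using xs(1)[of r j] by (cases "r = j") auto
      show ?thesis
      proof (cases "z div w = xs ! r")
        case True
        then have "bit (T (xs ! r)) (z mod w)"
          using T z by (metis (no_types, lifting) bits_def div_mult_mod_eq mod_less_divisor w_simps(1))
        from floor_log_bit(2)[OF pos this] have "z mod w \<le> b" by (simp add: b_def)
        then show ?thesis using True unfolding y_def by (metis add_left_mono div_mult_mod_eq)
      next
        case False
        with \<open>z div w \<le> xs ! r\<close> have "z div w < xs ! r" by simp
        then have "z < xs ! r * w" using div_less_iff_less_mult[of w z "xs ! r"] by simp
        then show ?thesis by (simp add: y_def)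
      qed
    qed
    note nx = down_next[OF S(1) b(2) max]
    have y_le: "y \<le> \<sigma>" using b S(2) by simp
    then have y_less: "xs ! r * w + b < 2 ^ w" "xs ! r * w < 2 ^ w" by (simp_all add: y_def)
    have e_less: "Suc e < 2 ^ w" using nx S(3) k by simp
    have bits': "bits (T(xs ! r := xor (T (xs ! r)) (2 ^ b))) (S - set (take (Suc e) (down S)))"
    proof -
      have tk: "set (take (Suc e) (down S)) = insert y (set (take e (down S)))"
        using nx by (simp add: take_Suc_conv_app_nth down_simps[OF S(1)])
      have "p * w + b' = y \<longleftrightarrow> p = xs ! r \<and> b' = b" if "b' < w" for p b'
        unfolding y_def using that b(1)
        by (metis add.commute div_mult_self3 div_less mod_less mod_mult_self3 add_0 mult.commute w_simps(2))
      then show ?thesis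
        using T b unfolding bits_def tk
        by (auto simp: bit_xor_iff bit_exp_iff y_def[symmetric])
    qed
    show ?case
    proof (intro vc, goal_cases)
      case (1 b' i v i' v' e')
      have eqs: "b' = b" "i = xs ! r" "v = xor (T (xs ! r)) (2 ^ b)" "i' = e" "v' = y" "e' = Suc e"
        using 1 R' ptw R4 by (auto simp: b_def y_def)
      show ?case
        apply (rule conjI, rule exI[of _ r], rule exI[of _ "Suc e"],
            rule exI[of _ "T(xs ! r := xor (T (xs ! r)) (2 ^ b))"], rule exI[of _ "f(e := y)"])
        using eqs r nx q_eq R' bits' f late by (auto simp: W' X' fun_eq_iff less_Suc_eq take_Suc_conv_app_nth down_simps[OF S(1)])
    qed (use r_less xr R' R4 b(1) y_less e_less nx(1) S(4) ptw in \<open>auto simp: xb_def y_def b_def\<close>)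
  next
    case (2 p tw)
    have ptw: "p = xs ! r" "tw = T (xs ! r)" using 2 R' W' W6[OF r_less] by auto
    have z: "T (xs ! r) = 0" using 2(3) ptw by simp
    have "y div w \<noteq> xs ! r" if "y \<in> S - set (take e (down S))" for y
    proof
      assume "y div w = xs ! r"
      then have "bit (T (xs ! r)) (y mod w)"
        using T that by (metis (no_types, lifting) bits_def div_mult_mod_eq mod_less_divisor w_simps(1))
      with z show False by simp
    qed
    with late have late': "\<forall>y\<in>S - set (take e (down S)). y div w \<notin> set (take (Suc r) xs)"
      using r_less by (auto simp: take_Suc_conv_app_nth)
    show ?case
    proof (rule vc_asg, goal_cases)
      case (1 r')
      have eqs: "r' = Suc r" using 1 R' by simp
      show ?case
        apply (rule conjI, rule exI[of _ "Suc r"], rule exI[of _ e], rule exI[of _ T], rule exI[of _ f])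
        using eqs r_less e q_eq R' T f late' by (auto simp: W' X')
    next
      case 2
      show ?case using r_less xs(3) R' k small[of "Suc r"] by auto
    qed simp
  qed (use r_less xr R' xs(4) W6[OF r_less] in \<open>auto simp: xb_def W'\<close>)
qed

lemma wp_copy_loop:
  assumes R: "R 9 = 0" "R 8 \<le> Suc \<sigma>" "R 8 \<le> length inputs"
    and Q: "\<And>t' f. t' \<le> t + R 8 * 14 + 4 \<Longrightarrow> \<forall>i<R 8. f i = W 7 i \<Longrightarrow>
      Q t' (R(9 := R 8)) (W(6 := f)) X"
  shows "wp (loop (V 9 .< V 8) copy_body) Q t R W X"
proof (rule wp_for[where N = "R 8" and T = 10 and I =
      "\<lambda>q R' W' X'. \<exists>f. R' = R(9 := q) \<and> W' = W(6 := f) \<and> (\<forall>i<q. f i = W 7 i) \<and> X' = X"])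
  let ?I = "\<lambda>q R' W' X'. \<exists>f. R' = R(9 := q) \<and> W' = W(6 := f) \<and> (\<forall>i<q. f i = W 7 i) \<and> X' = X"
  show "?I 0 R W X" using R(1) by (intro exI[of _ "W 6"]) (auto simp: fun_eq_iff)
  show "ok (V 9 .< V 8) R' W' \<and> (ev (V 9 .< V 8) R' W' \<noteq> 0) = (q < R 8)"
    if "?I q R' W' X'" "q \<le> R 8" for q R' W' X' using that by auto
  show "Q t' R' W' X'" if "?I (R 8) R' W' X'"
    "t' \<le> t + (R 8 * (10 + cost (V 9 .< V 8) + 1) + cost (V 9 .< V 8) + 1)" for t' R' W' X'
    using that Q[of t'] by auto
  fix q t R' W' X' assume I: "?I q R' W' X'" and q: "q < R 8"
  then obtain f where I': "R' = R(9 := q)" "W' = W(6 := f)" "\<forall>i<q. f i = W 7 i" "X' = X" by blast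
  have "Suc q < 2 ^ w" using q R by simp
  then show "wp copy_body (\<lambda>t' R' W' X'. ?I (Suc q) R' W' X' \<and> t' \<le> t + 10) t R' W' X'"
    unfolding copy_body_def
    by (intro vc) (use I' q R in \<open>auto simp: xb_def less_Suc_eq intro!: exI[of _ "f(q := W 7 q)"]\<close>)
qed

lemma wp_expand:
  assumes p: "params R" and S: "finite S" "\<And>y. y \<in> S \<Longrightarrow> y \<le> \<sigma>" "card S \<le> length inputs" "card S \<le> Suc \<sigma>"
    and xs: "\<And>i j. i < j \<Longrightarrow> j < length xs \<Longrightarrow> xs ! j < xs ! i" "\<And>x. x \<in> set xs \<Longrightarrow> x \<le> \<sigma>"
      "length xs \<le> Suc (length inputs)" "length xs \<le> Suc \<sigma>"
    and W6: "\<And>i. i < length xs \<Longrightarrow> W 6 i = xs ! i" and R8: "R 8 = length xs"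
    and div: "\<And>y. y \<in> S \<Longrightarrow> y div w \<in> set xs" and bits: "bits (W 5) S"
    and Q: "\<And>t' R' W'. t' \<le> t + (length xs + card S) * 50 + card S * 14 + 20 \<Longrightarrow>
      \<forall>x. x \<notin> {8, 9, 13, 14, 15, 16, 17} \<longrightarrow> R' x = R x \<Longrightarrow> R' 8 = card S \<Longrightarrow>
      \<forall>a. a \<notin> {5, 6, 7} \<longrightarrow> W' a = W a \<Longrightarrow> W' 5 = (\<lambda>_. 0) \<Longrightarrow>
      \<forall>i<card S. W' 6 i = down S ! i \<Longrightarrow> Q t' R' W' X"
  shows "wp expand_prog Q t R W X"
  unfolding expand_prog_def
proof (rule wp_seq, rule vc_asg, rule wp_seq, rule vc_asg, rule wp_seq,
    rule wp_expand_loop[where S = S and xs = xs], goal_cases)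
  case (16 x13 x14 t' R' f)
  show ?case
  proof (rule wp_seq, rule vc_asg, rule wp_seq, rule vc_asg, rule wp_copy_loop, goal_cases)
    case (4 x8 x9 t'' f')
    show ?case
      by (rule Q) (use 4 16 in \<open>auto\<close>)
  qed (use 16 S in auto)
qed (use p S xs W6 R8 div bits in \<open>auto simp: params_def\<close>)

lemma digits_split: "digits j = (\<lambda>x. x div w ^ j) ` minus_labels (g False) \<union> (\<lambda>x. x div w ^ j) ` minus_labels (g True)"
  by (simp add: digits_def labels_def minus_labels_def inputs_eq image_Un)

text \<open>The list before step \<open>q\<close>: the root alone, then prefixes with ever fewer
  digits cut off, and the labels themselves at \<open>q = Suc L\<close>.\<close>

definition level :: "nat \<Rightarrow> nat \<Rightarrow> nat list" where
  "level L q = (if q = 0 then [0] else down (digits (Suc L - q)))"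

definition keeps :: "(nat \<Rightarrow> nat) \<Rightarrow> mem \<Rightarrow> (nat \<Rightarrow> nat) \<Rightarrow> mem \<Rightarrow> bool" where
  "keeps R W R' W' \<longleftrightarrow> (\<forall>x<8. R' x = R x) \<and> (\<forall>a. a \<notin> {5, 6, 7} \<longrightarrow> W' a = W a)"

lemma params_keeps: "params R \<Longrightarrow> \<forall>x<8. R' x = R x \<Longrightarrow> params R'"
  by (simp add: params_def)

lemma wp_level_body:
  assumes p: "params R" and L: "w ^ L \<le> \<sigma>" "\<sigma> < w ^ Suc L" and q: "q \<le> L" and R10: "R 10 = w ^ (L - q)"
    and R8: "R 8 = length (level L q)" and W6: "\<And>i. i < length (level L q) \<Longrightarrow> W 6 i = level L q ! i"
    and W5: "W 5 = (\<lambda>_. 0)"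
    and Q: "\<And>t' R' W'. t' \<le> t + length inputs * 300 \<Longrightarrow> keeps R W R' W' \<Longrightarrow>
      R' 10 = (if q = L then 0 else w ^ (L - Suc q)) \<Longrightarrow> R' 8 = length (level L (Suc q)) \<Longrightarrow>
      \<forall>i<length (level L (Suc q)). W' 6 i = level L (Suc q) ! i \<Longrightarrow> W' 5 = (\<lambda>_. 0) \<Longrightarrow> Q t' R' W' X"
  shows "wp level_body Q t R W X"
  unfolding level_body_def
proof (rule wp_seq, rule wp_mark[where A = "{}"], goal_cases)
  case (4 t' f z)
  note 2 = 4
  let ?R = "R(9 := length (g False), 12 := z)"
  show ?case
  proof (rule wp_seq, rule wp_mark[where A = "{} \<union> (\<lambda>x. x div R 10) ` minus_labels (g False)"], goal_cases)
    case (4 t'' f' z')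
    let ?S = "digits (L - q)"
    have S: "bits f' ?S" using 4(2) R10 by (simp add: digits_split)
    have len: "length (level L q) \<le> Suc (length inputs)" "length (level L q) \<le> Suc \<sigma>"
      using card_digits[of "Suc L - q"] digits_card_le[OF order_refl, of "Suc L - q"]
      by (auto simp: level_def down_simps finite_digits)
    \<comment> \<open>There is at least one entry, so additive costs fit into a multiple of the
      length.\<close>
    have bound: "length inputs * 300 \<ge> length inputs * 100 + length (g False) * 40 + length (g True) * 40 + length inputs * 14 + 100"
      using num_pos num_le by (simp add: inputs_eq)
    show ?case
    proof (rule wp_seq, rule wp_expand[where S = ?S and xs = "level L q"], goal_cases)
      case 1
      show ?case using p by (simp add: params_def)
    next
      case (6 i j)
      then show ?case by (auto simp: level_def down_nth finite_digits down_simps split: if_splits)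
    next
      case (7 x)
      then show ?case using digits_le by (auto simp: level_def finite_digits down_simps split: if_splits)
    next
      case (12 y)
      show ?case
      proof (cases "q = 0")
        case True
        \<comment> \<open>All labels lie below \<open>w ^ Suc L\<close>, so cutting off
          \<open>Suc L\<close> digits leaves the root prefix 0.\<close>
        with 12 have "y div w \<in> digits (Suc L)" using digits_Suc by simp
        then obtain x where "x \<in> labels" "y div w = x div w ^ Suc L" by (auto simp: digits_def)
        with L labels_le[of x] have "y div w = 0" by simp
        with True show ?thesis by (simp add: level_def)
      next
        case False
        have "Suc (L - q) = Suc L - q" using q by simp
        with digits_Suc[OF 12] False show ?thesis
          by (simp add: level_def finite_digits down_simps)
      qed
    next
      case (14 t3 R' W')
      have R': "R' x = R x" if "x \<notin> {8, 9, 12, 13, 14, 15, 16, 17}" for x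
        using 14(2) that by auto
      have l: "level L (Suc q) = down ?S" by (simp add: level_def)
      show ?case
      proof (rule vc_asg, goal_cases)
        case (1 y)
        have "y = (if q = L then 0 else w ^ (L - Suc q))"
        proof (cases "q = L")
          case True
          then show ?thesis using 1 R'[of 10] R'[of 4] R10 p w_ge by (simp add: params_def)
        next
          case False
          then have "L - q = Suc (L - Suc q)" using q by simp
          then show ?thesis using 1 False R'[of 10] R'[of 4] R10 p by (simp add: params_def)
        qed
        moreover have "card ?S \<le> length inputs" by (rule card_digits)
        ultimately show ?case
          using 1 14 4 2(1) len bound R'
          by (intro Q) (auto simp: keeps_def l down_simps finite_digits)
      qed simp_all
    qed (use S R8 W6 len card_digits digits_card_le[OF order_refl] finite_digits digits_le in auto)
  qed (use 2 p R10 in \<open>auto simp: params_def\<close>)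
qed (use p R10 W5 in \<open>simp_all add: bits_zero\<close>)

text \<open>Each of the \<open>Suc L\<close> levels takes time linear in the number of entries, as
  only cells of occurring prefixes are visited.\<close>

lemma wp_sort:
  assumes p: "params R" and L: "w ^ L \<le> \<sigma>" "\<sigma> < w ^ Suc L"
    and W: "W 5 = (\<lambda>_. 0)" "W 6 = (\<lambda>_. 0)"
    and Q: "\<And>t' R' W'. t' \<le> t + Suc L * (length inputs * 400) + 40 \<Longrightarrow> keeps R W R' W' \<Longrightarrow>
      R' 8 = card labels \<Longrightarrow> \<forall>i<card labels. W' 6 i = down labels ! i \<Longrightarrow> Q t' R' W' X"
  shows "wp sort_prog Q t R W X"
  unfolding sort_prog_def
proof (rule wp_seq, rule vc_asg, rule wp_seq, rule vc_asg, rule wp_seq, goal_cases)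
  case (1 x10 x11)
  have R: "R 3 = \<sigma>" "R 4 = w" using p by (simp_all add: params_def)
  let ?J = "\<lambda>q R' W' X'. R' = R(10 := w ^ q, 11 := \<sigma> div w ^ q) \<and> W' = W \<and> X' = X"
  let ?I = "\<lambda>q R' W' X'. keeps R W R' W' \<and> R' 10 = (if q = Suc L then 0 else w ^ (L - q)) \<and>
    R' 8 = length (level L q) \<and> (\<forall>i<length (level L q). W' 6 i = level L q ! i) \<and>
    W' 5 = (\<lambda>_. 0) \<and> X' = X"
  have ev_less: "w \<le> \<sigma> div w ^ q \<longleftrightarrow> q < L" if "q \<le> L" for q
  proof -
    have "w \<le> \<sigma> div w ^ q \<longleftrightarrow> w ^ Suc q \<le> \<sigma>"
      by (simp add: less_eq_div_iff_mult_less_eq)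
    also have "\<dots> \<longleftrightarrow> q < L"
    proof
      assume "w ^ Suc q \<le> \<sigma>"
      with L(2) have "w ^ Suc q < w ^ Suc L" by linarith
      then show "q < L" by (simp del: power_Suc)
    next
      assume "q < L"
      then have "w ^ Suc q \<le> w ^ L" using w_ge by (intro power_increasing) auto
      with L(1) show "w ^ Suc q \<le> \<sigma>" by simp
    qed
    finally show ?thesis .
  qed
  show ?case
  proof (rule wp_for[where N = L and T = 10 and I = ?J], goal_cases)
    case 1
    show ?case using \<open>x10 = _\<close> \<open>x11 = _\<close> R by simp
  next
    case (2 q R' W' X')
    then show ?case using ev_less[of q] R by (auto simp: not_less)
  next
    case (3 q t R' W' X')
    then have "w * w ^ q \<le> \<sigma>" using ev_less[of q] by (simp add: less_eq_div_iff_mult_less_eq)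
    then have "w * w ^ q < 2 ^ w" by simp
    with 3 R show ?case
      unfolding power_body_def
      by (intro vc) (auto simp: div_mult2_eq[symmetric] mult.commute fun_eq_iff)
  next
    case (4 t' R' W' X')
    obtain l where l: "length inputs = Suc l" using num_pos num_le by (cases "length inputs") auto
    show ?case
    proof (rule wp_seq, rule vc_asg, rule wp_for[where N = "Suc L" and T = "length inputs * 300" and I = ?I], goal_cases)
      case 1
      then show ?case using 4 W by (auto simp: keeps_def level_def)
    next
      case (2 x8 q R2 W2 X2)
      then show ?case by auto
    next
      case (3 x8 q t2 R2 W2 X2)
      then have q: "q \<le> L" by simp
      show ?case
        by (rule wp_level_body[OF _ L q])
          (use 3 q p in \<open>auto simp: keeps_def intro: params_keeps\<close>)
    next
      case (4 x8 t2 R2 W2 X2)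
      note 5 = 4
      have "level L (Suc L) = down labels" by (simp add: level_def digits_def)
      moreover have "t2 \<le> t + Suc L * (length inputs * 400) + 40"
        using 5(3) \<open>t' \<le> _\<close> by (simp add: l algebra_simps)
      ultimately show ?case using 5 finite_labels by (auto intro!: Q simp: down_simps)
    qed simp_all
  qed
qed simp_all

end

section \<open>Refining the merge\<close>

text \<open>The initial merge, first graph before second and all in one block, is written to the new
  vectors, because every round begins by making the new vectors the old ones.\<close>

definition init_prog :: prog where
  "init_prog =
     9 ::= V 6 ;;
     loop (V 9 .< V 5) (setb 1 (V 9) ;; 9 ::= V 9 .+ K 1) ;;
     setb 3 (K 0)"

text \<open>\<open>setb\<close> only sets bits, so the new vectors are cleared while they are
  copied, word by word.\<close>

definition shift_body :: prog where
  "shift_body =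
     sto 0 (V 9) (Ld 1 (V 9)) ;; sto 1 (V 9) (K 0) ;;
     sto 2 (V 9) (Ld 3 (V 9)) ;; sto 3 (V 9) (K 0) ;;
     9 ::= V 9 .+ K 1"

definition shift_prog :: prog where
  "shift_prog = 9 ::= K 0 ;; loop (V 9 .< V 7) shift_body"

text \<open>Going down the sorted labels, the running difference is the first position of the
  current label. Visiting only occurring labels keeps the cost linear in the number of
  entries.\<close>

definition reset_body :: prog where
  "reset_body =
     12 ::= Ld 6 (V 9) ;;
     18 ::= V 18 .- Ld 4 (V 12) ;;
     sto 8 (V 12) (V 18) ;;
     sto 9 (V 12) (K 0) ;;
     9 ::= V 9 .+ K 1"

definition reset_prog :: prog where
  "reset_prog = 18 ::= V 5 ;; 9 ::= K 0 ;; loop (V 9 .< V 8) reset_body"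

definition head_prog :: prog where
  "head_prog = ite (getb 2 (V 22)) (23 ::= V 22 .+ K 1) skip"

definition fetch_prog :: "bool \<Rightarrow> prog" where
  "fetch_prog b =
     25 ::= In (ia b 0) (V (pr b)) ;;
     26 ::= In (ia b 1) (V (pr b)) ;;
     27 ::= In (ia b 2) (V (pr b)) ;;
     pr b ::= V (pr b) .+ K 1"

definition place_prog :: prog where
  "place_prog =
     ite (V 26)
       (28 ::= Ld 8 (V 25) ;;
        sto 8 (V 25) (V 28 .+ K 1) ;;
        ite (V 24) (setb 1 (V 28)) skip ;;
        ite (Ld 9 (V 25) .= V 23) skip (setb 3 (V 28) ;; sto 9 (V 25) (V 23)))
       skip"

definition scan_body :: prog where
  "scan_body =
     head_prog ;;
     24 ::= getb 0 (V 22) ;;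
     ite (V 24) (fetch_prog True) (fetch_prog False) ;;
     place_prog ;;
     22 ::= V 22 .+ V 27 ;;
     9 ::= V 9 .+ K 1"

definition scan_prog :: prog where
  "scan_prog =
     9 ::= K 0 ;; 20 ::= K 0 ;; 21 ::= K 0 ;; 22 ::= K 0 ;;
     loop (V 9 .< V 0 .+ V 1) scan_body"

text \<open>The roots are no targets and get their bits by hand: \<open>K 0 .< V 0\<close> is the
  index of the second graph's root, and index 0 starts a block.\<close>

definition round_body :: prog where
  "round_body =
     shift_prog ;; reset_prog ;;
     ite (V 1) (setb 1 (K 0 .< V 0)) skip ;;
     setb 3 (K 0) ;;
     scan_prog ;;
     19 ::= V 19 .+ K 1"

definition rounds_prog :: prog where
  "rounds_prog = 19 ::= K 0 ;; loop (V 19 .< V 2) round_body"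

section \<open>Bitvectors of a merge\<close>

context merge_run
begin

lemma div_less_nw: "j < num \<Longrightarrow> j div w < nw"
proof -
  assume "j < num"
  then have "j \<le> num - 1" by simp
  from div_le_mono[OF this, of w] show ?thesis by (simp add: nw_def)
qed

text \<open>All positions are below \<open>num\<close>, so copying \<open>nw\<close> words copies
  the whole vector.\<close>

lemma bits_beyond:
  assumes "bits f S" and "S \<subseteq> {..<num}" and "nw \<le> p"
  shows "f p = 0"
proof (rule bit_eqI)
  fix b
  have "num \<le> nw * w"
  proof -
    have "num - 1 < ((num - 1) div w + 1) * w"
      using dividend_less_times_div[of w "num - 1"] by (simp add: algebra_simps)
    then show ?thesis unfolding nw_def by linarith
  qed
  also have "\<dots> \<le> p * w" using assms(3) by (rule mult_le_mono1)
  finally have "p * w + b \<notin> S" using assms(2) by auto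
  with assms(1) show "bit (f p) b = bit (0 :: nat) b" by (simp add: bits_def)
qed

definition ZS :: "nat \<Rightarrow> nat set" where
  "ZS h = {j. j < num \<and> fst (M h ! j)}"

definition BS :: "nat \<Rightarrow> nat set" where
  "BS h = {j. j < num \<and> starts (kl h) j}"

lemma bitvectors_subset: "ZS h \<subseteq> {..<num}" "BS h \<subseteq> {..<num}"
  by (auto simp: ZS_def BS_def)

text \<open>With an empty prefix the key compares graphs and then reversals, the order in which the
  nodes are already given.\<close>

lemma M_0: "M 0 = tagged"
proof -
  have "sorted (map (key 0) tagged)"
  proof -
    have "sorted (map rev (node_list k (C b)))" for b
      using sorted_node_list[of k "C b"] by (rule strict_sorted_imp_sorted)
    then show ?thesis
      by (auto simp: tagged_def key_def sorted_append sorted_map comp_def)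
  qed
  then show ?thesis by (simp add: M_def sort_key_id_if_sorted)
qed

lemma count_nodes: "length (filter (snd \<circ> snd) (g b)) = length (node_list k (C b))"
proof -
  have "\<forall>u\<in>set (node_list k (C b)). \<exists>ys y. node_entries k (C b) u = ys @ [y] \<and>
      (\<forall>z\<in>set ys. \<not> (snd \<circ> snd) z) \<and> (snd \<circ> snd) y"
    using flagged_ends[OF node_W_nonempty[OF graph_facts fin]] unfolding node_entries_def comp_def by blast
  from concat_count_ends_total[OF this] show ?thesis by (simp add: g_def graph_entries_def comp_def)
qed

lemma ZS_0: "ZS 0 = {length (filter (snd \<circ> snd) (g False))..<num}"
  unfolding ZS_def M_0 count_nodes by (auto simp: tagged_def num_def nth_append)

lemma BS_0: "BS 0 = {0}"
proof -
  have "kl 0 ! j = []" if "j < num" for j using nth_kl[of 0 0 j] that by (simp add: kt_def)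
  then show ?thesis using num_pos by (auto simp: BS_def starts_def)
qed

definition base :: "(nat \<Rightarrow> nat) \<Rightarrow> mem \<Rightarrow> bool" where
  "base R W \<longleftrightarrow> counted R \<and> R 8 = card labels \<and> (\<forall>i<card labels. W 6 i = down labels ! i) \<and> W 4 = cnt"

lemma base_regs:
  assumes "base R W"
  shows "R 0 = length (g False)" "R 1 = length (g True)" "R 2 = k" "R 3 = \<sigma>" "R 4 = w" "R 5 = num" "R 7 = nw"
    "R 8 = card labels" "W 4 = cnt" "i < card labels \<Longrightarrow> W 6 i = down labels ! i"
  using assms by (auto simp: base_def counted_def params_def)

lemma base_cong:
  assumes "\<And>x. x \<le> 8 \<Longrightarrow> x \<noteq> 6 \<Longrightarrow> R' x = R x" and "W' 4 = W 4" and "W' 6 = W 6"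
  shows "base R' W' = base R W"
  using assms by (simp add: base_def counted_def params_def)

lemma wp_init:
  assumes R: "R 4 = w" "R 5 = num" "R 6 = length (filter (snd \<circ> snd) (g False))"
    and W: "W 1 = (\<lambda>_. 0)" "W 3 = (\<lambda>_. 0)"
    and Q: "\<And>t' f1 f3. t' \<le> t + length inputs * 30 + 30 \<Longrightarrow> bits f1 (ZS 0) \<Longrightarrow> bits f3 (BS 0) \<Longrightarrow>
      Q t' (R(9 := num)) (W(1 := f1, 3 := f3)) X"
  shows "wp init_prog Q t R W X"
  unfolding init_prog_def
proof (rule wp_seq, rule vc_asg, rule wp_seq)
  fix x9 assume x9: "x9 = ev (V 6) R W"
  define n0 where "n0 = length (filter (snd \<circ> snd) (g False))"
  have n0: "n0 \<le> num" using length_la_g by (simp add: n0_def)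
  show "wp (loop (V 9 .< V 5) (setb 1 (V 9) ;; 9 ::= V 9 .+ K 1)) (wp (setb 3 (K 0)) Q)
      (t + (cost (V 6) + 1)) (R(9 := x9)) W X"
  proof (rule wp_for[where N = "num - n0" and T = 20 and I =
      "\<lambda>q R' W' X'. R' = R(9 := n0 + q) \<and> (\<exists>f. W' = W(1 := f) \<and> bits f {n0..<n0 + q}) \<and> X' = X"], goal_cases)
    case 1
    show ?case using x9 R W by (intro conjI exI[of _ "W 1"]) (auto simp: n0_def bits_zero)
  next
    case (2 q R' W' X')
    then show ?case using R n0 by auto
  next
    case (3 q t R' W' X')
    then obtain f where f: "R' = R(9 := n0 + q)" "W' = W(1 := f)" "bits f {n0..<n0 + q}" "X' = X" by blast
    have lt: "n0 + q < num" using 3 by simp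
    have ins: "insert (n0 + q) {n0..<n0 + q} = {n0..<n0 + Suc q}" by auto
    have "Suc (n0 + q) < 2 ^ w" using lt num_le by simp
    then show ?case
    proof (intro wp_seq wp_setb[where S = "{n0..<n0 + q}"] vc_asg, goal_cases)
      case (5 f' y)
      then show ?case using f ins by (auto intro!: exI[of _ f'])
    qed (use f R lt div_less_nw[OF lt] in \<open>auto simp: xb_def\<close>)
  next
    case (4 t' R' W' X')
    then obtain f where f: "R' = R(9 := num)" "W' = W(1 := f)" "bits f {n0..<num}" "X' = X"
      using n0 by auto
    show ?case
    proof (rule wp_setb[where S = "{}"], goal_cases)
      case (5 f')
      have "num * 30 \<le> length inputs * 30" using num_le by simp
      moreover have "(num - n0) * 24 \<le> num * 30" by simp
      ultimately show ?case
        using Q[of _ f f'] f 4(2) 5 by (simp add: ZS_0 BS_0 n0_def)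
    qed (use f R W div_less_nw[OF num_pos] in \<open>auto simp: xb_def bits_zero\<close>)
  qed
qed simp_all

lemma wp_shift:
  assumes R: "R 7 = nw" and Z: "bits (W 0) Z0" "bits (W 1) Z1" "bits (W 2) B0" "bits (W 3) B1"
    "Z0 \<subseteq> {..<num}" "Z1 \<subseteq> {..<num}" "B0 \<subseteq> {..<num}" "B1 \<subseteq> {..<num}"
    and Q: "\<And>t'. t' \<le> t + length inputs * 30 + 10 \<Longrightarrow>
      Q t' (R(9 := nw)) (W(0 := W 1, 1 := \<lambda>_. 0, 2 := W 3, 3 := \<lambda>_. 0)) X"
  shows "wp shift_prog Q t R W X"
  unfolding shift_prog_def
proof (rule wp_seq, rule vc_asg)
  fix x9 assume x9: "x9 = ev (K 0) R W"
  let ?W = "\<lambda>q. W(0 := \<lambda>p. if p < q then W 1 p else W 0 p, 1 := \<lambda>p. if p < q then 0 else W 1 p,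
      2 := \<lambda>p. if p < q then W 3 p else W 2 p, 3 := \<lambda>p. if p < q then 0 else W 3 p)"
  show "wp (loop (V 9 .< V 7) shift_body) Q (t + (cost (K 0) + 1)) (R(9 := x9)) W X"
  proof (rule wp_for[where N = nw and T = 24 and I =
      "\<lambda>q R' W' X'. R' = R(9 := q) \<and> W' = ?W q \<and> X' = X"], goal_cases)
    case 1
    show ?case using x9 by (auto simp: fun_eq_iff)
  next
    case (2 q R' W' X')
    then show ?case using R by auto
  next
    case (3 q t R' W' X')
    have "Suc q < 2 ^ w" using 3 nw_le num_le by simp
    then show ?case
      unfolding shift_body_def
      by (intro vc) (use 3 in \<open>auto simp: xb_def fun_eq_iff less_Suc_eq\<close>)
  next
    case (4 t' R' W' X')
    have "?W nw = W(0 := W 1, 1 := \<lambda>_. 0, 2 := W 3, 3 := \<lambda>_. 0)"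
      using bits_beyond[OF Z(1,5)] bits_beyond[OF Z(2,6)] bits_beyond[OF Z(3,7)] bits_beyond[OF Z(4,8)]
      by (auto simp: fun_eq_iff not_less)
    moreover have "nw * 28 \<le> length inputs * 30"
      using nw_le num_le by (intro mult_le_mono) auto
    ultimately show ?case using 4 Q[of t'] by simp
  qed
qed simp_all

text \<open>Cells outside \<open>labels\<close> are still zero, so visiting the labels alone clears
  the whole of array 9.\<close>

lemma wp_reset:
  assumes b: "base R W" and LB: "\<And>c. c \<notin> labels \<Longrightarrow> W 9 c = 0"
    and Q: "\<And>t' z y f. t' \<le> t + length inputs * 40 + 10 \<Longrightarrow> \<forall>c\<in>labels. f c = first_pos c \<Longrightarrow>
      Q t' (R(9 := card labels, 12 := z, 18 := y)) (W(8 := f, 9 := \<lambda>_. 0)) X"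
  shows "wp reset_prog Q t R W X"
  unfolding reset_prog_def
proof (rule wp_seq, rule vc_asg, rule wp_seq, rule vc_asg)
  fix x18 x9 assume x: "x18 = ev (V 5) R W" "x9 = ev (K 0) (R(18 := x18)) W"
  note R = base_regs[OF b]
  let ?d = "down labels"
  define acc where "acc q = length (filter (\<lambda>x. fst (snd x) \<and> fst x \<in> set (take q ?d)) inputs)" for q
  have d: "set ?d = labels" "distinct ?d" "length ?d = card labels"
    using down_simps[OF finite_labels] by auto
  have acc_Suc: "acc (Suc q) = acc q + cnt (?d ! q)" if q: "q < card labels" for q
  proof -
    have tk: "set (take (Suc q) ?d) = insert (?d ! q) (set (take q ?d))" and ni: "?d ! q \<notin> set (take q ?d)"
      using q d by (auto simp: take_Suc_conv_app_nth in_set_conv_nth nth_eq_iff_index_eq)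
    have "length (filter (\<lambda>x. fst (snd x) \<and> fst x \<in> insert (?d ! q) (set (take q ?d))) xs) =
      length (filter (\<lambda>x. fst (snd x) \<and> fst x \<in> set (take q ?d)) xs) + tally xs (?d ! q)"
      for xs :: "(nat \<times> bool \<times> bool) list"
      using ni by (induction xs) auto
    then show ?thesis unfolding acc_def tk cnt_def .
  qed
  have acc_le: "acc q \<le> num" for q
  proof -
    have "length (filter (\<lambda>x. fst (snd x) \<and> P x) xs) \<le> length (filter (fst \<circ> snd) xs)"
      for P and xs :: "(nat \<times> bool \<times> bool) list"
      by (induction xs) auto
    then have "acc q \<le> length (filter (fst \<circ> snd) inputs)" unfolding acc_def .
    also have "\<dots> \<le> num"
      using num_split[of 0] count_E[of "fst \<circ> snd" 0] by simp
    finally show ?thesis .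
  qed
  \<comment> \<open>In the descending list the first \<open>Suc q\<close> labels are exactly those
    not below the current one.\<close>
  have first: "first_pos (?d ! q) = num - acc (Suc q)" if q: "q < card labels" for q
  proof -
    have "filter (\<lambda>x. fst (snd x) \<and> ?d ! q \<le> fst x) inputs =
        filter (\<lambda>x. fst (snd x) \<and> fst x \<in> set (take (Suc q) ?d)) inputs"
    proof (rule filter_cong[OF refl])
      fix x assume x: "x \<in> set inputs"
      show "(fst (snd x) \<and> ?d ! q \<le> fst x) = (fst (snd x) \<and> fst x \<in> set (take (Suc q) ?d))"
      proof (cases "fst (snd x)")
        case True
        then have "fst x \<in> labels" using x by (auto simp: labels_def minus_labels_def)
        then obtain j where j: "j < card labels" "?d ! j = fst x" using d by (metis in_set_conv_nth)
        have "?d ! q \<le> ?d ! j \<longleftrightarrow> j \<le> q"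
          using down_nth[OF finite_labels, of j q] down_nth[OF finite_labels, of q j] q j(1)
          by (cases "j = q"; cases "j < q") auto
        moreover have "?d ! j \<in> set (take (Suc q) ?d) \<longleftrightarrow> j \<le> q"
          using q j(1) d by (auto simp: in_set_conv_nth nth_eq_iff_index_eq less_Suc_eq_le)
        ultimately show ?thesis using j(2) True by simp
      qed simp
    qed
    then show ?thesis by (simp add: first_pos_def acc_def)
  qed
  show "wp (loop (V 9 .< V 8) reset_body) Q (t + (cost (V 5) + 1) + (cost (K 0) + 1)) (R(18 := x18, 9 := x9)) W X"
  proof (rule wp_for[where N = "card labels" and T = 30 and I =
      "\<lambda>q R' W' X'. \<exists>z F L. R' = R(9 := q, 12 := z, 18 := num - acc q) \<and> W' = W(8 := F, 9 := L) \<and>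
        (\<forall>i<q. F (?d ! i) = first_pos (?d ! i)) \<and>
        (\<forall>c. L c = (if c \<in> set (take q ?d) then 0 else W 9 c)) \<and> X' = X"], goal_cases)
    case 1
    show ?case
      by (rule exI[of _ "R 12"], rule exI[of _ "W 8"], rule exI[of _ "W 9"])
        (use x R in \<open>auto simp: fun_eq_iff acc_def\<close>)
  next
    case (2 q R' W' X')
    then show ?case using R by auto
  next
    case (3 q t R' W' X')
    then obtain z F L where I: "R' = R(9 := q, 12 := z, 18 := num - acc q)" "W' = W(8 := F, 9 := L)"
      "\<forall>i<q. F (?d ! i) = first_pos (?d ! i)" "\<forall>c. L c = (if c \<in> set (take q ?d) then 0 else W 9 c)" "X' = X"
      by blast
    have q: "q < card labels" by fact
    have c: "?d ! q \<in> labels" using q d by (metis nth_mem)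
    have c_le: "?d ! q \<le> \<sigma>" using labels_le[OF c] by simp
    have Sq: "Suc q < 2 ^ w" using q card_labels by simp
    have qs: "q < Suc (Suc \<sigma>)" using q digits_card_le[of labels 0] by (simp add: digits_def)
    have ac: "cnt (?d ! q) \<le> num - acc q" using acc_le[of "Suc q"] acc_Suc[OF q] by simp
    have na: "num - acc q < 2 ^ w" using num_le by simp
    have tk: "set (take (Suc q) ?d) = insert (?d ! q) (set (take q ?d))"
      using q d by (simp add: take_Suc_conv_app_nth)
    have ne: "?d ! i \<noteq> ?d ! q" if "i < q" for i using that q d by (simp add: nth_eq_iff_index_eq)
    show ?case
      unfolding reset_body_def
    proof (intro vc, goal_cases)
      case (1 x12 x18 i8 v8 i9 v9 x9)
      have eqs: "x12 = ?d ! q" "x18 = num - acc (Suc q)" "i8 = ?d ! q" "v8 = num - acc (Suc q)" "i9 = ?d ! q"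
        "v9 = 0" "x9 = Suc q"
        using 1 I R(9) R(10)[OF q] acc_Suc[OF q] by auto
      show ?case
        apply (rule conjI, rule exI[of _ "?d ! q"], rule exI[of _ "F(?d ! q := num - acc (Suc q))"],
            rule exI[of _ "L(?d ! q := 0)"])
        using I eqs first[OF q] ne tk by (auto simp: fun_eq_iff less_Suc_eq)
    qed (use I R(9) R(10)[OF q] c_le Sq qs ac na in \<open>auto simp: xb_def\<close>)
  next
    case (4 t' R' W' X')
    then obtain z F L where I: "R' = R(9 := card labels, 12 := z, 18 := num - acc (card labels))" "W' = W(8 := F, 9 := L)"
      "\<forall>i<card labels. F (?d ! i) = first_pos (?d ! i)"
      "\<forall>c. L c = (if c \<in> set (take (card labels) ?d) then 0 else W 9 c)" "X' = X"
      by blast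
    have "L = (\<lambda>_. 0)" using I(4) d LB by (auto simp: fun_eq_iff)
    moreover have "\<forall>c\<in>labels. F c = first_pos c" using I(3) d by (metis in_set_conv_nth)
    moreover have "card labels * 34 \<le> length inputs * 40" using card_labels by (intro mult_le_mono) auto
    ultimately show ?case using I 4(2) by (auto intro!: Q)
  qed
qed simp_all

lemma wp_head:
  assumes R: "R 4 = w" "R 22 = i" and i: "i < num" and h: "h \<le> h'" and B: "bits (W 2) (BS h)"
    and blk: "\<not> starts (kl h) i \<Longrightarrow> R 23 = block h (M h' ! i)"
    and Q: "\<And>t'. t' \<le> t + 20 \<Longrightarrow> Q t' (R(23 := block h (M h' ! i))) W X"
  shows "wp head_prog Q t R W X"
proof -
  have ev: "drop_bit (i mod w) (W 2 (i div w)) mod 2 = of_bool (starts (kl h) i)"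
    using bits_get[OF B, of i] i by (simp add: BS_def)
  have si: "Suc i < 2 ^ w" using i num_le by simp
  show ?thesis
    unfolding head_prog_def
  proof (rule vc_ite, goal_cases)
    case 1
    then have s: "starts (kl h) i" using ev R by (cases "starts (kl h) i") auto
    show ?case
      by (rule vc_asg)
        (use Q[of "t + (cost (getb 2 (V 22)) + 1) + (cost (V 22 .+ K 1) + 1)"] R si block_starts[OF h i s]
          in \<open>simp_all\<close>)
  next
    case 2
    then have s: "\<not> starts (kl h) i" using ev R by (cases "starts (kl h) i") auto
    have "R(23 := block h (M h' ! i)) = R" using blk[OF s] by (simp add: fun_upd_idem)
    then show ?case using Q[of "t + (cost (getb 2 (V 22)) + 1) + 1"] by (intro vc) simp
  qed (use R div_less_nw[OF i] in \<open>auto simp: xb_def\<close>)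
qed

lemma wp_place:
  assumes R: "R 4 = w" "R 25 = c" "c \<le> \<sigma>" "R 26 = of_bool m" "R 24 = of_bool b" "R 23 = blk"
    and Z: "bits (W 1) Z" and B: "bits (W 3) B" and p: "m \<Longrightarrow> W 8 c = p" "m \<Longrightarrow> p < num"
    and Q: "\<And>t' z f1 f3. t' \<le> t + 60 \<Longrightarrow> bits f1 (if m \<and> b then insert p Z else Z) \<Longrightarrow>
      bits f3 (if m \<and> W 9 c \<noteq> blk then insert p B else B) \<Longrightarrow>
      Q t' (R(28 := z)) (W(1 := f1, 3 := f3, 8 := if m then (W 8)(c := Suc p) else W 8,
        9 := if m then (W 9)(c := blk) else W 9)) X"
  shows "wp place_prog Q t R W X"
proof (cases m)
  case False
  have "R(28 := R 28) = R" "W(1 := W 1, 3 := W 3, 8 := W 8, 9 := W 9) = W" by (auto simp: fun_eq_iff)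
  then show ?thesis
    unfolding place_prog_def
    by (intro vc) (use False R Q[of _ "W 1" "W 3" "R 28"] Z B in auto)
next
  case True
  then have p: "W 8 c = p" "p < num" using p by auto
  have sp: "Suc p < 2 ^ w" using p num_le by simp
  have dp: "p div w < nw" using div_less_nw p by simp
  let ?tail = "ite (Ld 9 (V 25) .= V 23) skip (setb 3 (V 28) ;; sto 9 (V 25) (V 23))"
  have tail: "wp ?tail Q t' (R(28 := p)) (W(1 := f1, 8 := (W 8)(c := Suc p))) X"
    if t': "t' \<le> t + 34" and f1: "bits f1 (if b then insert p Z else Z)" for t' f1
  proof (rule vc_ite, goal_cases)
    case 1
    then have eq: "W 9 c = blk" using R by (auto split: if_splits)
    have "W(1 := f1, 8 := (W 8)(c := Suc p)) =
        W(1 := f1, 3 := W 3, 8 := (W 8)(c := Suc p), 9 := (W 9)(c := blk))"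
      using eq by (auto simp: fun_eq_iff)
    then show ?case
      using Q[of "t' + (cost (Ld 9 (V 25) .= V 23) + 1) + 1" f1 "W 3" p] True eq f1 B t'
      by (intro vc) simp
  next
    case 2
    then have ne: "W 9 c \<noteq> blk" using R by auto
    show ?case
    proof (rule wp_seq, rule wp_setb[where S = B], goal_cases)
      case (5 f3)
      show ?case
      proof (rule vc_sto, goal_cases)
        case (1 i x)
        have "W(1 := f1, 8 := (W 8)(c := Suc p), 3 := f3, 9 := (W 9)(c := blk)) =
          W(1 := f1, 3 := f3, 8 := (W 8)(c := Suc p), 9 := (W 9)(c := blk))" by (auto simp: fun_eq_iff)
        then show ?case using 1 5 R ne True f1 t' Q[of _ f1 f3 p] by simp
      qed (use R in \<open>auto simp: xb_def\<close>)
    qed (use R dp B in \<open>auto simp: xb_def\<close>)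
  qed (use R in \<open>auto simp: xb_def\<close>)
  show ?thesis
    unfolding place_prog_def
  proof (rule vc_ite, rule wp_seq, rule vc_asg, rule wp_seq, rule vc_sto, rule wp_seq, goal_cases)
    case (1 x28 i v)
    have eqs: "x28 = p" "i = c" "v = Suc p" using 1 R p by auto
    have W8: "W(8 := (W 8)(c := Suc p)) = W(1 := W 1, 8 := (W 8)(c := Suc p))" by (auto simp: fun_eq_iff)
    show ?case
    proof (rule vc_ite, goal_cases)
      case 1
      then have b using R by (cases b) auto
      then show ?case
      proof (intro wp_setb[where S = Z], goal_cases)
        case (5 f1)
        have "W(8 := (W 8)(c := Suc p), 1 := f1) = W(1 := f1, 8 := (W 8)(c := Suc p))" by (auto simp: fun_eq_iff)
        then show ?case using tail[of _ f1] 5 eqs by simp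
      qed (use R eqs dp Z in \<open>auto simp: xb_def\<close>)
    next
      case 2
      then have "\<not> b" using R by (cases b) auto
      with Z have Z': "bits (W 1) (if b then insert p Z else Z)" by simp
      show ?case unfolding eqs W8 by (rule wp_skip, rule tail[OF _ Z']) simp
    qed simp
  qed (use R True p sp in \<open>auto simp: xb_def\<close>)
qed

lemma pr_neq [simp]: "x < 20 \<or> 21 < x \<Longrightarrow> x \<noteq> pr b" "x < 20 \<or> 21 < x \<Longrightarrow> pr b \<noteq> x"
  by (auto simp: pr_def)

lemma wp_fetch:
  assumes R: "R 24 = of_bool b" "R (pr b) = p" and p: "p < length (g b)" "g b ! p = (c, m, l)"
    and Q: "\<And>t'. t' \<le> t + 30 \<Longrightarrow> Q t' (R(25 := c, 26 := of_bool m, 27 := of_bool l, pr b := Suc p)) W X"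
  shows "wp (ite (V 24) (fetch_prog True) (fetch_prog False)) Q t R W X"
proof -
  have sp: "Suc p < 2 ^ w" using p(1) length_g_le[of b] by simp
  have pr: "pr b < 40" "pr b \<notin> {25, 26, 27}" by (simp_all add: pr_def)
  have *: "wp (fetch_prog b) Q t' R W X" if "t' \<le> t + 2" for t'
    unfolding fetch_prog_def
  proof (intro vc, goal_cases)
    case (1 a b' c' d)
    then have "a = c" "b' = of_bool m" "c' = of_bool l" "d = Suc p"
      using R p pr by auto
    then show ?case using Q[of "t' + (cost (In (ia b 0) (V (pr b))) + 1) + (cost (In (ia b 1) (V (pr b))) + 1) +
      (cost (In (ia b 2) (V (pr b))) + 1) + (cost (V (pr b) .+ K 1) + 1)"] that by simp
  qed (use R p pr sp in auto)
  show ?thesis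
    by (rule vc_ite; (cases b)?) (use R * in auto)
qed

section \<open>Invariant of the scan\<close>

definition ends :: "nat \<Rightarrow> nat \<Rightarrow> nat" where
  "ends h q = length (filter la (take q (E h)))"

definition rest :: "nat \<Rightarrow> bool \<Rightarrow> nat \<Rightarrow> (nat \<times> bool \<times> bool) list" where
  "rest h b q = map (\<lambda>y. snd (snd y)) (filter (\<lambda>y. fst y = b) (drop q (E h)))"

definition zpos :: "nat \<Rightarrow> nat \<Rightarrow> nat set" where
  "zpos h q = {pos h i |i. i < q \<and> mi (E h ! i) \<and> fst (E h ! i)}"

definition bpos :: "nat \<Rightarrow> nat \<Rightarrow> nat set" where
  "bpos h q = {pos h i |i. i < q \<and> mi (E h ! i) \<and> fresh h i}"

lemma zpos_Suc: "zpos h (Suc q) = (if mi (E h ! q) \<and> fst (E h ! q) then insert (pos h q) (zpos h q) else zpos h q)"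
  by (auto simp: zpos_def less_Suc_eq)

lemma bpos_Suc: "bpos h (Suc q) = (if mi (E h ! q) \<and> fresh h q then insert (pos h q) (bpos h q) else bpos h q)"
  by (auto simp: bpos_def less_Suc_eq)

lemma latest_seen_Suc:
  assumes "q < length (E h)"
  shows "latest (seen h (Suc q)) = (if mi (E h ! q)
    then (latest (seen h q))(lab (E h ! q) := block h (own (E h ! q))) else latest (seen h q))"
  using assms by (simp add: seen_def take_Suc_conv_app_nth)

text \<open>\<open>Z\<close> and \<open>B\<close> are the bits set for the roots before the scan.
  The block register is constrained only if the next node continues a block; at a start
  \<open>head_prog\<close> overwrites it.\<close>

definition scan_inv :: "nat \<Rightarrow> nat set \<Rightarrow> nat set \<Rightarrow> (nat \<Rightarrow> nat) \<Rightarrow> mem \<Rightarrow> nat \<Rightarrow> (nat \<Rightarrow> nat) \<Rightarrow> mem \<Rightarrow> bool" where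
  "scan_inv h Z B R W q R' W' \<longleftrightarrow>
     (\<forall>x. x \<notin> {9, 20, 21, 22, 23, 24, 25, 26, 27, 28} \<longrightarrow> R' x = R x) \<and> R' 9 = q \<and> R' 22 = ends h q \<and>
     (\<forall>b. drop (R' (pr b)) (g b) = rest h b q) \<and>
     (ends h q < num \<and> \<not> starts (kl h) (ends h q) \<longrightarrow> R' 23 = block h (M h ! ends h q)) \<and>
     (\<exists>f1 f3 F. W' = W(1 := f1, 3 := f3, 8 := F, 9 := latest (seen h q)) \<and>
        bits f1 (Z \<union> zpos h q) \<and> bits f3 (B \<union> bpos h q) \<and>
        (\<forall>c\<in>labels. F c = first_pos c + length (filter (\<lambda>y. mi y \<and> lab y = c) (take q (E h)))))"

lemma wp_scan_body:
  assumes h: "Suc h \<le> k" and b: "base R W" and W: "bits (W 0) (ZS h)" "bits (W 2) (BS h)"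
    and I: "scan_inv h Z B R W q R' W'" and q: "q < length inputs"
    and Q: "\<And>t' R2 W2. t' \<le> t + 150 \<Longrightarrow> scan_inv h Z B R W (Suc q) R2 W2 \<Longrightarrow> Q t' R2 W2 X"
  shows "wp scan_body Q t R' W' X"
proof -
  obtain f1 f3 F where R': "\<forall>x. x \<notin> {9, 20, 21, 22, 23, 24, 25, 26, 27, 28} \<longrightarrow> R' x = R x" "R' 9 = q" "R' 22 = ends h q"
    and dr: "\<forall>b. drop (R' (pr b)) (g b) = rest h b q"
    and blk: "ends h q < num \<and> \<not> starts (kl h) (ends h q) \<longrightarrow> R' 23 = block h (M h ! ends h q)"
    and W': "W' = W(1 := f1, 3 := f3, 8 := F, 9 := latest (seen h q))"
    and f: "bits f1 (Z \<union> zpos h q)" "bits f3 (B \<union> bpos h q)"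
    and F: "\<forall>c\<in>labels. F c = first_pos c + length (filter (\<lambda>y. mi y \<and> lab y = c) (take q (E h)))"
    using I unfolding scan_inv_def by blast
  have qE: "q < length (E h)" using q by simp
  obtain b u c m l where y: "E h ! q = (b, u, c, m, l)" by (metis prod_cases5)
  have yE: "E h ! q \<in> set (E h)" using qE by (rule nth_mem)
  have e: "ends h q < num" "M h ! ends h q = (b, u)"
    using count_la[OF qE] by (simp_all add: ends_def own_def y)
  have e_Suc: "ends h (Suc q) = ends h q + of_bool l"
    using qE by (simp add: ends_def take_Suc_conv_app_nth y)
  have rest: "rest h b' q = (if b' = b then (c, m, l) # rest h b' (Suc q) else rest h b' (Suc q))" for b'
    unfolding rest_def Cons_nth_drop_Suc[OF qE, symmetric] by (simp add: y)
  define p where "p = R' (pr b)"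
  have dp: "drop p (g b) = (c, m, l) # rest h b (Suc q)" using dr rest[of b] by (simp add: p_def)
  then have p: "p < length (g b)" by (metis drop_all list.distinct(1) not_le)
  have gp: "g b ! p = (c, m, l)" "drop (Suc p) (g b) = rest h b (Suc q)"
    using dp Cons_nth_drop_Suc[OF p] by auto
  have dr': "drop (R' (pr b')) (g b') = rest h b' (Suc q)" if "b' \<noteq> b" for b'
    using dr rest[of b'] that by simp
  have c: "c \<le> \<sigma>" using label_le[OF yE] by (simp add: y)
  have cl: "c \<in> labels" if m using labels_iff[of c h] yE y that by force
  have Fc: "F c = pos h q" if m using F cl[OF that] by (simp add: pos_def y)
  have pos: "pos h q < num" if m using M_pos(1)[OF h qE] that by (simp add: y)
  have fresh: "fresh h q \<longleftrightarrow> latest (seen h q) c \<noteq> block h (b, u)"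
    using fresh_iff_latest[OF qE] by (simp add: y own_def)
  have lat: "latest (seen h (Suc q)) = (if m then (latest (seen h q))(c := block h (b, u)) else latest (seen h q))"
    using latest_seen_Suc[OF qE] by (simp add: y own_def)
  \<comment> \<open>Either the entry ends its node and the next node continues the block, or the
    node itself goes on.\<close>
  have blk_Suc: "block h (b, u) = block h (M h ! ends h (Suc q))"
    if "ends h (Suc q) < num" "\<not> starts (kl h) (ends h (Suc q))"
  proof (cases l)
    case True
    then show ?thesis using block_not_starts[of h h "ends h q"] that e(2) e_Suc by simp
  next
    case False
    then show ?thesis using e(2) e_Suc by simp
  qed
  have R4: "R' 4 = w" using R'(1) base_regs[OF b] by simp
  have W2: "W' 0 = W 0" "W' 2 = W 2" "W' 1 = f1" "W' 3 = f3" "W' 8 = F" "W' 9 = latest (seen h q)" by (simp_all add: W')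
  have zq: "drop_bit (ends h q mod w) (W 0 (ends h q div w)) mod 2 = of_bool b"
    using bits_get[OF W(1), of "ends h q"] e by (simp add: ZS_def)
  have Suc_q: "Suc q < 2 ^ w" using q by simp
  have Suc_e: "ends h q + of_bool l < 2 ^ w" using e(1) num_le by (cases l) simp_all
  have pr: "pr b \<in> {20, 21}" "\<And>b'. b' \<noteq> b \<Longrightarrow> pr b' \<noteq> pr b" "\<And>b'. pr b' \<in> {20, 21}"
    by (auto simp: pr_def)
  show ?thesis
    unfolding scan_body_def
  proof (rule wp_seq, rule wp_head[where i = "ends h q" and h = h and h' = h], goal_cases)
    case (7 t1)
    show ?case
    proof (rule wp_seq, rule vc_asg, rule wp_seq, rule wp_fetch[where b = b and p = p and c = c and m = m and l = l], goal_cases)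
      case (5 x24 t2)
      show ?case
      proof (rule wp_seq, rule wp_place[where c = c and m = m and b = b and blk = "block h (b, u)" and
            Z = "Z \<union> zpos h q" and B = "B \<union> bpos h q" and p = "pos h q"], goal_cases)
        case (11 t3 z f1' f3')
        show ?case
        proof (rule wp_seq, rule vc_asg, rule vc_asg, goal_cases)
          case (1 x22 x9)
          have eqs: "x22 = ends h (Suc q)" "x9 = Suc q"
            using 1 R' e_Suc pr by auto
          show ?case
          proof (rule Q, goal_cases)
            case 1
            show ?case using 7 5 11 by simp
          next
            case 2
            show ?case
              unfolding scan_inv_def
            proof (intro conjI, goal_cases)
              case 1
              show ?case using R' pr(1) by auto
            next
              case 4
              show ?case
              proof
                fix b'
                show "drop ((R'(23 := block h (M h ! ends h q), 24 := x24, 25 := c, 26 := of_bool m, 27 := of_bool l,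
                  pr b := Suc p, 28 := z, 22 := x22, 9 := x9)) (pr b')) (g b') = rest h b' (Suc q)"
                  using dr' gp(2) pr by (cases "b' = b") (auto simp: pr_def)
              qed
            next
              case 6
              have "bits f1' (Z \<union> zpos h (Suc q))" using 11(2) by (auto simp: zpos_Suc y split: if_splits)
              moreover have "bits f3' (B \<union> bpos h (Suc q))" using 11(3) by (auto simp: bpos_Suc y fresh W2 split: if_splits)
              moreover have "\<forall>c'\<in>labels. (if m then F(c := Suc (pos h q)) else F) c' =
                  first_pos c' + length (filter (\<lambda>y. mi y \<and> lab y = c') (take (Suc q) (E h)))"
                using F Fc qE by (auto simp: take_Suc_conv_app_nth y)
              ultimately show ?case
                by (intro exI[of _ f1'] exI[of _ f3'] exI[of _ "if m then F(c := Suc (pos h q)) else F"])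
                  (simp add: W' lat)
            qed (use R' eqs blk_Suc e pr in \<open>auto\<close>)
          qed
        qed (use R' Suc_e Suc_q pr in \<open>auto\<close>)
      qed (use R' R4 c e pr 5 f Fc pos W2 zq in \<open>auto\<close>)
    qed (use R' R4 zq W2 gp p p_def div_less_nw[OF e(1)] in \<open>auto simp: xb_def pr_def\<close>)
  qed (use R4 R' e W2 W blk in \<open>auto\<close>)
qed

lemma wp_scan:
  assumes h: "Suc h \<le> k" and b: "base R W" and W: "bits (W 0) (ZS h)" "bits (W 2) (BS h)"
    and Z: "bits (W 1) Z" and B: "bits (W 3) B"
    and F: "\<forall>c\<in>labels. W 8 c = first_pos c" and LB: "W 9 = (\<lambda>_. 0)"
    and Q: "\<And>t' R2 W2. t' \<le> t + length inputs * 160 + 20 \<Longrightarrow> scan_inv h Z B R W (length inputs) R2 W2 \<Longrightarrow>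
      Q t' R2 W2 X"
  shows "wp scan_prog Q t R W X"
  unfolding scan_prog_def
proof (rule wp_seq, rule vc_asg, rule wp_seq, rule vc_asg, rule wp_seq, rule vc_asg, rule wp_seq, rule vc_asg, goal_cases)
  case (1 x9 x20 x21 x22)
  have x: "x9 = 0" "x20 = 0" "x21 = 0" "x22 = 0" using 1 by simp_all
  note Rb = base_regs[OF b]
  have len: "length (g False) + length (g True) = length inputs" by (simp add: inputs_eq)
  show ?case
  proof (rule wp_for[where N = "length inputs" and T = 150 and
        I = "\<lambda>q R' W' X'. scan_inv h Z B R W q R' W' \<and> X' = X"], goal_cases)
    case 1
    have "W = W(1 := W 1, 3 := W 3, 8 := W 8, 9 := latest (seen h 0))"
      by (auto simp: fun_eq_iff seen_def LB)
    moreover have "rest h b 0 = g b" for b by (simp add: rest_def g_def filter_E)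
    moreover have "bits (W 1) (Z \<union> zpos h 0)" "bits (W 3) (B \<union> bpos h 0)"
      "\<forall>c\<in>labels. W 8 c = first_pos c + length (filter (\<lambda>y. mi y \<and> lab y = c) (take 0 (E h)))"
      using Z B F by (auto simp: zpos_def bpos_def)
    ultimately have "\<exists>f1 f3 F. W = W(1 := f1, 3 := f3, 8 := F, 9 := latest (seen h 0)) \<and>
        bits f1 (Z \<union> zpos h 0) \<and> bits f3 (B \<union> bpos h 0) \<and>
        (\<forall>c\<in>labels. F c = first_pos c + length (filter (\<lambda>y. mi y \<and> lab y = c) (take 0 (E h))))"
      and "rest h b 0 = g b" for b by blast+
    then show ?case
      using x unfolding scan_inv_def by (auto simp: ends_def pr_def)
  next
    case (2 q R' W' X')
    then have "R' 0 = R 0" "R' 1 = R 1" "R' 9 = q" by (auto simp: scan_inv_def)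
    then show ?case using Rb len by auto
  next
    case (3 q t R' W' X')
    then show ?case by (intro wp_scan_body[OF h b W]) auto
  next
    case (4 t' R' W' X')
    then show ?case by (auto intro!: Q)
  qed
qed simp_all

text \<open>A non-empty collection has its root and hence an entry, so an empty graph is recognised
  by its array length.\<close>

lemma empty_graph: "length (g b) = 0 \<longleftrightarrow> C b = {}"
proof
  assume "length (g b) = 0"
  then have "length (filter (snd \<circ> snd) (g b)) = 0" by simp
  then have "set (node_list k (C b)) = {}" by (simp only: count_nodes length_0_conv list.set)
  then show "C b = {}" using root_node[of "C b" k] set_node_list[OF fin, of k b] by auto
qed (simp add: g_def graph_entries_def node_list_def)

text \<open>The old vectors belong to the preceding merge; after round \<open>k\<close>, array 2
  thus holds the block starts of order \<open>k - 1\<close> for the output. Before the first round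
  there is no preceding merge.\<close>

definition round_inv :: "nat \<Rightarrow> (nat \<Rightarrow> nat) \<Rightarrow> mem \<Rightarrow> bool" where
  "round_inv h R W \<longleftrightarrow> base R W \<and> R 19 = h \<and> bits (W 1) (ZS h) \<and> bits (W 3) (BS h) \<and>
     (if h = 0 then bits (W 0) {} \<and> bits (W 2) {} else bits (W 0) (ZS (h - 1)) \<and> bits (W 2) (BS (h - 1))) \<and>
     (\<forall>c. c \<notin> labels \<longrightarrow> W 9 c = 0)"

lemma wp_round:
  assumes h: "Suc h \<le> k" and I: "round_inv h R W"
    and Q: "\<And>t' R' W'. t' \<le> t + length inputs * 400 \<Longrightarrow> round_inv (Suc h) R' W' \<Longrightarrow> Q t' R' W' X"
  shows "wp round_body Q t R W X"
  unfolding round_body_def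
proof -
  from I have b: "base R W" and R19: "R 19 = h" and Z1: "bits (W 1) (ZS h)" and B1: "bits (W 3) (BS h)"
    and LB: "\<And>c. c \<notin> labels \<Longrightarrow> W 9 c = 0" by (auto simp: round_inv_def)
  obtain Z0 B0 where ZB0: "bits (W 0) Z0" "bits (W 2) B0" "Z0 \<subseteq> {..<num}" "B0 \<subseteq> {..<num}"
    using I bitvectors_subset[of "h - 1"] unfolding round_inv_def by (metis empty_subsetI)
  note Rb = base_regs[OF b]
  define rt where "rt = (if length (g True) = 0 then {} else {of_bool (0 < length (g False)) :: nat})"
  have rt: "j \<in> rt \<longleftrightarrow> C True \<noteq> {} \<and> j = of_bool (C False \<noteq> {})" for j
    using empty_graph[of True] empty_graph[of False] by (auto simp: rt_def)
  have rt_less: "j < num" if "j \<in> rt" for j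
  proof -
    have "j < length roots" using that unfolding rt by (auto simp: roots_def)
    then show ?thesis using num_split[of 0] by simp
  qed
  \<comment> \<open>The bit set by hand for a root and those set by the scan make up the next origin
    vector.\<close>
  have ZS_Suc: "rt \<union> zpos h (length inputs) = ZS (Suc h)"
    using fst_M_Suc[OF h] rt rt_less M_pos(1)[OF h]
    by (auto simp: ZS_def zpos_def)
  have BS_Suc: "{0} \<union> bpos h (length inputs) = BS (Suc h)"
    using starts_Suc[OF h] M_pos(1)[OF h] num_pos
    by (auto simp: BS_def bpos_def)
  have one: "length inputs \<ge> 1" using num_pos num_le by simp
  show "wp (shift_prog ;; reset_prog ;; ite (V 1) (setb 1 (K 0 .< V 0)) skip ;; setb 3 (K 0) ;; scan_prog ;; 19 ::= V 19 .+ K 1) Q t R W X"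
  proof (rule wp_seq, rule wp_shift[where ?Z0.0 = Z0 and ?Z1.0 = "ZS h" and ?B0.0 = B0 and ?B1.0 = "BS h"], goal_cases)
    case (10 t1)
    let ?W1 = "W(0 := W 1, 1 := \<lambda>_. 0, 2 := W 3, 3 := \<lambda>_. 0)"
    have b1: "base (R(9 := nw)) ?W1" using b by (subst base_cong[of _ R _ W]) auto
    show ?case
    proof (rule wp_seq, rule wp_reset[OF b1], goal_cases)
      case (2 t2 z y f)
      let ?R2 = "R(9 := nw, 9 := card labels, 12 := z, 18 := y)"
      let ?W2 = "\<lambda>f1. ?W1(8 := f, 9 := \<lambda>_. 0, 1 := f1)"
      have rest: "wp (setb 3 (K 0) ;; scan_prog ;; 19 ::= V 19 .+ K 1) Q t3 ?R2 (?W2 f1) X"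
        if t3: "t3 \<le> t2 + 30" and f1: "bits f1 rt" for t3 f1
      proof (rule wp_seq, rule wp_setb[where S = "{}"], goal_cases)
        case (5 f3)
        have b2: "base ?R2 ((?W2 f1)(3 := f3))" using b by (subst base_cong[of _ R _ W]) auto
        show ?case
        proof (rule wp_seq, rule wp_scan[OF h b2, where Z = rt and B = "{0}"], goal_cases)
          case (7 t4 R4 W4)
          obtain f1' f3' F' where s: "\<forall>x. x \<notin> {9, 20, 21, 22, 23, 24, 25, 26, 27, 28} \<longrightarrow> R4 x = ?R2 x"
            "W4 = ((?W2 f1)(3 := f3))(1 := f1', 3 := f3', 8 := F', 9 := latest (seen h (length inputs)))"
            "bits f1' (ZS (Suc h))" "bits f3' (BS (Suc h))"
            using 7(2) unfolding scan_inv_def ZS_Suc BS_Suc by blast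
          \<comment> \<open>Only labels of edges with W^- = 1 are recorded, so the sparse reset of
            array 9 keeps working.\<close>
          have LB': "latest (seen h (length inputs)) c = 0" if "c \<notin> labels" for c
          proof -
            have "latest (seen h q) c = 0" if "q \<le> length inputs" for q
              using that
            proof (induction q)
              case (Suc q)
              then have qE: "q < length (E h)" by simp
              have "lab (E h ! q) \<noteq> c" if "mi (E h ! q)"
                using labels_iff[of c h] nth_mem[OF qE] that \<open>c \<notin> labels\<close> by blast
              with Suc latest_seen_Suc[OF qE] show ?case by (cases "mi (E h ! q)") auto
            qed (simp add: seen_def)
            then show ?thesis by simp
          qed
          show ?case
          proof (rule vc_asg, goal_cases)
            case (1 x19)
            have x19: "x19 = Suc h" using 1 s(1) R19 by simp
            show ?case
            proof (rule Q, goal_cases)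
              case 1
              show ?case using 10 2(1) t3 5(1) 7(1) one by simp
            next
              case 2
              have "base (R4(19 := x19)) W4" using b s by (subst base_cong[of _ R _ W]) auto
              then show ?case using s LB' x19 Z1 B1 by (simp add: round_inv_def)
            qed
          qed (use s R19 h in auto)
        qed (use f1 5 2 Z1 B1 in auto)
      qed (use Rb div_less_nw[OF num_pos] in \<open>auto simp: xb_def bits_zero\<close>)
      show ?case
      proof (rule wp_seq, rule vc_ite, goal_cases)
        case 1
        then have ne: "length (g True) \<noteq> 0" using Rb by simp
        then have rte: "rt = {of_bool (0 < length (g False))}" by (simp add: rt_def)
        show ?case
        proof (rule wp_setb[where S = "{}"], goal_cases)
          case (5 f1)
          then show ?case using rest[of _ f1] Rb rte by simp
        qed (use Rb rte rt_less div_less_nw div_less_nw[OF num_pos] in \<open>auto simp: xb_def bits_zero\<close>)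
      next
        case 2
        then have "rt = {}" using Rb by (simp add: rt_def)
        then have "bits (\<lambda>_. 0) rt" by (simp add: bits_zero)
        from rest[OF _ this, of "t2 + (cost (V 1) + 1) + 1"] show ?case
          by (intro wp_skip) (simp add: fun_upd_twist)
      qed simp
    qed (use LB in auto)
  qed (use Rb ZB0 Z1 B1 bitvectors_subset in auto)
qed

lemma wp_rounds:
  assumes I: "\<And>R'. (\<forall>x. x \<noteq> 19 \<longrightarrow> R' x = R x) \<Longrightarrow> R' 19 = 0 \<Longrightarrow> round_inv 0 R' W"
    and Q: "\<And>t' R' W'. t' \<le> t + k * (length inputs * 410) + 10 \<Longrightarrow> round_inv k R' W' \<Longrightarrow> Q t' R' W' X"
  shows "wp rounds_prog Q t R W X"
  unfolding rounds_prog_def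
proof (rule wp_seq, rule vc_asg, rule wp_for[where N = k and T = "length inputs * 400" and
      I = "\<lambda>h R' W' X'. round_inv h R' W' \<and> X' = X"], goal_cases)
  case (1 x)
  then show ?case using I by simp
next
  case (2 x q R' W' X')
  then show ?case by (auto simp: round_inv_def dest: base_regs)
next
  case (3 x q t R' W' X')
  then show ?case by (intro wp_round[of q]) auto
next
  case (4 x t' R' W' X')
  obtain l where l: "length inputs = Suc l" using num_pos num_le by (cases "length inputs") auto
  have "t' \<le> t + k * (length inputs * 410) + 10" using 4(3) by (simp add: l algebra_simps)
  with 4 Q show ?case by blast
qed simp_all

end

section \<open>Writing the output\<close>

definition ar :: "bool \<Rightarrow> nat" where
  "ar b = (if b then 31 else 30)"

text \<open>These registers hold the next label of the current node in each of the graphs.\<close>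

definition cr :: "bool \<Rightarrow> nat" where
  "cr b = (if b then 33 else 32)"

text \<open>\<open>\<sigma> + 1\<close> exceeds every label and is the sentinel for a graph with no
  entry left at this node.\<close>

definition pick_prog :: "bool \<Rightarrow> prog" where
  "pick_prog b = ite (V (ar b)) (cr b ::= In (ia b 0) (V (pr b))) (cr b ::= V 3 .+ K 1)"

definition take_prog :: "bool \<Rightarrow> prog" where
  "take_prog b =
     ite (V (cr b) .= V 25)
       (ar b ::= K 1 .- In (ia b 2) (V (pr b)) ;; pr b ::= V (pr b) .+ K 1) skip"

definition emit_prog :: prog where
  "emit_prog =
     outp 0 (V 29) (V 25) ;;
     26 ::= K 0 ;;
     ite (V 25) (ite (Ld 9 (V 25) .= V 23) skip (26 ::= K 1 ;; sto 9 (V 25) (V 23))) skip ;;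
     outp 1 (V 29) (V 26) ;;
     outp 2 (V 29) ((V 30 .+ V 31) .= K 0) ;;
     29 ::= V 29 .+ K 1"

text \<open>A \<open>0\<close> taken while entries remain is dropped, since the node then has an
  edge in the union.\<close>

definition merge_body :: prog where
  "merge_body =
     pick_prog False ;; pick_prog True ;;
     ite (V 32 .< V 33) (25 ::= V 32) (25 ::= V 33) ;;
     take_prog False ;; take_prog True ;;
     ite (V 25) emit_prog (ite (V 30 .+ V 31) skip emit_prog)"

text \<open>If the next position continues the block, the copy of the first graph stands in front
  and register 30 is already set.\<close>

definition node_prog :: prog where
  "node_prog =
     24 ::= getb 1 (V 22) ;;
     22 ::= V 22 .+ K 1 ;;
     30 ::= K 1 .- V 24 ;;
     31 ::= V 24 ;;
     ite (V 22 .< V 5) (ite (getb 3 (V 22)) skip (31 ::= K 1 ;; 22 ::= V 22 .+ K 1)) skip"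

definition output_body :: prog where
  "output_body = head_prog ;; node_prog ;; loop (V 30 .+ V 31) merge_body"

definition output_prog :: prog where
  "output_prog =
     20 ::= K 0 ;; 21 ::= K 0 ;; 22 ::= K 0 ;; 29 ::= K 0 ;;
     loop (V 22 .< V 5) output_body"

text \<open>The final \<open>reset_prog\<close> clears the last block of each label, as the output
  uses these cells anew with blocks of order \<open>k - 1\<close>.\<close>

definition merge_prog :: prog where
  "merge_prog = count_all ;; sort_prog ;; init_prog ;; rounds_prog ;; reset_prog ;; output_prog"

definition written :: "(nat \<times> bool \<times> bool) list \<Rightarrow> outs" where
  "written xs = (\<lambda>a i. if a < 3 \<and> i < length xs
     then Some ([fst (xs ! i), of_bool (fst (snd (xs ! i))), of_bool (snd (snd (xs ! i)))] ! a) else None)"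

lemma written_snoc:
  fixes xs :: "(nat \<times> bool \<times> bool) list"
  defines "n \<equiv> length xs"
  shows "(written xs)(0 := (written xs 0)(n := Some c), 1 := (written xs 1)(n := Some (of_bool m)),
      2 := (written xs 2)(n := Some (of_bool l))) = written (xs @ [(c, m, l)])"
proof (rule ext, rule ext)
  fix a i :: nat
  consider "a = 0" | "a = 1" | "a = 2" | "3 \<le> a" by linarith
  then show "((written xs)(0 := (written xs 0)(n := Some c), 1 := (written xs 1)(n := Some (of_bool m)),
      2 := (written xs 2)(n := Some (of_bool l)))) a i = written (xs @ [(c, m, l)]) a i"
    by cases (auto simp: written_def n_def nth_append less_Suc_eq)
qed

text \<open>\<open>m\<close> and \<open>k\<close> are positive, so additive terms count as multiples
  of \<open>m * k\<close>; the coefficients then add up to \<open>400 * L + 1304\<close>.\<close>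

lemma time_sum:
  fixes t t1 t2 t3 t4 t5 t6 m k L :: nat
  assumes "1 \<le> m" and "1 \<le> k" and "t1 \<le> t + m * 24 + 30" and "t2 \<le> t1 + Suc L * (m * 400) + 40"
    and "t3 \<le> t2 + m * 30 + 30" and "t4 \<le> t3 + k * (m * 410) + 10" and "t5 \<le> t4 + m * 40 + 10"
    and "t6 \<le> t5 + m * 260 + 20"
  shows "t6 \<le> t + (L * 400 + 1600) * (m * k)"
proof -
  obtain m' k' where "m = Suc m'" "k = Suc k'" using assms(1,2) by (cases m; cases k) auto
  then show ?thesis using assms(3-) by (simp add: algebra_simps)
qed

section \<open>Merging the entries of one node\<close>

context merge_run
begin

lemma regs_neq [simp]:
  "x < 30 \<or> 31 < x \<Longrightarrow> x \<noteq> ar b" "x < 30 \<or> 31 < x \<Longrightarrow> ar b \<noteq> x"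
  "x < 32 \<or> 33 < x \<Longrightarrow> x \<noteq> cr b" "x < 32 \<or> 33 < x \<Longrightarrow> cr b \<noteq> x"
  "pr b \<noteq> ar b'" "ar b' \<noteq> pr b" "pr b \<noteq> cr b'" "cr b' \<noteq> pr b" "ar b \<noteq> cr b'" "cr b' \<noteq> ar b"
  "ar b = ar b' \<longleftrightarrow> b = b'" "cr b = cr b' \<longleftrightarrow> b = b'" "pr b = pr b' \<longleftrightarrow> b = b'"
  "ar b < 40" "cr b < 40" "pr b < 40"
  by (auto simp: ar_def cr_def pr_def)

lemma entry_at:
  assumes "drop p (g b) = flagged f l @ r" and "l \<noteq> []"
  shows "p < length (g b)" and "g b ! p = (hd l, f (hd l), tl l = [])"
    and "drop (Suc p) (g b) = flagged f (tl l) @ r"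
proof -
  obtain c l' where l: "l = c # l'" using assms(2) by (cases l) auto
  then have d: "drop p (g b) = (c, f c, l' = []) # flagged f l' @ r" using assms(1) by simp
  then show p: "p < length (g b)" by (metis drop_all list.distinct(1) not_le)
  show "g b ! p = (hd l, f (hd l), tl l = [])" "drop (Suc p) (g b) = flagged f (tl l) @ r"
    using d Cons_nth_drop_Suc[OF p] by (auto simp: l)
qed

lemma wp_pick:
  assumes R: "R (ar b) = of_bool (l \<noteq> [])" "R 3 = \<sigma>" and d: "drop (R (pr b)) (g b) = flagged f l @ r"
    and Q: "\<And>t'. t' \<le> t + 6 \<Longrightarrow> Q t' (R(cr b := if l = [] then Suc \<sigma> else hd l)) W X"
  shows "wp (pick_prog b) Q t R W X"
proof -
  have s: "Suc \<sigma> < 2 ^ w" using k by simp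
  show ?thesis
  proof (cases "l = []")
    case True
    show ?thesis
      unfolding pick_prog_def
      by (intro vc) (use True R s Q in auto)
  next
    case False
    note e = entry_at[OF d False]
    show ?thesis
      unfolding pick_prog_def
      by (intro vc) (use False R e Q in auto)
  qed
qed

lemma wp_take:
  assumes R: "R (cr b) = (if l = [] then Suc \<sigma> else hd l)" "R 25 = c" "c \<le> \<sigma>" "R (ar b) = of_bool (l \<noteq> [])"
    and d: "drop (R (pr b)) (g b) = flagged f l @ r"
    and Q: "\<And>t'. t' \<le> t + 15 \<Longrightarrow>
      Q t' (R(ar b := of_bool ((if l \<noteq> [] \<and> hd l = c then tl l else l) \<noteq> []),
        pr b := if l \<noteq> [] \<and> hd l = c then Suc (R (pr b)) else R (pr b))) W X"
  shows "wp (take_prog b) Q t R W X"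
proof (cases "l \<noteq> [] \<and> hd l = c")
  case True
  then have l: "l \<noteq> []" by simp
  note e = entry_at[OF d l]
  have s: "Suc (R (pr b)) < 2 ^ w" using e(1) length_g_le[of b] by simp
  show ?thesis
    unfolding take_prog_def
  proof (intro vc, goal_cases)
    case (1 x y)
    have "x = of_bool (tl l \<noteq> [])" "y = Suc (R (pr b))" using 1 e by auto
    then show ?case using Q[unfolded if_P[OF True]] by simp
  qed (use True R e s in auto)
next
  case False
  then have "R (cr b) \<noteq> R 25" using R by auto
  moreover have "R(ar b := of_bool ((if l \<noteq> [] \<and> hd l = c then tl l else l) \<noteq> []),
      pr b := if l \<noteq> [] \<and> hd l = c then Suc (R (pr b)) else R (pr b)) = R"
    unfolding if_not_P[OF False] R(4)[symmetric] by simp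
  ultimately show ?thesis
    using Q unfolding take_prog_def by (intro vc) simp_all
qed

lemma wp_emit:
  assumes R: "R 25 = c" "c \<le> \<sigma>" "R 23 = blk" "R 29 = length xs" "length xs < length inputs"
      "R 30 = of_bool a0" "R 31 = of_bool a1"
    and X: "X = written xs" and m: "m \<longleftrightarrow> c \<noteq> 0 \<and> W 9 c \<noteq> blk"
    and Q: "\<And>t' z. t' \<le> t + 60 \<Longrightarrow> Q t' (R(26 := z, 29 := Suc (length xs)))
      (W(9 := if c \<noteq> 0 then (W 9)(c := blk) else W 9)) (written (xs @ [(c, m, \<not> a0 \<and> \<not> a1)]))"
  shows "wp emit_prog Q t R W X"
proof -
  have s: "Suc (length xs) < 2 ^ w" "of_bool a0 + of_bool a1 < (2 :: nat) ^ w"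
    using R(5) le_less_trans[OF _ two_less, of "of_bool a0 + of_bool a1"] by (auto simp: of_bool_def)
  let ?X = "(written xs)(0 := (written xs 0)(length xs := Some c))"
  let ?W = "W(9 := if c \<noteq> 0 then (W 9)(c := blk) else W 9)"
  have fin: "wp (outp 1 (V 29) (V 26) ;; outp 2 (V 29) ((V 30 .+ V 31) .= K 0) ;; 29 ::= V 29 .+ K 1) Q t'
      (R(26 := of_bool m)) ?W ?X" if t': "t' \<le> t + 40" for t'
  proof (intro vc, goal_cases)
    case (1 i x i' x' y)
    have eqs: "i = length xs" "x = of_bool m" "i' = length xs" "x' = of_bool (\<not> a0 \<and> \<not> a1)" "y = Suc (length xs)"
      using 1 R by (auto simp: of_bool_def)
    have X': "?X(1 := (?X 1)(i := Some x), 2 := ((?X(1 := (?X 1)(i := Some x))) 2)(i' := Some x')) =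
        written (xs @ [(c, m, \<not> a0 \<and> \<not> a1)])"
      unfolding eqs written_snoc[symmetric] by simp
    show ?case
      unfolding X' using Q[of _ "of_bool m"] t' eqs by simp
  qed (use R s in auto)
  show ?thesis
    unfolding emit_prog_def
  proof (rule wp_seq, rule vc_outp, rule wp_seq, rule vc_asg, rule wp_seq, goal_cases)
    case (1 i x z)
    have eqs: "i = length xs" "x = c" "z = 0" using 1 R by auto
    have X1: "X(0 := (X 0)(i := Some x)) = ?X" using eqs X by simp
    show ?case
      unfolding X1
    proof (rule vc_ite, goal_cases)
      case 1
      then have c: "c \<noteq> 0" using R by simp
      show ?case
      proof (rule vc_ite, goal_cases)
        case 1
        then have eq: "W 9 c = blk" using R by (auto split: if_splits)
        then have "?W = W" "m = False" using c m by (auto simp: fun_eq_iff)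
        with fin show ?case using eqs by (intro wp_skip) simp
      next
        case 2
        then have ne: "W 9 c \<noteq> blk" using R by auto
        with c m have "m" by simp
        show ?case
        proof (rule wp_seq, rule vc_asg, rule vc_sto, goal_cases)
          case (1 x26 i9 x9)
          then have e: "x26 = of_bool m" "i9 = c" "x9 = blk" using R \<open>m\<close> by auto
          show ?case using fin c e by simp
        qed (use R in \<open>auto simp: xb_def\<close>)
      qed (use R in \<open>auto simp: xb_def\<close>)
    next
      case 2
      then have c: "c = 0" using R by simp
      then have "?W = W" "m = False" using m by (auto simp: fun_eq_iff)
      with fin show ?case using eqs by (intro wp_skip) simp
    qed simp
  qed (use R in auto)
qed

definition UE :: "(nat list \<times> nat \<times> bool \<times> bool) list" where
  "UE = union_entries (node_list k CU)"

text \<open>\<open>l b\<close> lists the labels of \<open>u\<close> not yet taken from graph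
  \<open>b\<close>. The output position never exceeds the number of entries read, which bounds it
  without the size of the union.\<close>

definition merge_inv :: "nat list \<Rightarrow> nat \<Rightarrow> (nat \<Rightarrow> nat) \<Rightarrow> mem \<Rightarrow> (bool \<Rightarrow> nat list) \<Rightarrow>
    (nat \<Rightarrow> nat) \<Rightarrow> mem \<Rightarrow> outs \<Rightarrow> bool" where
  "merge_inv u j R W l R' W' X' \<longleftrightarrow>
     (\<forall>x. x \<notin> {20, 21, 25, 26, 29, 30, 31, 32, 33} \<longrightarrow> R' x = R x) \<and>
     (\<forall>b. drop (R' (pr b)) (g b) = flagged (\<lambda>c. minus_bit k (C b) (u, c)) (l b) @ rest_entries b j) \<and>
     (\<forall>b. R' (pr b) \<le> length (g b)) \<and>
     (\<forall>b. R' (ar b) = of_bool (l b \<noteq> [])) \<and>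
     (\<forall>b. sorted_wrt (<) (l b) \<and> (\<forall>c\<in>set (l b). c \<le> \<sigma>)) \<and>
     (\<exists>pre. X' = written (map snd pre) \<and> W' = W(9 := latest (seen_union pre)) \<and> R' 29 = length pre \<and>
        length pre \<le> R' 20 + R' 21 \<and>
        UE = pre @ map (Pair u) (flagged (\<lambda>c. minus_bit k CU (u, c)) (labels_of (set (l False) \<union> set (l True)))) @
          union_entries (rest_nodes j))"

text \<open>Each iteration reads one or two entries and writes at most one; the number of entries
  read measures progress and pays for the time.\<close>

lemma wp_merge_body:
  assumes R: "R 3 = \<sigma>" "R 23 = block (k - 1) (False, u)" and I: "merge_inv u j R W l R' W' X'"
    and ne: "l False \<noteq> [] \<or> l True \<noteq> []"
    and Q: "\<And>t' l' R2 W2 X2. t' \<le> t + 130 \<Longrightarrow> merge_inv u j R W l' R2 W2 X2 \<Longrightarrow>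
      R' 20 + R' 21 < R2 20 + R2 21 \<Longrightarrow> R2 20 + R2 21 \<le> length inputs \<Longrightarrow> Q t' R2 W2 X2"
  shows "wp merge_body Q t R' W' X'"
proof -
  from I have fr: "\<forall>x. x \<notin> {20, 21, 25, 26, 29, 30, 31, 32, 33} \<longrightarrow> R' x = R x"
    and dr: "\<And>b. drop (R' (pr b)) (g b) = flagged (\<lambda>c. minus_bit k (C b) (u, c)) (l b) @ rest_entries b j"
    and act: "\<And>b. R' (ar b) = of_bool (l b \<noteq> [])"
    and p_le: "\<And>b. R' (pr b) \<le> length (g b)"
    and srt: "\<And>b. sorted_wrt (<) (l b)" and le: "\<And>b c. c \<in> set (l b) \<Longrightarrow> c \<le> \<sigma>"
    unfolding merge_inv_def by auto
  from I obtain pre where pre: "X' = written (map snd pre)" "W' = W(9 := latest (seen_union pre))"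
    "R' 29 = length pre" "length pre \<le> R' 20 + R' 21"
    "UE = pre @ map (Pair u) (flagged (\<lambda>c. minus_bit k CU (u, c)) (labels_of (set (l False) \<union> set (l True)))) @
      union_entries (rest_nodes j)"
    unfolding merge_inv_def by blast
  define S where "S = set (l False) \<union> set (l True)"
  define v where "v b = (if l b = [] then Suc \<sigma> else hd (l b))" for b
  define c where "c = (if v False < v True then v False else v True)"
  define l' where "l' b = (if l b \<noteq> [] \<and> hd (l b) = c then tl (l b) else l b)" for b
  have hd: "hd (l b) \<le> x" if "x \<in> set (l b)" for b x
    using that srt[of b] by (cases "l b") auto
  have vS: "v b \<le> \<sigma> \<and> v b \<in> set (l b)" if "l b \<noteq> []" for b
    using that le[of "hd (l b)" b] by (simp add: v_def)
  have c_le: "c \<le> \<sigma>" using ne vS[of False] vS[of True] by (auto simp: c_def v_def)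
  \<comment> \<open>\<open>c \<le> \<sigma>\<close> rules out the sentinel, so \<open>c\<close> is
    the head of one of the lists.\<close>
  have cb: "\<exists>b. l b \<noteq> [] \<and> hd (l b) = c"
  proof -
    have *: "l b \<noteq> [] \<and> hd (l b) = c" if "c = v b" for b using that c_le by (auto simp: v_def split: if_splits)
    have "c = v False \<or> c = v True" by (simp add: c_def)
    with * show ?thesis by blast
  qed
  have cS: "c \<in> S" using cb by (auto simp: S_def) (metis (full_types) hd_in_set)
  have c_min: "\<forall>x\<in>S. c \<le> x"
  proof
    fix x assume "x \<in> S"
    then obtain b where b: "x \<in> set (l b)" by (auto simp: S_def)
    have "c \<le> v b" by (cases b) (auto simp: c_def)
    also have "\<dots> \<le> x" using b hd[OF b] by (auto simp: v_def)
    finally show "c \<le> x" .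
  qed
  have sl': "set (l' b) = set (l b) - {c}" for b
  proof (cases "l b")
    case (Cons x xs)
    have "c \<le> x" using c_min Cons by (cases b) (auto simp: S_def)
    then show ?thesis using Cons srt[of b] by (auto simp: l'_def)
  qed (simp add: l'_def)
  have S': "set (l' False) \<union> set (l' True) = S - {c}" by (auto simp: sl' S_def)
  have emp: "l' False = [] \<and> l' True = [] \<longleftrightarrow> S - {c} = {}" unfolding S'[symmetric] by simp
  note step = labels_of_step[OF _ cS c_min]
  have finS: "finite S" by (simp add: S_def)
  have srt': "sorted_wrt (<) (l' b)" "\<forall>c\<in>set (l' b). c \<le> \<sigma>" for b
    using srt[of b] le[of _ b] by (cases "l b"; auto simp: l'_def)+
  define p' where "p' b = (if l b \<noteq> [] \<and> hd (l b) = c then Suc (R' (pr b)) else R' (pr b))" for b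
  have dr': "drop (p' b) (g b) = flagged (\<lambda>c. minus_bit k (C b) (u, c)) (l' b) @ rest_entries b j" for b
    using dr[of b] entry_at(3)[OF dr[of b]] by (auto simp: p'_def l'_def)
  have p'_le: "p' b \<le> length (g b)" for b
  proof (cases "l b \<noteq> [] \<and> hd (l b) = c")
    case True
    then show ?thesis using entry_at(1)[OF dr[of b]] by (simp add: p'_def)
  next
    case False
    show ?thesis unfolding p'_def if_not_P[OF False] by (rule p_le)
  qed
  have p_sum: "p' False + p' True \<le> length inputs"
    using p'_le[of False] p'_le[of True] by (simp add: inputs_eq)
  have p_less: "R' 20 + R' 21 < p' False + p' True"
  proof -
    have "R' (pr b) \<le> p' b" for b by (simp add: p'_def)
    moreover obtain b where "R' (pr b) < p' b" using cb by (auto simp: p'_def)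
    ultimately have "R' (pr False) + R' (pr True) < p' False + p' True"
      by (cases b) (auto intro: add_less_le_mono add_le_less_mono)
    then show ?thesis by (simp add: pr_def)
  qed
  define R4 where "R4 = R'(cr False := v False, cr True := v True, 25 := c,
    ar False := of_bool (l' False \<noteq> []), pr False := p' False, ar True := of_bool (l' True \<noteq> []), pr True := p' True)"
  have R4: "R4 25 = c" "R4 23 = block (k - 1) (False, u)" "R4 29 = length pre"
    "R4 30 = of_bool (l' False \<noteq> [])" "R4 31 = of_bool (l' True \<noteq> [])" "R4 20 = p' False" "R4 21 = p' True"
    "R4 (pr b) = p' b" "R4 (ar b) = of_bool (l' b \<noteq> [])"
    "x \<notin> {20, 21, 25, 26, 29, 30, 31, 32, 33} \<Longrightarrow> R4 x = R x" for b x
    using fr R pre(3) by (cases b; auto simp: R4_def pr_def ar_def cr_def)+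
  have inv: "merge_inv u j R W l' R2 W2 X2"
    if "\<And>x. x \<notin> {26, 29} \<Longrightarrow> R2 x = R4 x"
      "X2 = written (map snd pre2)" "W2 = W(9 := latest (seen_union pre2))"
      "R2 29 = length pre2" "length pre2 \<le> p' False + p' True"
      "UE = pre2 @ map (Pair u) (flagged (\<lambda>c. minus_bit k CU (u, c)) (labels_of (S - {c}))) @
        union_entries (rest_nodes j)" for R2 W2 X2 pre2
  proof -
    have [simp]: "R2 (pr b) = p' b" "R2 (ar b) = of_bool (l' b \<noteq> [])" for b
      using that(1)[of "pr b"] that(1)[of "ar b"] R4(8,9)[of b] by (auto simp: pr_def ar_def)
    have "R2 x = R x" if "x \<notin> {20, 21, 25, 26, 29, 30, 31, 32, 33}" for x
      using \<open>\<And>x. x \<notin> {26, 29} \<Longrightarrow> R2 x = R4 x\<close>[of x] R4(10)[of x] that by simp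
    moreover have "R2 20 = p' False" "R2 21 = p' True" using that(1)[of 20] that(1)[of 21] R4 by auto
    ultimately show ?thesis
      unfolding merge_inv_def S' using that(2-6) dr' p'_le srt' by auto
  qed
  have sum2: "R2 20 + R2 21 = p' False + p' True" if "\<And>x. x \<notin> {26, 29} \<Longrightarrow> R2 x = R4 x" for R2
    using that[of 20] that[of 21] R4 by auto
  let ?blk = "block (k - 1) (False, u)"
  define m where "m = minus_bit k CU (u, c)"
  \<comment> \<open>An entry is written in two cases: a positive label, or a \<open>0\<close> with
    nothing left.\<close>
  have emit: "wp emit_prog Q t' R4 W' X'" if t': "t' \<le> t + 65" and em: "\<not> (c = 0 \<and> S - {c} \<noteq> {})" for t'
  proof -
    have UE: "UE = pre @ (u, c, m, S - {c} = {}) #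
        map (Pair u) (flagged (\<lambda>c. minus_bit k CU (u, c)) (labels_of (S - {c}))) @ union_entries (rest_nodes j)"
      using pre(5) em step[OF finS] labels_of_eq_Nil[of "S - {c}"] finS
      unfolding S_def[symmetric] if_not_P[OF em] by (auto simp: m_def)
    have m: "m \<longleftrightarrow> c \<noteq> 0 \<and> W' 9 c \<noteq> ?blk"
    proof (cases "c = 0")
      case True
      then show ?thesis
        using arc_label[OF CU_facts, of u 0] by (auto simp: m_def minus_bit_iff[OF CU_facts])
    next
      case False
      with union_minus[OF UE[unfolded UE_def] False] show ?thesis by (simp add: pre(2))
    qed
    show ?thesis
    proof (rule wp_emit[where c = c and m = m and blk = ?blk and xs = "map snd pre" and
          ?a0.0 = "l' False \<noteq> []" and ?a1.0 = "l' True \<noteq> []"], goal_cases)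
      case (10 t'' z)
      let ?pre = "pre @ [(u, c, m, S - {c} = {})]"
      have seen: "latest (seen_union ?pre) = (if c \<noteq> 0 then (latest (seen_union pre))(c := ?blk) else latest (seen_union pre))"
        by (simp add: seen_union_def)
      show ?case
      proof (rule Q[where l' = l'], goal_cases)
        case 1
        then show ?case using 10 t' by simp
      next
        case 2
        show ?case
          by (rule inv[where ?pre2.0 = ?pre])
            (use UE emp seen pre p_less in \<open>auto simp: fun_eq_iff\<close>)
      qed (use sum2[of "R4(26 := z, 29 := Suc (length (map snd pre)))"] p_less p_sum in auto)
    qed (use R4 c_le m pre p_less p_sum in auto)
  qed
  show ?thesis
    unfolding merge_body_def
  proof (rule wp_seq, rule wp_pick[where b = False and l = "l False" and r = "rest_entries False j" and
          f = "\<lambda>c. minus_bit k (C False) (u, c)"], goal_cases)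
    case (4 t1)
    note 3 = 4
    show ?case
    proof (rule wp_seq, rule wp_pick[where b = True and l = "l True" and r = "rest_entries True j" and
          f = "\<lambda>c. minus_bit k (C True) (u, c)"], goal_cases)
      case (4 t2)
      let ?R2 = "R'(cr False := v False, cr True := v True)"
      have 24: "wp (take_prog False ;; take_prog True ;; ite (V 25) emit_prog (ite (V 30 .+ V 31) skip emit_prog)) Q t3
        (?R2(25 := c)) W' X'" if t3: "t3 \<le> t2 + 10" for t3
      proof (rule wp_seq, rule wp_take[where b = False and c = c and l = "l False" and r = "rest_entries False j" and
          f = "\<lambda>c. minus_bit k (C False) (u, c)"], goal_cases)
        case (6 t4)
        show ?case
        proof (rule wp_seq, rule wp_take[where b = True and c = c and l = "l True" and r = "rest_entries True j" and
            f = "\<lambda>c. minus_bit k (C True) (u, c)"], goal_cases)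
          case (6 t5)
          have t5: "t5 \<le> t + 55" using 3 4 t3 \<open>t4 \<le> _\<close> 6 by simp
          have "wp (ite (V 25) emit_prog (ite (V 30 .+ V 31) skip emit_prog)) Q t5 R4 W' X'"
          proof (rule vc_ite, goal_cases)
            case 1
            then show ?case using emit t5 R4(1) by simp
          next
            case 2
            then have c0: "c = 0" using R4(1) by simp
            show ?case
            proof (rule vc_ite, goal_cases)
              case 1
              then have nS: "S - {c} \<noteq> {}" using R4(4,5) emp by (auto split: if_splits)
              \<comment> \<open>Removing the \<open>0\<close> does not change
                \<open>labels_of\<close>, so the written prefix stays as it is.\<close>
              have "UE = pre @ map (Pair u) (flagged (\<lambda>c. minus_bit k CU (u, c)) (labels_of (S - {c}))) @
                  union_entries (rest_nodes j)"
                using pre(5) step[OF finS] c0 nS unfolding S_def[symmetric] by simp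
              then have "merge_inv u j R W l' R4 W' X'"
                by (intro inv) (use pre R4 p_less in auto)
              then show ?case
                by (intro wp_skip Q) (use t5 R4 p_less p_sum in auto)
            next
              case 2
              then have "S - {c} = {}" using R4(4,5) emp by (auto split: if_splits)
              then show ?case using emit t5 by simp
            next
              case 3
              have "of_bool (l' False \<noteq> []) + of_bool (l' True \<noteq> []) < (2 :: nat) ^ w"
                by (rule le_less_trans[OF _ two_less]) (simp add: of_bool_def)
              then show ?case using R4(4,5) by simp
            qed
          qed simp
          then show ?case
            by (rule back_subst[where P = "\<lambda>R. wp (ite (V 25) emit_prog (ite (V 30 .+ V 31) skip emit_prog)) Q t5 R W' X'"])
              (simp add: R4_def l'_def p'_def)
        qed (use act dr c_le v_def in auto)
      qed (use act dr c_le v_def in auto)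
      show ?case
      proof (rule wp_seq, rule vc_ite, goal_cases)
        case 1
        then have "c = v False" by (auto simp: c_def v_def cr_def split: if_splits)
        then show ?case using 24 by (intro vc_asg) (auto simp: cr_def v_def)
      next
        case 2
        then have "c = v True" by (auto simp: c_def v_def cr_def split: if_splits)
        then show ?case using 24 by (intro vc_asg) (auto simp: cr_def v_def)
      qed simp
    qed (use act dr fr R in auto)
  qed (use act fr R dr in auto)
qed

section \<open>Walking through the nodes of the union\<close>

lemma block_members:
  assumes "i < num" and "boundary i"
  shows "Suc i < num \<and> \<not> starts (kl k) (Suc i) \<Longrightarrow> \<not> fst (M k ! i) \<and> snd (M k ! i) \<in> nodes k (C b)"
    and "\<not> (Suc i < num \<and> \<not> starts (kl k) (Suc i)) \<Longrightarrow> snd (M k ! i) \<in> nodes k (C b) \<longleftrightarrow> b = fst (M k ! i)"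
proof -
  define u where "u = snd (M k ! i)"
  {
    assume a: "Suc i < num \<and> \<not> starts (kl k) (Suc i)"
    then have p: "M k ! i = (False, u)" "M k ! Suc i = (True, u)" using M_pair[of i] by (simp_all add: u_def)
    have "M k ! i \<in> set (M k)" "M k ! Suc i \<in> set (M k)" using a by simp_all
    then have "u \<in> nodes k (C False)" "u \<in> nodes k (C True)"
      unfolding p by (simp_all add: set_M)
    then show "\<not> fst (M k ! i) \<and> snd (M k ! i) \<in> nodes k (C b)" using arg_cong[OF p(1), of fst] unfolding u_def[symmetric] by (cases b) simp_all
  next
    assume a: "\<not> (Suc i < num \<and> \<not> starts (kl k) (Suc i))"
    then have "block_end i = Suc i" by (simp add: block_end_def)
    moreover have "drop i (M k) = M k ! i # drop (Suc i) (M k)" using assms(1) by (simp add: Cons_nth_drop_Suc)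
    ultimately have "map (\<lambda>b. (b, u)) (filter (\<lambda>b. u \<in> nodes k (C b)) [False, True]) = [M k ! i]"
      using drop_block[OF assms] by (simp add: u_def)
    then have "map fst (map (\<lambda>b. (b, u)) (filter (\<lambda>b. u \<in> nodes k (C b)) [False, True])) = [fst (M k ! i)]"
      by (simp only: list.map)
    then have "filter (\<lambda>b. u \<in> nodes k (C b)) [False, True] = [fst (M k ! i)]" by (simp add: comp_def)
    then have "set (filter (\<lambda>b. u \<in> nodes k (C b)) [False, True]) = {fst (M k ! i)}" by (simp only: list.set)
    then show "snd (M k ! i) \<in> nodes k (C b) \<longleftrightarrow> b = fst (M k ! i)"
      unfolding u_def[symmetric] by (cases b) (auto split: if_splits)
  }
qed

lemma wp_node:
  assumes R: "R 4 = w" "R 5 = num" "R 22 = i" and i: "i < num" "boundary i"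
    and Z: "bits (W 1) (ZS k)" and B: "bits (W 3) (BS k)"
    and Q: "\<And>t' R'. t' \<le> t + 60 \<Longrightarrow> (\<forall>x. x \<notin> {22, 24, 30, 31} \<longrightarrow> R' x = R x) \<Longrightarrow> R' 22 = block_end i \<Longrightarrow>
      (\<forall>b. R' (ar b) = of_bool (snd (M k ! i) \<in> nodes k (C b))) \<Longrightarrow> Q t' R' W X"
  shows "wp node_prog Q t R W X"
proof -
  let ?b = "fst (M k ! i)"
  have z: "drop_bit (i mod w) (W 1 (i div w)) mod 2 = of_bool ?b"
    using bits_get[OF Z, of i] i by (simp add: ZS_def)
  have Suc_i: "Suc i < 2 ^ w" using i(1) num_le by simp
  show ?thesis
    unfolding node_prog_def
  proof (rule wp_seq, rule vc_asg, rule wp_seq, rule vc_asg, rule wp_seq, rule vc_asg, rule wp_seq, rule vc_asg, goal_cases)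
    case (1 x24 x22 x30 x31)
    have eqs: "x24 = of_bool ?b" "x22 = Suc i" "x30 = 1 - of_bool ?b" "x31 = of_bool ?b"
      using 1 R z by auto
    let ?R = "R(24 := x24, 22 := x22, 30 := x30, 31 := x31)"
    have s: "drop_bit (Suc i mod w) (W 3 (Suc i div w)) mod 2 = of_bool (starts (kl k) (Suc i))" if "Suc i < num"
      using bits_get[OF B, of "Suc i"] that by (simp add: BS_def)
    have single: "Q t' ?R W X" if "t' \<le> t + 60" "\<not> (Suc i < num \<and> \<not> starts (kl k) (Suc i))" for t'
    proof (rule Q[OF that(1)])
      show "?R 22 = block_end i" using that(2) eqs by (simp add: block_end_def)
      show "\<forall>b. ?R (ar b) = of_bool (snd (M k ! i) \<in> nodes k (C b))"
        unfolding block_members(2)[OF i that(2)] using eqs by (auto simp: ar_def)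
    qed auto
    show ?case
    proof (rule vc_ite, goal_cases)
      case 1
      then have lt: "Suc i < num" using eqs R by (simp split: if_splits)
      then have ss: "Suc (Suc i) < 2 ^ w" using num_le k by simp
      show ?case
      proof (rule vc_ite, goal_cases)
        case 1
        then have "starts (kl k) (Suc i)" using s[OF lt] eqs R by (auto split: if_splits)
        then show ?case by (intro wp_skip single) simp_all
      next
        case 2
        then have ns: "\<not> starts (kl k) (Suc i)" using s[OF lt] eqs R by (auto split: if_splits)
        note mem = block_members(1)[OF i conjI[OF lt ns]]
        show ?case
        proof (rule wp_seq, rule vc_asg, rule vc_asg, goal_cases)
          case (1 y31 y22)
          have y: "y31 = 1" "y22 = Suc (Suc i)" using 1 eqs by auto
          show ?case
          proof (rule Q, goal_cases)
            case 3
            show ?case using y lt ns by (simp add: block_end_def)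
          next
            case 4
            show ?case using y eqs mem by (auto simp: ar_def)
          qed (simp, auto)
        qed (use ss eqs in auto)
      qed (use R eqs div_less_nw[OF lt] in \<open>auto simp: xb_def\<close>)
    next
      case 2
      then have "\<not> Suc i < num" using eqs R by (simp split: if_splits)
      then show ?case by (intro wp_skip single) simp_all
    qed simp
  qed (use R z i(1) Suc_i div_less_nw[OF i(1)] in \<open>auto simp: xb_def\<close>)
qed

lemma block_snd: "block h (b, u) = block h (b', u)"
  by (simp add: block_def kt_def)

text \<open>Nodes differ in their number of entries, so no constant bounds the time of each; instead
  140 units are charged to every entry read and 120 to every merged node passed.\<close>

definition out_inv :: "nat \<Rightarrow> (nat \<Rightarrow> nat) \<Rightarrow> mem \<Rightarrow> nat \<Rightarrow> (nat \<Rightarrow> nat) \<Rightarrow> mem \<Rightarrow> outs \<Rightarrow> bool" where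
  "out_inv t0 R W t R' W' X' \<longleftrightarrow>
     (\<forall>x. x \<notin> {20, 21, 22, 23, 24, 25, 26, 29, 30, 31, 32, 33} \<longrightarrow> R' x = R x) \<and>
     boundary (R' 22) \<and>
     (\<forall>b. drop (R' (pr b)) (g b) = rest_entries b (R' 22)) \<and>
     (\<forall>b. R' (pr b) \<le> length (g b)) \<and>
     (R' 22 < num \<and> \<not> starts (kl (k - 1)) (R' 22) \<longrightarrow> R' 23 = block (k - 1) (M k ! R' 22)) \<and>
     (\<exists>pre. X' = written (map snd pre) \<and> W' = W(9 := latest (seen_union pre)) \<and> R' 29 = length pre \<and>
        length pre \<le> R' 20 + R' 21 \<and> UE = pre @ union_entries (rest_nodes (R' 22))) \<and>
     t \<le> t0 + (R' 20 + R' 21) * 140 + R' 22 * 120"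

lemma wp_output_body:
  assumes R: "R 3 = \<sigma>" "R 4 = w" "R 5 = num"
    and W: "bits (W 1) (ZS k)" "bits (W 2) (BS (k - 1))" "bits (W 3) (BS k)"
    and I: "out_inv t0 R W t R' W' X'" and i: "R' 22 < num"
    and Q: "\<And>t' R2 W2 X2. out_inv t0 R W t' R2 W2 X2 \<Longrightarrow> R' 22 < R2 22 \<Longrightarrow> Q t' R2 W2 X2"
  shows "wp output_body Q (t + 4) R' W' X'"
proof -
  define i where "i = R' 22"
  define u where "u = snd (M k ! i)"
  define j where "j = block_end i"
  from I obtain pre where fr: "\<forall>x. x \<notin> {20, 21, 22, 23, 24, 25, 26, 29, 30, 31, 32, 33} \<longrightarrow> R' x = R x"
    and bd: "boundary i" and dr: "\<And>b. drop (R' (pr b)) (g b) = rest_entries b i"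
    and p_le: "\<And>b. R' (pr b) \<le> length (g b)"
    and blk: "\<not> starts (kl (k - 1)) i \<Longrightarrow> R' 23 = block (k - 1) (M k ! i)"
    and pre: "X' = written (map snd pre)" "W' = W(9 := latest (seen_union pre))" "R' 29 = length pre"
      "length pre \<le> R' 20 + R' 21" "UE = pre @ union_entries (rest_nodes i)"
    and t: "t \<le> t0 + (R' 20 + R' 21) * 140 + i * 120"
    using i unfolding out_inv_def i_def[symmetric] by blast
  have i_less: "i < num" using i by (simp add: i_def)
  have j: "i < j" "boundary j" using boundary_block_end[OF i_less] by (simp_all add: j_def block_end_def)
  have Mi: "M k ! i \<in> set (M k)" using i_less by simp
  then have u_in: "u \<in> nodes k (C (fst (M k ! i)))" by (auto simp: set_M u_def)
  then have uCU: "u \<in> nodes k CU" by (auto simp: nodes_CU)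
  have nl: "node_labels b u \<noteq> [] \<longleftrightarrow> u \<in> nodes k (C b)" for b
    using node_W_nonempty[OF graph_facts fin] by (simp add: node_labels_def)
  have blk_u: "block (k - 1) (M k ! i) = block (k - 1) (False, u)"
    using block_snd[of "k - 1" "fst (M k ! i)" u False] by (simp add: u_def)
  \<comment> \<open>In a block of two the second copy equals the first and lies in the same block of
    order \<open>k - 1\<close>, from which position \<open>j\<close> inherits it.\<close>
  have blk_j: "block (k - 1) (False, u) = block (k - 1) (M k ! j)" if "j < num" "\<not> starts (kl (k - 1)) j"
  proof (cases "Suc i < num \<and> \<not> starts (kl k) (Suc i)")
    case True
    then have "j = Suc (Suc i)" by (simp add: j_def block_end_def)
    with that have "block (k - 1) (M k ! j) = block (k - 1) (M k ! Suc i)"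
      using block_not_starts[of "k - 1" k "Suc i"] by simp
    moreover have "M k ! Suc i = (True, u)" using M_pair(2)[of i] True by (simp add: u_def)
    ultimately show ?thesis using block_snd by metis
  next
    case False
    then have "j = Suc i" by (auto simp: j_def block_end_def)
    with that have "block (k - 1) (M k ! j) = block (k - 1) (M k ! i)"
      using block_not_starts[of "k - 1" k i] by simp
    with blk_u show ?thesis by simp
  qed
  show ?thesis
    unfolding output_body_def
  proof (rule wp_seq, rule wp_head[where i = i and h = "k - 1" and h' = k], goal_cases)
    case (7 t1)
    note t1 = 7(1)
    show ?case
    proof (rule wp_seq, rule wp_node[where i = i], goal_cases)
      case (8 t2 R2)
      note t2 = 8(1)
      have R2: "R2 x = R' x" if "x \<notin> {22, 23, 24, 30, 31}" for x using 8(2) that by auto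
      have R2b: "R2 23 = block (k - 1) (False, u)" using 8(2) blk_u by auto
      have R2pr: "R2 (pr b) = R' (pr b)" for b by (rule R2) (cases b; simp add: pr_def)
      have mi0: "merge_inv u j R2 W (\<lambda>b. node_labels b u) R2 W' X'"
        unfolding merge_inv_def
      proof (intro conjI, goal_cases)
        case 2
        show ?case using rest_entries_step[OF i_less bd] dr R2pr by (simp add: u_def j_def)
      next
        case 3
        show ?case using p_le R2pr by simp
      next
        case 4
        show ?case using 8(4) nl by (simp add: u_def)
      next
        case 5
        show ?case using node_W_le[OF graph_facts fin] sorted_node_W by (auto simp: node_labels_def)
      next
        case 6
        have "union_entries (rest_nodes i) = map (Pair u) (node_entries k CU u) @ union_entries (rest_nodes j)"
          using rest_nodes_step[OF i_less bd] by (simp add: union_entries_def u_def j_def)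
        then show ?case
          using pre R2 by (intro exI[of _ pre]) (simp add: node_entries_def node_W_CU[OF uCU])
      qed simp
      show ?case
      proof (rule wp_while[where \<mu> = "\<lambda>R3. length inputs - (R3 20 + R3 21)" and
            I = "\<lambda>t3 R3 W3 X3. \<exists>l. merge_inv u j R2 W l R3 W3 X3 \<and> R3 20 + R3 21 \<le> length inputs \<and>
              t3 + (R' 20 + R' 21) * 140 \<le> t2 + (R3 20 + R3 21) * 140"], goal_cases)
        case 1
        have "R2 20 + R2 21 \<le> length inputs"
          using p_le[of False] p_le[of True] R2 by (simp add: pr_def inputs_eq)
        then show ?case using mi0 R2 by auto
      next
        case (2 t3 R3 W3 X3)
        then obtain l where "merge_inv u j R2 W l R3 W3 X3" by blast
        then have "R3 (ar False) = of_bool (l False \<noteq> [])" "R3 (ar True) = of_bool (l True \<noteq> [])"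
          unfolding merge_inv_def by blast+
        moreover have "of_bool (l False \<noteq> []) + of_bool (l True \<noteq> []) < (2 :: nat) ^ w"
          by (rule le_less_trans[OF _ two_less]) (simp add: of_bool_def)
        ultimately show ?case by (simp add: ar_def)
      next
        case (3 t3 R3 W3 X3)
        then obtain l where l: "merge_inv u j R2 W l R3 W3 X3" "R3 20 + R3 21 \<le> length inputs"
          "t3 + (R' 20 + R' 21) * 140 \<le> t2 + (R3 20 + R3 21) * 140" by blast
        have "R3 (ar False) = of_bool (l False \<noteq> [])" "R3 (ar True) = of_bool (l True \<noteq> [])"
          using l(1) unfolding merge_inv_def by blast+
        with 3(2) have ne: "l False \<noteq> [] \<or> l True \<noteq> []" by (auto simp: ar_def)
        show ?case
        proof (rule wp_merge_body[OF _ R2b l(1) ne], goal_cases)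
          case 1
          show ?case using R2 fr R by simp
        next
          case (2 t4 l' R4 W4 X4)
          then show ?case using l(3) by (auto intro!: exI[of _ l'])
        qed
      next
        case (4 t3 R3 W3 X3)
        then obtain l where l: "merge_inv u j R2 W l R3 W3 X3" "R3 20 + R3 21 \<le> length inputs"
          "t3 + (R' 20 + R' 21) * 140 \<le> t2 + (R3 20 + R3 21) * 140" by blast
        have ar: "R3 (ar False) = of_bool (l False \<noteq> [])" "R3 (ar True) = of_bool (l True \<noteq> [])"
          using l(1) unfolding merge_inv_def by blast+
        have "l False = [] \<and> l True = []" using 4(2) ar by (simp add: ar_def split: if_splits)
        then have l0: "l b = []" for b by (cases b) auto
        have R3: "R3 x = R2 x" if "x \<notin> {20, 21, 25, 26, 29, 30, 31, 32, 33}" for x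
          using l(1) that unfolding merge_inv_def by blast
        have R3': "R3 22 = j" "R3 23 = block (k - 1) (False, u)" using R3 8(3) R2b by (auto simp: j_def)
        show ?case
        proof (rule Q)
          show "R' 22 < R3 22" using R3' j by (simp add: i_def)
          show "out_inv t0 R W (t3 + (cost (V 30 .+ V 31) + 1)) R3 W3 X3"
            unfolding out_inv_def R3'
          proof (intro conjI, goal_cases)
            case 1
            show ?case using R3 R2 fr by auto
          next
            case 3
            show ?case using l(1) unfolding merge_inv_def l0 by simp
          next
            case 4
            show ?case using l(1) unfolding merge_inv_def by blast
          next
            case 6
            show ?case using l(1) unfolding merge_inv_def l0 by simp
          next
            case 7
            show ?case using l(3) t t1 t2 j(1) by simp
          qed (use j(2) blk_j in auto)
        qed
      qed
    qed (use R fr i_less bd W pre i_def in auto)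
  qed (use R fr i_less W pre blk i_def in auto)
qed

lemma wp_output:
  assumes R: "R 3 = \<sigma>" "R 4 = w" "R 5 = num"
    and W: "bits (W 1) (ZS k)" "bits (W 2) (BS (k - 1))" "bits (W 3) (BS k)" "W 9 = (\<lambda>_. 0)"
    and X: "X = written []"
    and Q: "\<And>t' R' W'. t' \<le> t + length inputs * 260 + 20 \<Longrightarrow> Q t' R' W' (written (graph_entries k CU))"
  shows "wp output_prog Q t R W X"
  unfolding output_prog_def
proof (rule wp_seq, rule vc_asg, rule wp_seq, rule vc_asg, rule wp_seq, rule vc_asg, rule wp_seq, rule vc_asg, goal_cases)
  case (1 x20 x21 x22 x29)
  have x: "x20 = 0" "x21 = 0" "x22 = 0" "x29 = 0" using 1 by simp_all
  show ?case
  \<comment> \<open>The 8 units are those of the four assignments before the loop.\<close>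
  proof (rule wp_while[where \<mu> = "\<lambda>R'. num - R' 22" and I = "out_inv (t + 8) R W"], goal_cases)
    case 1
    have W': "W = W(9 := latest (seen_union []))" using W(4) by (auto simp: fun_eq_iff seen_union_def)
    have "UE = [] @ union_entries (rest_nodes 0)" by (simp add: UE_def rest_nodes_0)
    moreover have "boundary 0" using num_pos by (simp add: boundary_def)
    ultimately show ?case
      unfolding out_inv_def using x X W'
      by (auto simp: pr_def rest_entries_0 g_def intro!: exI[of _ "[]"])
  next
    case (2 t' R' W' X')
    then have "R' 5 = R 5" by (auto simp: out_inv_def)
    then show ?case by simp
  next
    case (3 t' R' W' X')
    then have "R' 5 = R 5" by (auto simp: out_inv_def)
    then have i: "R' 22 < num" using 3(2) R by (simp split: if_splits)
    have c: "t' + (cost (V 22 .< V 5) + 1) = t' + 4" by simp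
    show ?case
      unfolding c by (rule wp_output_body[OF R W(1-3) 3(1) i]) (use i in auto)
  next
    case (4 t' R' W' X')
    then have "R' 5 = R 5" by (auto simp: out_inv_def)
    then have "\<not> R' 22 < num" using 4(2) R by (simp split: if_splits)
    moreover have "R' 22 \<le> num" using 4(1) by (simp add: out_inv_def boundary_def)
    ultimately have n: "R' 22 = num" by simp
    obtain pre where "X' = written (map snd pre)" "UE = pre @ union_entries (rest_nodes num)"
      using 4(1) unfolding out_inv_def n by blast
    moreover have "rest_nodes num = []" by (simp add: rest_nodes_def)
    ultimately have X': "X' = written (graph_entries k CU)"
      by (simp add: union_entries_def UE_def map_snd_union_entries[symmetric])
    have "R' (pr False) \<le> length (g False)" "R' (pr True) \<le> length (g True)"
      using 4(1) unfolding out_inv_def by blast+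
    then have "R' 20 + R' 21 \<le> length inputs" by (simp add: pr_def inputs_eq)
    moreover have "t' \<le> t + 8 + (R' 20 + R' 21) * 140 + num * 120"
      using 4(1) unfolding out_inv_def n by simp
    \<comment> \<open>There are no more nodes than entries, so the charges of 140 and 120 give 260
      per entry.\<close>
    ultimately have "t' + 4 \<le> t + length inputs * 260 + 20" using num_le by simp
    then show ?case unfolding X' by (intro Q) simp
  qed
qed simp_all

section \<open>Total time and space\<close>

lemma wp_merge_prog:
  assumes p: "params R" and R5: "R 5 = 0" and W: "W = (\<lambda>_ _. 0)" and X: "X = (\<lambda>_ _. None)"
    and L: "w ^ L \<le> \<sigma>" "\<sigma> < w ^ Suc L"
    and Q: "\<And>t' R' W'. t' \<le> t + (L * 400 + 1600) * (length inputs * k) \<Longrightarrow>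
      Q t' R' W' (written (graph_entries k CU))"
  shows "wp merge_prog Q t R W X"
  unfolding merge_prog_def
proof (rule wp_seq, rule wp_count_all[OF p R5 W], goal_cases)
  case (1 t1 R1)
  show ?case
  proof (rule wp_seq, rule wp_sort[where L = L], goal_cases)
    case (6 t2 R2 W2)
    have k2: "R2 x = R1 x" if "x < 8" for x using 6(2) that by (simp add: keeps_def)
    have W2: "W2 a = (W(4 := cnt)) a" if "a \<notin> {5, 6, 7}" for a using 6(2) that by (simp add: keeps_def)
    have R2: "R2 4 = w" "R2 5 = num" "R2 6 = length (filter (snd \<circ> snd) (g False))" "R2 7 = nw" "params R2"
      using 1 k2 by (auto simp: counted_def params_def)
    have base2: "base R' W'" if "\<And>x. x \<le> 8 \<Longrightarrow> R' x = R2 x" "W' 4 = W2 4" "W' 6 = W2 6" for R' W'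
      using R2 6(3,4) W2[of 4] that(1)[of 0] that(1)[of 1] that(1)[of 2] that(1)[of 3] that(1)[of 4]
        that(1)[of 5] that(1)[of 7] that(1)[of 8] that(2,3)
      by (simp add: base_def counted_def params_def)
    show ?case
    proof (rule wp_seq, rule wp_init, goal_cases)
      case (6 t3 f1 f3)
      show ?case
      proof (rule wp_seq, rule wp_rounds, goal_cases)
        case (1 R3)
        have "base R3 (W2(1 := f1, 3 := f3))" by (rule base2) (use 1 in auto)
        then show ?case
          unfolding round_inv_def using 1 6 W2[of 0] W2[of 2] W2[of 9] W by (simp add: bits_zero)
      next
        case (2 t4 R4 W4)
        then have r: "base R4 W4" "bits (W4 1) (ZS k)" "bits (W4 3) (BS k)" "bits (W4 2) (BS (k - 1))"
          "\<And>c. c \<notin> labels \<Longrightarrow> W4 9 c = 0"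
          using k by (auto simp: round_inv_def)
        show ?case
        proof (rule wp_seq, rule wp_reset[OF r(1) r(5)], goal_cases)
          case (2 t5 z y f)
          show ?case
          proof (rule wp_output, goal_cases)
            case (9 t6 R6 W6)
            have "1 \<le> length inputs" using num_pos num_le by linarith
            from time_sum[OF this k \<open>t1 \<le> _\<close> \<open>t2 \<le> _\<close> \<open>t3 \<le> _\<close> \<open>t4 \<le> _\<close> \<open>t5 \<le> _\<close> 9]
            show ?case by (rule Q)
          qed (use r base_regs[OF r(1)] X in \<open>auto simp: written_def\<close>)
        qed auto
      qed
    qed (use R2 W2[of 1] W2[of 3] W in auto)
  qed (use 1 L W in \<open>auto simp: counted_def\<close>)
qed

end

lemma finite_prog_arrays: "finite (prog_arrays P)"
proof -
  have "finite (instr_arrays i)" for i by (cases i) auto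
  then show ?thesis by (induction P) auto
qed

lemma output_is_written:
  assumes "1 \<le> k" and "\<forall>s\<in>C. set s \<subseteq> {1..\<sigma>}" and "finite C" and "out s = written (graph_entries k C)"
  shows "output_is s (boss_arrays (BOSS k C))"
  unfolding output_is_def assms(4) boss_arrays_eq[OF assms(1-3)]
proof (intro allI)
  fix a i :: nat
  consider "a = 0" | "a = 1" | "a = 2" | "3 \<le> a" by linarith
  then show "written (graph_entries k C) a i =
    (if a < length [map fst (graph_entries k C), map (of_bool \<circ> fst \<circ> snd) (graph_entries k C),
          map (of_bool \<circ> snd \<circ> snd) (graph_entries k C)] \<and>
        i < length ([map fst (graph_entries k C), map (of_bool \<circ> fst \<circ> snd) (graph_entries k C),
          map (of_bool \<circ> snd \<circ> snd) (graph_entries k C)] ! a)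
     then Some ([map fst (graph_entries k C), map (of_bool \<circ> fst \<circ> snd) (graph_entries k C),
          map (of_bool \<circ> snd \<circ> snd) (graph_entries k C)] ! a ! i) else None)"
    by cases (auto simp: written_def)
qed

lemma (in merge_run) merges:
  assumes \<sigma>: "1 \<le> \<sigma>" "\<sigma> \<le> w ^ c"
  shows "merges_within merge_prog w \<sigma> k (BOSS k (C False)) (BOSS k (C True)) (BOSS k CU)
    ((c * 400 + 1600) * (length inputs * k)) (4 * num + (card (prog_regs merge_prog) + 22) * \<sigma> * w)"
proof -
  obtain L where L: "w ^ L \<le> \<sigma>" "\<sigma> < w ^ Suc L"
    using ex_power_ivl1[of w \<sigma>] w_ge \<sigma>(1) by auto
  have "w ^ L \<le> w ^ c" by (rule le_trans[OF L(1) \<sigma>(2)])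
  \<comment> \<open>The depth of the trie is bounded by the exponent alone, which makes the constant
    of the time independent of \<open>w\<close> and \<open>\<sigma>\<close>.\<close>
  then have Lc: "L \<le> c" by (rule power_le_imp_le_exp[rotated]) simp
  have lenW: "length (boss_W (BOSS k (C b))) = length (g b)" for b
    using arg_cong[OF boss_arrays_eq[OF graph_facts fin, of b], of hd]
    by (simp add: boss_arrays_def g_def)
  let ?s0 = "init_state [length (boss_W (BOSS k (C False))), length (boss_W (BOSS k (C True))), k, \<sigma>, w]"
  have "wp merge_prog (\<lambda>t R W X. t \<le> (c * 400 + 1600) * (length inputs * k) \<and> X = written (graph_entries k CU))
    0 (regs ?s0) (work ?s0) (out ?s0)"
  proof (rule wp_merge_prog[OF _ _ _ _ L], goal_cases)
    case 1
    show ?case by (simp add: params_def init_state_def lenW)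
  next
    case (5 t' R' W')
    have "(L * 400 + 1600) * (length inputs * k) \<le> (c * 400 + 1600) * (length inputs * k)"
      using Lc by (intro mult_le_mono) auto
    moreover have "t' \<le> (L * 400 + 1600) * (length inputs * k)" using 5 by simp
    ultimately show ?case using le_trans by blast
  qed (simp_all add: init_state_def)
  moreover have "fits ?s0" by (simp add: fits_def init_state_def)
  ultimately obtain t s where ts: "exec w inp merge_prog ?s0 t s" "fits s"
    "t \<le> (c * 400 + 1600) * (length inputs * k)" "out s = written (graph_entries k CU)"
    unfolding wp_def by force
  have "(\<Sum>a\<in>prog_arrays merge_prog. extent s a) \<le> (\<Sum>a\<in>prog_arrays merge_prog. xb a)"
    using ts(2) by (intro sum_mono) (simp add: fits_def)
  also have "\<dots> = (\<Sum>a\<in>prog_arrays merge_prog \<inter> {..<10}. xb a)"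
    by (rule sum.mono_neutral_right) (auto simp: finite_prog_arrays xb_def)
  also have "\<dots> \<le> (\<Sum>a<10. xb a)"
    by (rule sum_mono2) auto
  also have "\<dots> = 4 * nw + 6 * (\<sigma> + 2)"
    by (simp add: xb_def eval_nat_numeral)
  finally have e: "(\<Sum>a\<in>prog_arrays merge_prog. extent s a) \<le> 4 * nw + 6 * (\<sigma> + 2)" .
  \<comment> \<open>Rounding up to whole words costs at most one word per bitvector.\<close>
  have wnw: "w * nw \<le> num + w"
  proof -
    have "w * ((num - 1) div w) \<le> num - 1" by (rule times_div_less_eq_dividend)
    then have "w * ((num - 1) div w) \<le> num" by linarith
    then show ?thesis by (simp add: nw_def algebra_simps)
  qed
  have "work_bits w merge_prog s \<le> w * (card (prog_regs merge_prog) + (4 * nw + 6 * (\<sigma> + 2)))"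
    unfolding work_bits_def using e by (intro mult_le_mono2 add_left_mono)
  also have "\<dots> = 4 * (w * nw) + (card (prog_regs merge_prog) + 6 * (\<sigma> + 2)) * w"
    by (simp add: algebra_simps)
  also have "\<dots> \<le> 4 * (num + w) + (card (prog_regs merge_prog) + 6 * (\<sigma> + 2)) * w"
    using wnw by simp
  \<comment> \<open>The 16 words are two further cells in each of six arrays and one word of
    rounding for each of four bitvectors; a positive \<open>\<sigma>\<close> lets a multiple of
    \<open>\<sigma>\<close> absorb them.\<close>
  also have "\<dots> = 4 * num + (card (prog_regs merge_prog) + 16 + 6 * \<sigma>) * w"
    by (simp add: algebra_simps)
  also have "\<dots> \<le> 4 * num + ((card (prog_regs merge_prog) + 22) * \<sigma>) * w"
  proof -
    obtain s' where "\<sigma> = Suc s'" using \<sigma>(1) by (cases \<sigma>) auto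
    then have "card (prog_regs merge_prog) + 16 + 6 * \<sigma> \<le> (card (prog_regs merge_prog) + 22) * \<sigma>"
      by (simp add: algebra_simps)
    then show ?thesis by (intro add_left_mono mult_le_mono1)
  qed
  finally have "work_bits w merge_prog s \<le> 4 * num + (card (prog_regs merge_prog) + 22) * \<sigma> * w" .
  moreover have "output_is s (boss_arrays (BOSS k CU))"
    by (rule output_is_written[OF k CU(2,1) ts(4)])
  ultimately show ?thesis
    unfolding merges_within_def using ts(1,3) unfolding inp_def by blast
qed

text \<open>The program is fixed before \<open>c\<close>: it finds the depth of the trie at run
  time, so \<open>c\<close> enters only the constant \<open>K\<close>.\<close>

theorem theorem1:
  shows "\<exists>P. \<forall>c. \<exists>K. \<forall>w \<sigma> k C0 C1 n0 n1 m0 m1 n m.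
    1 \<le> \<sigma> \<longrightarrow> \<sigma> \<le> w ^ c \<longrightarrow> 1 \<le> k \<longrightarrow>
    finite C0 \<longrightarrow> finite C1 \<longrightarrow> C0 \<union> C1 \<noteq> {} \<longrightarrow>
    (\<forall>s\<in>C0 \<union> C1. set s \<subseteq> {1..\<sigma>}) \<longrightarrow>
    n0 = card (nodes k C0) \<longrightarrow> n1 = card (nodes k C1) \<longrightarrow>
    m0 = length (boss_W (BOSS k C0)) \<longrightarrow> m1 = length (boss_W (BOSS k C1)) \<longrightarrow>
    n = n0 + n1 \<longrightarrow> m = m0 + m1 \<longrightarrow>
    m + k + \<sigma> < 2 ^ w \<longrightarrow>
    merges_within P w \<sigma> k (BOSS k C0) (BOSS k C1) (BOSS k (C0 \<union> C1))
      (K * (m * k)) (4 * n + K * \<sigma> * w)"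
proof (intro exI[of _ merge_prog] allI)
  fix c
  define K where "K = c * 400 + 1600 + (card (prog_regs merge_prog) + 22)"
  show "\<exists>K. \<forall>w \<sigma> k C0 C1 n0 n1 m0 m1 n m.
    1 \<le> \<sigma> \<longrightarrow> \<sigma> \<le> w ^ c \<longrightarrow> 1 \<le> k \<longrightarrow>
    finite C0 \<longrightarrow> finite C1 \<longrightarrow> C0 \<union> C1 \<noteq> {} \<longrightarrow>
    (\<forall>s\<in>C0 \<union> C1. set s \<subseteq> {1..\<sigma>}) \<longrightarrow>
    n0 = card (nodes k C0) \<longrightarrow> n1 = card (nodes k C1) \<longrightarrow>
    m0 = length (boss_W (BOSS k C0)) \<longrightarrow> m1 = length (boss_W (BOSS k C1)) \<longrightarrow>
    n = n0 + n1 \<longrightarrow> m = m0 + m1 \<longrightarrow>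
    m + k + \<sigma> < 2 ^ w \<longrightarrow>
    merges_within merge_prog w \<sigma> k (BOSS k C0) (BOSS k C1) (BOSS k (C0 \<union> C1))
      (K * (m * k)) (4 * n + K * \<sigma> * w)"
  proof (rule exI[of _ K], intro allI impI)
    fix w \<sigma> k C0 C1 n0 n1 m0 m1 n m
    assume a: "1 \<le> \<sigma>" "\<sigma> \<le> w ^ c" "1 \<le> k" "finite C0" "finite C1" "C0 \<union> C1 \<noteq> {}"
      "\<forall>s\<in>C0 \<union> C1. set s \<subseteq> {1..\<sigma>}" "n0 = card (nodes k C0)" "n1 = card (nodes k C1)"
      "m0 = length (boss_W (BOSS k C0))" "m1 = length (boss_W (BOSS k C1))" "n = n0 + n1" "m = m0 + m1"
      "m + k + \<sigma> < 2 ^ w"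
    let ?C = "\<lambda>b. if b then C1 else C0"
    interpret two_graphs k \<sigma> ?C
      by unfold_locales (use a in \<open>auto split: if_splits\<close>)
    have m: "length inputs = m"
    proof -
      have "length (boss_W (BOSS k D)) = length (graph_entries k D)" if "D \<in> {C0, C1}" for D
        using arg_cong[OF boss_arrays_eq[of k D \<sigma>], of hd] that a by (auto simp: boss_arrays_def)
      then show ?thesis using a by (simp add: inputs_def)
    qed
    interpret merge_run k \<sigma> ?C w
      by unfold_locales (use m a in simp)
    have n: "num = n" using num_eq a by simp
    have "merges_within merge_prog w \<sigma> k (BOSS k C0) (BOSS k C1) (BOSS k (C0 \<union> C1))
      ((c * 400 + 1600) * (m * k)) (4 * n + (card (prog_regs merge_prog) + 22) * \<sigma> * w)"
      using merges[OF a(1,2)] by (simp add: m n CU_def)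
    moreover have "(c * 400 + 1600) * (m * k) \<le> K * (m * k)" by (intro mult_le_mono1) (simp add: K_def)
    moreover have "(card (prog_regs merge_prog) + 22) * \<sigma> * w \<le> K * \<sigma> * w"
      by (intro mult_le_mono1) (simp add: K_def)
    ultimately show "merges_within merge_prog w \<sigma> k (BOSS k C0) (BOSS k C1) (BOSS k (C0 \<union> C1))
      (K * (m * k)) (4 * n + K * \<sigma> * w)"
      unfolding merges_within_def by (meson add_left_mono le_trans)
  qed
qed

end
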